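(* Let $\mathfrak k$ be a field, $n\ge 1$ an integer, and let $q\in\mathfrak k^*$ satisfy $q^2\ne 1$ and $[k]_q\neq 0$ for $2\le k\le n$. Let $A_n$ be either the Hecke algebra $H_n(q)$, or the Birman–Murakami–Wenzl algebra $BMW_n(q,\nu)$ with $\nu\in\mathfrak k\setminus\{0,q,-q^{-1}\}$ and $\nu\ne q^{2j-1}$ for $1\le j\le n-1$. Then the symmetrizer $S_n\in A_n$ is $$S_n=\frac{1}{[n]_q^{\$}}\;{}^{q}\Sigma_n ,$$ and, for $n\ge 2$, the symmetrizers satisfy the recurrence $$S_n=\frac{1}{[n]_q!}\;{}^{q}\mathrm{Sh}_{1,n-1}\,S_{n-1}.$$
   Context: Notation: $[n]_q=(q^n-q^{-n})/(q-q^{-1})$, $[n]_q!=[1]_q[2]_q\cdots[n]_q$, $[n]_q^{\$}=[1]_q!\,[2]_q!\cdots[n]_q!$. $B_n$ is the braid group with generators $\sigma_1,\dots,\sigma_{n-1}$ and relations $\sigma_i\sigma_j\sigma_i=\sigma_j\sigma_i\sigma_j$ for $|i-j|=1$, $\sigma_i\sigma_j=\sigma_j\sigma_i$ for $|i-j|>1$. $H_n(q)$ is the quotient of $\mathfrak k B_n$ by $\sigma_i^2=(q-q^{-1})\sigma_i+1$. $BMW_n(q,\nu)$ is the quotient of $\mathfrak kB_n$ by $\kappa_i\sigma_i=\sigma_i\kappa_i=\nu\kappa_i$, $\kappa_i\sigma_{i-1}\kappa_i=\nu^{-1}\kappa_i$, $\kappa_i\sigma_{i-1}^{-1}\kappa_i=\nu\kappa_i$,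 where $\kappa_i$ is defined by $\sigma_i-\sigma_i^{-1}=(q-q^{-1})(1-\kappa_i)$. The algebras $A_1=\mathfrak k\to A_2\to A_3\to\cdots$ map to each other by $\sigma_i\mapsto\sigma_i$. Baxterized elements: in the Hecke algebra, $\sigma_i(x)=\frac{1}{q-q^{-1}}(x\sigma_i-x^{-1}\sigma_i^{-1})$; in the BMW algebra, $$\sigma_i(x)=x^{-1}\Bigl(1+\frac{x^2-1}{q-q^{-1}}\sigma_i+\frac{x^2-1}{1-\nu^{-1}q^{-1}x^2}\kappa_i\Bigr).$$ These satisfy (known) $\sigma_i(x)\sigma_{i-1}(xy)\sigma_i(y)=\sigma_{i-1}(y)\sigma_i(xy)\sigma_{i-1}(x)$. Set ${}^{q}\mathrm{Sh}_{1,k}=\sigma_1(q)\sigma_2(q^2)\cdots\sigma_k(q^k)$ (with ${}^q\mathrm{Sh}_{1,0}=1$) and ${}^{q}\Sigma_n={}^{q}\mathrm{Sh}_{1,n-1}\,{}^{q}\mathrm{Sh}_{1,n-2}\cdots{}^{q}\mathrm{Sh}_{1,1}$ (with ${}^q\Sigma_1=1$). The symmetrizer $S_n$ is the unique non-zero element of $A_n$ with $\sigma_iS_n=S_n\sigma_i=qS_n$ for $i=1,\dots,n-1$ and $S_n^2=S_n$; $S_1=1$. *)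

theory Defs
  imports "HOL-Algebra.QuotRing"
begin

section \<open>Quantum integers and factorials\<close>

definition qint :: "'k::field \<Rightarrow> nat \<Rightarrow> 'k" where
  "qint q n = (q ^ n - inverse q ^ n) / (q - inverse q)"

definition qfact :: "'k::field \<Rightarrow> nat \<Rightarrow> 'k" where
  "qfact q n = (\<Prod>k=1..n. qint q k)"

definition qsuperfact :: "'k::field \<Rightarrow> nat \<Rightarrow> 'k" where
  "qsuperfact q n = (\<Prod>k=1..n. qfact q k)"


section \<open>The braid group on \<open>n\<close> strands\<close>

text \<open>
  The letter \<open>(i, True)\<close> stands for the generator \<open>\<sigma>\<^sub>i\<close> and \<open>(i, False)\<close> for its inverse.
  The group is presented as words modulo the least congruence containing the relations
  (including cancellation of a letter with its inverse).
\<close>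

type_synonym braid_word = "(nat \<times> bool) list"

definition braid_words :: "nat \<Rightarrow> braid_word set" where
  "braid_words n = lists ({1..<n} \<times> UNIV)"

inductive_set braid_cong :: "nat \<Rightarrow> (braid_word \<times> braid_word) set" for n :: nat where
  rel_refl: "w \<in> braid_words n \<Longrightarrow> (w, w) \<in> braid_cong n"
| rel_sym: "(u, v) \<in> braid_cong n \<Longrightarrow> (v, u) \<in> braid_cong n"
| rel_trans: "(u, v) \<in> braid_cong n \<Longrightarrow> (v, w) \<in> braid_cong n \<Longrightarrow> (u, w) \<in> braid_cong n"
| rel_append: "(u, v) \<in> braid_cong n \<Longrightarrow> (u', v') \<in> braid_cong n \<Longrightarrow> (u @ u', v @ v') \<in> braid_cong n"
| rel_cancel: "i \<in> {1..<n} \<Longrightarrow> ([(i, e), (i, \<not> e)], []) \<in> braid_cong n"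
| rel_braid: "i \<in> {1..<n} \<Longrightarrow> j \<in> {1..<n} \<Longrightarrow> \<bar>int i - int j\<bar> = 1 \<Longrightarrow>
    ([(i, True), (j, True), (i, True)], [(j, True), (i, True), (j, True)]) \<in> braid_cong n"
| rel_far: "i \<in> {1..<n} \<Longrightarrow> j \<in> {1..<n} \<Longrightarrow> \<bar>int i - int j\<bar> > 1 \<Longrightarrow>
    ([(i, True), (j, True)], [(j, True), (i, True)]) \<in> braid_cong n"

definition braid_group :: "nat \<Rightarrow> braid_word set monoid" where
  "braid_group n =
    \<lparr>carrier = braid_words n // braid_cong n,
     mult = (\<lambda>X Y. \<Union>u\<in>X. \<Union>v\<in>Y. braid_cong n `` {u @ v}),
     one = braid_cong n `` {[]}\<rparr>"

text \<open>The homomorphism \<open>B\<^sub>m \<rightarrow> B\<^sub>n\<close> (for \<open>m \<le> n\<close>) with \<open>\<sigma>\<^sub>i \<mapsto> \<sigma>\<^sub>i\<close>; only the target index is needed.\<close>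

definition braid_map :: "nat \<Rightarrow> braid_word set \<Rightarrow> braid_word set" where
  "braid_map n X = (\<Union>w\<in>X. braid_cong n `` {w})"


section \<open>Group algebras\<close>

text \<open>Elements are the finitely supported functions on the group; the product is convolution.\<close>

definition group_algebra :: "('g, 'm) monoid_scheme \<Rightarrow> ('g \<Rightarrow> 'k::field) ring" where
  "group_algebra G =
    \<lparr>carrier = {f. finite {x. f x \<noteq> 0} \<and> {x. f x \<noteq> 0} \<subseteq> carrier G},
     mult = (\<lambda>f g x. \<Sum>a | f a \<noteq> 0. \<Sum>b | g b \<noteq> 0. if a \<otimes>\<^bsub>G\<^esub> b = x then f a * g b else 0),
     one = (\<lambda>x. if x = \<one>\<^bsub>G\<^esub> then 1 else 0),
     zero = (\<lambda>x. 0),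
     add = (\<lambda>f g x. f x + g x)\<rparr>"

definition basis_elem :: "'g \<Rightarrow> 'g \<Rightarrow> 'k::field" where
  "basis_elem g = (\<lambda>x. if x = g then 1 else 0)"

text \<open>The structure map of the group algebra. The alg_scalar multiple \<open>c x\<close> is written as the product
  of \<open>c 1\<close> with \<open>x\<close>, both here and in the quotient algebras below.\<close>

definition scalar_elem :: "('g, 'm) monoid_scheme \<Rightarrow> 'k::field \<Rightarrow> 'g \<Rightarrow> 'k" where
  "scalar_elem G c = (\<lambda>x. if x = \<one>\<^bsub>G\<^esub> then c else 0)"

text \<open>The linear extension of a map of groups.\<close>

definition push_forward :: "('g \<Rightarrow> 'h) \<Rightarrow> ('g \<Rightarrow> 'k::field) \<Rightarrow> 'h \<Rightarrow> 'k" where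
  "push_forward \<phi> f = (\<lambda>y. \<Sum>x | f x \<noteq> 0 \<and> \<phi> x = y. f x)"

type_synonym 'k braid_alg_elem = "braid_word set \<Rightarrow> 'k"

definition kB :: "nat \<Rightarrow> 'k::field braid_alg_elem ring" where
  "kB n = group_algebra (braid_group n)"

definition kB_scalar :: "nat \<Rightarrow> 'k::field \<Rightarrow> 'k braid_alg_elem" where
  "kB_scalar n = scalar_elem (braid_group n)"

definition kB_sigma :: "nat \<Rightarrow> nat \<Rightarrow> 'k::field braid_alg_elem" where
  "kB_sigma n i = basis_elem (braid_cong n `` {[(i, True)]})"

definition kB_sigma_inv :: "nat \<Rightarrow> nat \<Rightarrow> 'k::field braid_alg_elem" where
  "kB_sigma_inv n i = basis_elem (braid_cong n `` {[(i, False)]})"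

text \<open>\<open>\<kappa>\<^sub>i\<close>, solved from \<open>\<sigma>\<^sub>i - \<sigma>\<^sub>i\<^sup>-\<^sup>1 = (q - q\<^sup>-\<^sup>1) (1 - \<kappa>\<^sub>i)\<close>.\<close>

definition kB_kappa :: "'k::field \<Rightarrow> nat \<Rightarrow> nat \<Rightarrow> 'k braid_alg_elem" where
  "kB_kappa q n i = \<one>\<^bsub>kB n\<^esub> \<ominus>\<^bsub>kB n\<^esub>
    kB_scalar n (1 / (q - inverse q)) \<otimes>\<^bsub>kB n\<^esub> (kB_sigma n i \<ominus>\<^bsub>kB n\<^esub> kB_sigma_inv n i)"


section \<open>Hecke and Birman--Murakami--Wenzl algebras\<close>

text \<open>\<open>Hecke\<close> selects the tower \<open>H\<^sub>n(q)\<close>, and \<open>BMW \<nu>\<close> the tower \<open>BMW\<^sub>n(q, \<nu>)\<close>.\<close>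

datatype 'k tower = Hecke | BMW 'k

fun relators :: "'k::field tower \<Rightarrow> 'k \<Rightarrow> nat \<Rightarrow> 'k braid_alg_elem set" where
  "relators Hecke q n =
    {kB_sigma n i \<otimes>\<^bsub>kB n\<^esub> kB_sigma n i \<ominus>\<^bsub>kB n\<^esub>
       (kB_scalar n (q - inverse q) \<otimes>\<^bsub>kB n\<^esub> kB_sigma n i \<oplus>\<^bsub>kB n\<^esub> \<one>\<^bsub>kB n\<^esub>) | i. i \<in> {1..<n}}"
| "relators (BMW \<nu>) q n =
    {kB_kappa q n i \<otimes>\<^bsub>kB n\<^esub> kB_sigma n i \<ominus>\<^bsub>kB n\<^esub>
       kB_scalar n \<nu> \<otimes>\<^bsub>kB n\<^esub> kB_kappa q n i | i. i \<in> {1..<n}} \<union>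
    {kB_sigma n i \<otimes>\<^bsub>kB n\<^esub> kB_kappa q n i \<ominus>\<^bsub>kB n\<^esub>
       kB_scalar n \<nu> \<otimes>\<^bsub>kB n\<^esub> kB_kappa q n i | i. i \<in> {1..<n}} \<union>
    {kB_kappa q n i \<otimes>\<^bsub>kB n\<^esub> kB_sigma n (i - 1) \<otimes>\<^bsub>kB n\<^esub> kB_kappa q n i \<ominus>\<^bsub>kB n\<^esub>
       kB_scalar n (inverse \<nu>) \<otimes>\<^bsub>kB n\<^esub> kB_kappa q n i | i. i \<in> {2..<n}} \<union>
    {kB_kappa q n i \<otimes>\<^bsub>kB n\<^esub> kB_sigma_inv n (i - 1) \<otimes>\<^bsub>kB n\<^esub> kB_kappa q n i \<ominus>\<^bsub>kB n\<^esub>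
       kB_scalar n \<nu> \<otimes>\<^bsub>kB n\<^esub> kB_kappa q n i | i. i \<in> {2..<n}}"

definition rel_ideal :: "'k::field tower \<Rightarrow> 'k \<Rightarrow> nat \<Rightarrow> 'k braid_alg_elem set" where
  "rel_ideal T q n = genideal (kB n) (relators T q n)"

definition alg :: "'k::field tower \<Rightarrow> 'k \<Rightarrow> nat \<Rightarrow> 'k braid_alg_elem set ring" where
  "alg T q n = kB n Quot rel_ideal T q n"

definition alg_proj :: "'k::field tower \<Rightarrow> 'k \<Rightarrow> nat \<Rightarrow> 'k braid_alg_elem \<Rightarrow> 'k braid_alg_elem set" where
  "alg_proj T q n f = rel_ideal T q n +>\<^bsub>kB n\<^esub> f"

definition alg_scalar :: "'k::field tower \<Rightarrow> 'k \<Rightarrow> nat \<Rightarrow> 'k \<Rightarrow> 'k braid_alg_elem set" where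
  "alg_scalar T q n c = alg_proj T q n (kB_scalar n c)"

definition alg_sigma :: "'k::field tower \<Rightarrow> 'k \<Rightarrow> nat \<Rightarrow> nat \<Rightarrow> 'k braid_alg_elem set" where
  "alg_sigma T q n i = alg_proj T q n (kB_sigma n i)"

definition alg_sigma_inv :: "'k::field tower \<Rightarrow> 'k \<Rightarrow> nat \<Rightarrow> nat \<Rightarrow> 'k braid_alg_elem set" where
  "alg_sigma_inv T q n i = alg_proj T q n (kB_sigma_inv n i)"

definition alg_kappa :: "'k::field tower \<Rightarrow> 'k \<Rightarrow> nat \<Rightarrow> nat \<Rightarrow> 'k braid_alg_elem set" where
  "alg_kappa T q n i = alg_proj T q n (kB_kappa q n i)"

text \<open>The algebra homomorphism \<open>A\<^sub>m \<rightarrow> A\<^sub>n\<close> (for \<open>m \<le> n\<close>) with \<open>\<sigma>\<^sub>i \<mapsto> \<sigma>\<^sub>i\<close>, induced on cosets by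
  the homomorphism of braid groups.\<close>

definition alg_map :: "'k::field tower \<Rightarrow> 'k \<Rightarrow> nat \<Rightarrow> 'k braid_alg_elem set \<Rightarrow> 'k braid_alg_elem set" where
  "alg_map T q n X = (\<Union>f\<in>X. alg_proj T q n (push_forward (braid_map n) f))"


section \<open>Baxterized elements and the symmetrizer\<close>

fun baxter :: "'k::field tower \<Rightarrow> 'k \<Rightarrow> nat \<Rightarrow> nat \<Rightarrow> 'k \<Rightarrow> 'k braid_alg_elem set" where
  "baxter Hecke q n i x =
    (let A = alg Hecke q n; c = alg_scalar Hecke q n in
      c (1 / (q - inverse q)) \<otimes>\<^bsub>A\<^esub>
        (c x \<otimes>\<^bsub>A\<^esub> alg_sigma Hecke q n i \<ominus>\<^bsub>A\<^esub> c (inverse x) \<otimes>\<^bsub>A\<^esub> alg_sigma_inv Hecke q n i))"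
| "baxter (BMW \<nu>) q n i x =
    (let A = alg (BMW \<nu>) q n; c = alg_scalar (BMW \<nu>) q n in
      c (inverse x) \<otimes>\<^bsub>A\<^esub>
        (\<one>\<^bsub>A\<^esub>
          \<oplus>\<^bsub>A\<^esub> c ((x\<^sup>2 - 1) / (q - inverse q)) \<otimes>\<^bsub>A\<^esub> alg_sigma (BMW \<nu>) q n i
          \<oplus>\<^bsub>A\<^esub> c ((x\<^sup>2 - 1) / (1 - inverse \<nu> * inverse q * x\<^sup>2)) \<otimes>\<^bsub>A\<^esub> alg_kappa (BMW \<nu>) q n i))"

text \<open>\<open>qSh T q n k\<close> and \<open>qSigma T q n m\<close> are \<open>\<^sup>qSh\<^sub>1\<^sub>,\<^sub>k\<close> and \<open>\<^sup>q\<Sigma>\<^sub>m\<close> as elements of \<open>A\<^sub>n\<close>.\<close>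

primrec qSh :: "'k::field tower \<Rightarrow> 'k \<Rightarrow> nat \<Rightarrow> nat \<Rightarrow> 'k braid_alg_elem set" where
  "qSh T q n 0 = \<one>\<^bsub>alg T q n\<^esub>"
| "qSh T q n (Suc k) = qSh T q n k \<otimes>\<^bsub>alg T q n\<^esub> baxter T q n (Suc k) (q ^ Suc k)"

primrec qSigma :: "'k::field tower \<Rightarrow> 'k \<Rightarrow> nat \<Rightarrow> nat \<Rightarrow> 'k braid_alg_elem set" where
  "qSigma T q n 0 = \<one>\<^bsub>alg T q n\<^esub>"
| "qSigma T q n (Suc m) = qSh T q n m \<otimes>\<^bsub>alg T q n\<^esub> qSigma T q n m"

definition is_symmetrizer :: "'k::field tower \<Rightarrow> 'k \<Rightarrow> nat \<Rightarrow> 'k braid_alg_elem set \<Rightarrow> bool" where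
  "is_symmetrizer T q n S \<longleftrightarrow>
    S \<in> carrier (alg T q n) \<and> S \<noteq> \<zero>\<^bsub>alg T q n\<^esub> \<and>
    (\<forall>i\<in>{1..<n}. alg_sigma T q n i \<otimes>\<^bsub>alg T q n\<^esub> S = alg_scalar T q n q \<otimes>\<^bsub>alg T q n\<^esub> S \<and>
                 S \<otimes>\<^bsub>alg T q n\<^esub> alg_sigma T q n i = alg_scalar T q n q \<otimes>\<^bsub>alg T q n\<^esub> S) \<and>
    S \<otimes>\<^bsub>alg T q n\<^esub> S = S"

definition symmetrizer :: "'k::field tower \<Rightarrow> 'k \<Rightarrow> nat \<Rightarrow> 'k braid_alg_elem set" where
  "symmetrizer T q n = (THE S. is_symmetrizer T q n S)"


section \<open>Well-definedness of the constructions\<close>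

lemma braid_cong_subset: "braid_cong n \<subseteq> braid_words n \<times> braid_words n"
proof -
  have "u \<in> braid_words n \<and> v \<in> braid_words n" if "(u, v) \<in> braid_cong n" for u v
    using that by induction (auto simp: braid_words_def)
  then show ?thesis by auto
qed

lemma equiv_braid_cong: "equiv (braid_words n) (braid_cong n)"
  using braid_cong_subset
  by (auto intro!: equivI refl_onI symI transI intro: braid_cong.intros)

lemma braid_mult_class:
  assumes "u \<in> braid_words n" "v \<in> braid_words n"
  shows "braid_cong n `` {u} \<otimes>\<^bsub>braid_group n\<^esub> braid_cong n `` {v} = braid_cong n `` {u @ v}"
proof -
  have "(\<lambda>u v. braid_cong n `` {u @ v}) respects2 braid_cong n"
    using equiv_class_eq[OF equiv_braid_cong]
    by (auto intro!: congruent2I' intro: braid_cong.rel_append)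
  from UN_equiv_class2[OF equiv_braid_cong equiv_braid_cong this assms]
  show ?thesis by (simp add: braid_group_def)
qed

lemma braid_inverse_word:
  "w \<in> braid_words n \<Longrightarrow> \<exists>v\<in>braid_words n. (v @ w, []) \<in> braid_cong n"
proof (induction w)
  case Nil
  then show ?case by (auto intro!: bexI[of _ "[]"] braid_cong.rel_refl simp: braid_words_def)
next
  case (Cons a w)
  obtain i e where a: "a = (i, e)" by (cases a)
  have i: "i \<in> {1..<n}" and w: "w \<in> braid_words n" using Cons.prems a by (auto simp: braid_words_def)
  obtain v where v: "v \<in> braid_words n" "(v @ w, []) \<in> braid_cong n" using Cons.IH w by blast
  have "([(i, \<not> e), (i, e)] @ w, [] @ w) \<in> braid_cong n"
    using braid_cong.rel_append[OF braid_cong.rel_cancel[OF i, of "\<not> e"] braid_cong.rel_refl[OF w]] by simp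
  from braid_cong.rel_append[OF braid_cong.rel_refl[OF v(1)] this]
  have "((v @ [(i, \<not> e)]) @ a # w, v @ w) \<in> braid_cong n" by (simp add: a)
  then have "((v @ [(i, \<not> e)]) @ a # w, []) \<in> braid_cong n"
    using v(2) by (rule braid_cong.rel_trans)
  moreover have "v @ [(i, \<not> e)] \<in> braid_words n" using v(1) i by (auto simp: braid_words_def)
  ultimately show ?case by blast
qed

lemma braid_words_append [simp]: "u @ v \<in> braid_words n \<longleftrightarrow> u \<in> braid_words n \<and> v \<in> braid_words n"
  by (auto simp: braid_words_def)

lemma Nil_braid_words [simp]: "[] \<in> braid_words n"
  by (simp add: braid_words_def)

lemma carrier_braid_group: "carrier (braid_group n) = (\<lambda>w. braid_cong n `` {w}) ` braid_words n"
  by (auto simp: braid_group_def quotient_def)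

lemma one_braid_group: "\<one>\<^bsub>braid_group n\<^esub> = braid_cong n `` {[]}"
  by (simp add: braid_group_def)

lemma group_braid_group: "group (braid_group n)"
proof (rule groupI)
  fix x assume "x \<in> carrier (braid_group n)"
  then obtain w where w: "w \<in> braid_words n" "x = braid_cong n `` {w}"
    by (auto simp: carrier_braid_group)
  obtain v where v: "v \<in> braid_words n" "(v @ w, []) \<in> braid_cong n"
    using braid_inverse_word[OF w(1)] by blast
  show "\<exists>y\<in>carrier (braid_group n). y \<otimes>\<^bsub>braid_group n\<^esub> x = \<one>\<^bsub>braid_group n\<^esub>"
    using v w equiv_class_eq[OF equiv_braid_cong v(2)]
    by (auto simp: carrier_braid_group one_braid_group braid_mult_class intro!: bexI[of _ v])
qed (auto simp: carrier_braid_group one_braid_group braid_mult_class)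

lemma group_algebra_mult_eq:
  assumes "finite A" "{x. f x \<noteq> 0} \<subseteq> A" "finite B" "{x. g x \<noteq> 0} \<subseteq> B"
  shows "(f \<otimes>\<^bsub>group_algebra G\<^esub> g) x =
    (\<Sum>a\<in>A. \<Sum>b\<in>B. if a \<otimes>\<^bsub>G\<^esub> b = x then f a * g b else 0)"
proof -
  have "(f \<otimes>\<^bsub>group_algebra G\<^esub> g) x =
      (\<Sum>a | f a \<noteq> 0. \<Sum>b | g b \<noteq> 0. if a \<otimes>\<^bsub>G\<^esub> b = x then f a * g b else 0)"
    by (simp add: group_algebra_def)
  also have "\<dots> = (\<Sum>a | f a \<noteq> 0. \<Sum>b\<in>B. if a \<otimes>\<^bsub>G\<^esub> b = x then f a * g b else 0)"
    using assms by (intro sum.cong refl sum.mono_neutral_left) auto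
  also have "\<dots> = (\<Sum>a\<in>A. \<Sum>b\<in>B. if a \<otimes>\<^bsub>G\<^esub> b = x then f a * g b else 0)"
    using assms by (intro sum.mono_neutral_left) (auto intro!: sum.neutral split: if_splits)
  finally show ?thesis .
qed

lemma group_algebra_carrier:
  "f \<in> carrier (group_algebra G) \<longleftrightarrow> finite {x. f x \<noteq> 0} \<and> {x. f x \<noteq> 0} \<subseteq> carrier G"
  by (simp add: group_algebra_def)

lemma group_algebra_mult_support:
  "{x. (f \<otimes>\<^bsub>group_algebra G\<^esub> g) x \<noteq> 0} \<subseteq>
    (\<lambda>(a, b). a \<otimes>\<^bsub>G\<^esub> b) ` ({x. f x \<noteq> 0} \<times> {x. g x \<noteq> 0})"
proof
  fix x assume "x \<in> {x. (f \<otimes>\<^bsub>group_algebra G\<^esub> g) x \<noteq> 0}"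
  then have "(\<Sum>a | f a \<noteq> 0. \<Sum>b | g b \<noteq> 0. if a \<otimes>\<^bsub>G\<^esub> b = x then f a * g b else 0) \<noteq> 0"
    by (simp add: group_algebra_def)
  then obtain a where a: "a \<in> {a. f a \<noteq> 0}"
      "(\<Sum>b | g b \<noteq> 0. if a \<otimes>\<^bsub>G\<^esub> b = x then f a * g b else 0) \<noteq> 0"
    by (rule sum.not_neutral_contains_not_neutral)
  from a(2) obtain b where "b \<in> {b. g b \<noteq> 0}" "(if a \<otimes>\<^bsub>G\<^esub> b = x then f a * g b else 0) \<noteq> 0"
    by (rule sum.not_neutral_contains_not_neutral)
  with a(1) show "x \<in> (\<lambda>(a, b). a \<otimes>\<^bsub>G\<^esub> b) ` ({x. f x \<noteq> 0} \<times> {x. g x \<noteq> 0})"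
    by (auto split: if_splits)
qed

lemma group_algebra_assoc:
  assumes G: "Group.monoid G"
    and f: "f \<in> carrier (group_algebra G)" and g: "g \<in> carrier (group_algebra G)"
    and h: "h \<in> carrier (group_algebra G)"
  shows "f \<otimes>\<^bsub>group_algebra G\<^esub> g \<otimes>\<^bsub>group_algebra G\<^esub> h =
    f \<otimes>\<^bsub>group_algebra G\<^esub> (g \<otimes>\<^bsub>group_algebra G\<^esub> h)"
proof
  fix x
  define A where "A = {x. f x \<noteq> 0}"
  define B where "B = {x. g x \<noteq> 0}"
  define C where "C = {x. h x \<noteq> 0}"
  have fin: "finite A" "finite B" "finite C" and sub: "A \<subseteq> carrier G" "B \<subseteq> carrier G" "C \<subseteq> carrier G"
    using f g h by (auto simp: group_algebra_carrier A_def B_def C_def)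
  define D where "D = (\<lambda>(a, b). a \<otimes>\<^bsub>G\<^esub> b) ` (A \<times> B)"
  define E where "E = (\<lambda>(a, b). a \<otimes>\<^bsub>G\<^esub> b) ` (B \<times> C)"
  have DE: "finite D" "finite E" using fin by (auto simp: D_def E_def)
  have "(f \<otimes>\<^bsub>group_algebra G\<^esub> g \<otimes>\<^bsub>group_algebra G\<^esub> h) x =
      (\<Sum>d\<in>D. \<Sum>c\<in>C. if d \<otimes>\<^bsub>G\<^esub> c = x then (f \<otimes>\<^bsub>group_algebra G\<^esub> g) d * h c else 0)"
    using DE fin by (intro group_algebra_mult_eq)
      (use group_algebra_mult_support[of G f g] in \<open>auto simp: A_def B_def C_def D_def\<close>)
  also have "\<dots> = (\<Sum>d\<in>D. \<Sum>c\<in>C. \<Sum>a\<in>A. \<Sum>b\<in>B.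
      if a \<otimes>\<^bsub>G\<^esub> b = d then (if a \<otimes>\<^bsub>G\<^esub> b \<otimes>\<^bsub>G\<^esub> c = x then f a * g b * h c else 0) else 0)"
    by (intro sum.cong refl)
      (auto simp: group_algebra_mult_eq[of A f B g] A_def B_def fin[unfolded A_def B_def]
        sum_distrib_right intro!: sum.cong sum.neutral)
  also have "\<dots> = (\<Sum>c\<in>C. \<Sum>a\<in>A. \<Sum>b\<in>B. \<Sum>d\<in>D.
      if a \<otimes>\<^bsub>G\<^esub> b = d then (if a \<otimes>\<^bsub>G\<^esub> b \<otimes>\<^bsub>G\<^esub> c = x then f a * g b * h c else 0) else 0)"
    by (rule trans[OF sum.swap], rule sum.cong[OF refl], rule trans[OF sum.swap], rule sum.cong[OF refl],
        rule sum.swap)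
  also have "\<dots> = (\<Sum>c\<in>C. \<Sum>a\<in>A. \<Sum>b\<in>B.
      if a \<otimes>\<^bsub>G\<^esub> b \<otimes>\<^bsub>G\<^esub> c = x then f a * g b * h c else 0)"
    using DE by (intro sum.cong refl) (auto simp: D_def)
  also have "\<dots> = (\<Sum>a\<in>A. \<Sum>b\<in>B. \<Sum>c\<in>C.
      if a \<otimes>\<^bsub>G\<^esub> b \<otimes>\<^bsub>G\<^esub> c = x then f a * g b * h c else 0)"
    by (rule trans[OF sum.swap], rule sum.cong[OF refl], rule sum.swap)
  also have "\<dots> = (\<Sum>a\<in>A. \<Sum>b\<in>B. \<Sum>c\<in>C.
      if a \<otimes>\<^bsub>G\<^esub> (b \<otimes>\<^bsub>G\<^esub> c) = x then f a * (g b * h c) else 0)"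
    using sub by (intro sum.cong refl) (auto simp: monoid.m_assoc[OF G] subset_iff mult.assoc)
  also have "\<dots> = (\<Sum>a\<in>A. \<Sum>b\<in>B. \<Sum>c\<in>C. \<Sum>d\<in>E.
      if b \<otimes>\<^bsub>G\<^esub> c = d then (if a \<otimes>\<^bsub>G\<^esub> (b \<otimes>\<^bsub>G\<^esub> c) = x then f a * (g b * h c) else 0) else 0)"
    using DE by (intro sum.cong refl) (auto simp: E_def)
  also have "\<dots> = (\<Sum>a\<in>A. \<Sum>d\<in>E. \<Sum>b\<in>B. \<Sum>c\<in>C.
      if b \<otimes>\<^bsub>G\<^esub> c = d then (if a \<otimes>\<^bsub>G\<^esub> (b \<otimes>\<^bsub>G\<^esub> c) = x then f a * (g b * h c) else 0) else 0)"
    by (rule sum.cong[OF refl], rule sym, rule trans[OF sum.swap], rule sum.cong[OF refl], rule sum.swap)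
  also have "\<dots> = (\<Sum>a\<in>A. \<Sum>d\<in>E. if a \<otimes>\<^bsub>G\<^esub> d = x then f a * (g \<otimes>\<^bsub>group_algebra G\<^esub> h) d else 0)"
    by (intro sum.cong refl)
      (auto simp: group_algebra_mult_eq[of B g C h] C_def B_def fin[unfolded C_def B_def]
        sum_distrib_left intro!: sum.cong sum.neutral)
  also have "\<dots> = (f \<otimes>\<^bsub>group_algebra G\<^esub> (g \<otimes>\<^bsub>group_algebra G\<^esub> h)) x"
    using DE fin by (intro group_algebra_mult_eq[symmetric])
      (use group_algebra_mult_support[of G g h] in \<open>auto simp: A_def B_def C_def E_def\<close>)
  finally show "(f \<otimes>\<^bsub>group_algebra G\<^esub> g \<otimes>\<^bsub>group_algebra G\<^esub> h) x =
    (f \<otimes>\<^bsub>group_algebra G\<^esub> (g \<otimes>\<^bsub>group_algebra G\<^esub> h)) x" .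
qed

lemma group_algebra_add_support:
  fixes f g :: "'a \<Rightarrow> 'k::field"
  shows "{x. f x + g x \<noteq> 0} \<subseteq> {x. f x \<noteq> 0} \<union> {x. g x \<noteq> 0}"
  by auto

lemma group_algebra_ring:
  assumes G: "Group.monoid G"
  shows "ring (group_algebra G :: ('g \<Rightarrow> 'k::field) ring)" (is "ring ?R")
proof (rule ringI)
  have add: "(f \<oplus>\<^bsub>?R\<^esub> g) = (\<lambda>x. f x + g x)" for f g by (simp add: group_algebra_def)
  have zero: "\<zero>\<^bsub>?R\<^esub> = (\<lambda>x. 0)" by (simp add: group_algebra_def)
  have one: "\<one>\<^bsub>?R\<^esub> = (\<lambda>x. if x = \<one>\<^bsub>G\<^esub> then 1 else 0)" by (simp add: group_algebra_def)
  have add_closed: "f \<oplus>\<^bsub>?R\<^esub> g \<in> carrier ?R" if "f \<in> carrier ?R" "g \<in> carrier ?R" for f g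
    using that finite_subset[OF group_algebra_add_support[of f g]] group_algebra_add_support[of f g]
    by (auto simp: group_algebra_carrier add)
  have mult_closed: "f \<otimes>\<^bsub>?R\<^esub> g \<in> carrier ?R" if "f \<in> carrier ?R" "g \<in> carrier ?R" for f g
  proof -
    have "(\<lambda>(a, b). a \<otimes>\<^bsub>G\<^esub> b) ` ({x. f x \<noteq> 0} \<times> {x. g x \<noteq> 0}) \<subseteq> carrier G"
      using that by (auto simp: group_algebra_carrier intro!: monoid.m_closed[OF G])
    moreover have "finite ((\<lambda>(a, b). a \<otimes>\<^bsub>G\<^esub> b) ` ({x. f x \<noteq> 0} \<times> {x. g x \<noteq> 0}))"
      using that by (auto simp: group_algebra_carrier)
    ultimately show ?thesis
      unfolding group_algebra_carrier
      by (intro conjI finite_subset[OF group_algebra_mult_support]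
          order.trans[OF group_algebra_mult_support])
  qed
  have one_closed: "\<one>\<^bsub>?R\<^esub> \<in> carrier ?R"
    using monoid.one_closed[OF G] by (auto simp: group_algebra_carrier one)
  show "abelian_group ?R"
  proof (rule abelian_groupI)
    fix f assume f: "f \<in> carrier ?R"
    then show "\<exists>g\<in>carrier ?R. g \<oplus>\<^bsub>?R\<^esub> f = \<zero>\<^bsub>?R\<^esub>"
      by (intro bexI[of _ "\<lambda>x. - f x"]) (auto simp: group_algebra_carrier add zero)
  qed (simp_all add: add_closed, auto simp: group_algebra_carrier add zero add_ac)
  show "Group.monoid ?R"
  proof (rule Group.monoidI)
    fix f assume f: "f \<in> carrier ?R"
    let ?A = "{x. f x \<noteq> 0}"
    have fin: "finite ?A" and sub: "?A \<subseteq> carrier G" using f by (auto simp: group_algebra_carrier)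
    show "\<one>\<^bsub>?R\<^esub> \<otimes>\<^bsub>?R\<^esub> f = f"
    proof
      fix x
      have "(\<one>\<^bsub>?R\<^esub> \<otimes>\<^bsub>?R\<^esub> f) x = (\<Sum>b\<in>?A. if \<one>\<^bsub>G\<^esub> \<otimes>\<^bsub>G\<^esub> b = x then f b else 0)"
        using fin by (subst group_algebra_mult_eq[of "{\<one>\<^bsub>G\<^esub>}" _ ?A]) (auto simp: one intro!: sum.cong)
      also have "\<dots> = (\<Sum>b\<in>?A. if b = x then f b else 0)"
        using sub by (intro sum.cong refl) (auto simp: monoid.l_one[OF G] subset_iff)
      also have "\<dots> = f x" using fin by (simp add: sum.delta')
      finally show "(\<one>\<^bsub>?R\<^esub> \<otimes>\<^bsub>?R\<^esub> f) x = f x" .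
    qed
    show "f \<otimes>\<^bsub>?R\<^esub> \<one>\<^bsub>?R\<^esub> = f"
    proof
      fix x
      have "(f \<otimes>\<^bsub>?R\<^esub> \<one>\<^bsub>?R\<^esub>) x = (\<Sum>b\<in>?A. if b \<otimes>\<^bsub>G\<^esub> \<one>\<^bsub>G\<^esub> = x then f b else 0)"
        using fin by (subst group_algebra_mult_eq[of ?A _ "{\<one>\<^bsub>G\<^esub>}"]) (auto simp: one intro!: sum.cong)
      also have "\<dots> = (\<Sum>b\<in>?A. if b = x then f b else 0)"
        using sub by (intro sum.cong refl) (auto simp: monoid.r_one[OF G] subset_iff)
      also have "\<dots> = f x" using fin by (simp add: sum.delta')
      finally show "(f \<otimes>\<^bsub>?R\<^esub> \<one>\<^bsub>?R\<^esub>) x = f x" .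
    qed
  qed (simp_all add: mult_closed one_closed group_algebra_assoc[OF G])
  fix f g h assume f: "f \<in> carrier ?R" and g: "g \<in> carrier ?R" and h: "h \<in> carrier ?R"
  let ?A = "{x. f x \<noteq> 0} \<union> {x. g x \<noteq> 0}" and ?C = "{x. h x \<noteq> 0}"
  have fin: "finite ?A" "finite ?C" using f g h by (auto simp: group_algebra_carrier)
  have 1: "(u \<otimes>\<^bsub>?R\<^esub> h) x = (\<Sum>a\<in>?A. \<Sum>b\<in>?C. if a \<otimes>\<^bsub>G\<^esub> b = x then u a * h b else 0)"
    if "{x. u x \<noteq> 0} \<subseteq> ?A" for u x
    using that fin by (intro group_algebra_mult_eq) auto
  have 2: "(h \<otimes>\<^bsub>?R\<^esub> u) x = (\<Sum>a\<in>?C. \<Sum>b\<in>?A. if a \<otimes>\<^bsub>G\<^esub> b = x then h a * u b else 0)"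
    if "{x. u x \<noteq> 0} \<subseteq> ?A" for u x
    using that fin by (intro group_algebra_mult_eq) auto
  have 3: "{x. (f \<oplus>\<^bsub>?R\<^esub> g) x \<noteq> 0} \<subseteq> ?A" "{x. f x \<noteq> 0} \<subseteq> ?A" "{x. g x \<noteq> 0} \<subseteq> ?A"
    by (auto simp: add)
  show "(f \<oplus>\<^bsub>?R\<^esub> g) \<otimes>\<^bsub>?R\<^esub> h = f \<otimes>\<^bsub>?R\<^esub> h \<oplus>\<^bsub>?R\<^esub> g \<otimes>\<^bsub>?R\<^esub> h"
    unfolding add[of "f \<otimes>\<^bsub>?R\<^esub> h"] fun_eq_iff 1[OF 3(1)] 1[OF 3(2)] 1[OF 3(3)]
    by (auto simp: add sum.distrib[symmetric] distrib_right intro!: sum.cong)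
  show "h \<otimes>\<^bsub>?R\<^esub> (f \<oplus>\<^bsub>?R\<^esub> g) = h \<otimes>\<^bsub>?R\<^esub> f \<oplus>\<^bsub>?R\<^esub> h \<otimes>\<^bsub>?R\<^esub> g"
    unfolding add[of "h \<otimes>\<^bsub>?R\<^esub> f"] fun_eq_iff 2[OF 3(1)] 2[OF 3(2)] 2[OF 3(3)]
    by (auto simp: add sum.distrib[symmetric] distrib_left intro!: sum.cong)
qed

lemma ring_kB: "ring (kB n)"
  unfolding kB_def by (intro group_algebra_ring group.is_monoid group_braid_group)


lemma push_forward_eq:
  assumes "finite A" "{x. f x \<noteq> 0} \<subseteq> A"
  shows "push_forward \<phi> f y = (\<Sum>x\<in>A. if \<phi> x = y then f x else 0)"
proof -
  have "push_forward \<phi> f y = (\<Sum>x\<in>{x\<in>A. \<phi> x = y}. f x)"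
    unfolding push_forward_def using assms by (intro sum.mono_neutral_left) auto
  also have "\<dots> = (\<Sum>x\<in>A. if \<phi> x = y then f x else 0)"
    using assms(1) by (simp add: sum.inter_filter)
  finally show ?thesis .
qed

lemma push_forward_support: "{y. push_forward \<phi> f y \<noteq> 0} \<subseteq> \<phi> ` {x. f x \<noteq> 0}"
proof
  fix y assume "y \<in> {y. push_forward \<phi> f y \<noteq> 0}"
  then have "(\<Sum>x | f x \<noteq> 0 \<and> \<phi> x = y. f x) \<noteq> 0" by (simp add: push_forward_def)
  then obtain x where "x \<in> {x. f x \<noteq> 0 \<and> \<phi> x = y}"
    by (rule sum.not_neutral_contains_not_neutral)
  then show "y \<in> \<phi> ` {x. f x \<noteq> 0}" by auto
qed

lemma sum_swap_pairs:
  "(\<Sum>a\<in>A. \<Sum>b\<in>B. \<Sum>u\<in>U. \<Sum>v\<in>V. F a b u v) = (\<Sum>u\<in>U. \<Sum>v\<in>V. \<Sum>a\<in>A. \<Sum>b\<in>B. F a b u v)"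
proof -
  have "(\<Sum>a\<in>A. \<Sum>b\<in>B. \<Sum>u\<in>U. \<Sum>v\<in>V. F a b u v) = (\<Sum>a\<in>A. \<Sum>u\<in>U. \<Sum>b\<in>B. \<Sum>v\<in>V. F a b u v)"
    by (rule sum.cong[OF refl], rule sum.swap)
  also have "\<dots> = (\<Sum>u\<in>U. \<Sum>a\<in>A. \<Sum>b\<in>B. \<Sum>v\<in>V. F a b u v)"
    by (rule sum.swap)
  also have "\<dots> = (\<Sum>u\<in>U. \<Sum>a\<in>A. \<Sum>v\<in>V. \<Sum>b\<in>B. F a b u v)"
    by (rule sum.cong[OF refl], rule sum.cong[OF refl], rule sum.swap)
  also have "\<dots> = (\<Sum>u\<in>U. \<Sum>v\<in>V. \<Sum>a\<in>A. \<Sum>b\<in>B. F a b u v)"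
    by (rule sum.cong[OF refl], rule sum.swap)
  finally show ?thesis .
qed

lemma push_forward_ring_hom:
  fixes G :: "('g, 'm) monoid_scheme" and H :: "('h, 'n) monoid_scheme"
  assumes G: "group G" and H: "group H" and \<phi>: "\<phi> \<in> hom G H"
  shows "push_forward \<phi> \<in> ring_hom (group_algebra G) (group_algebra H :: ('h \<Rightarrow> 'k::field) ring)"
    (is "_ \<in> ring_hom ?R ?S")
proof (rule ring_hom_memI)
  fix f assume f: "f \<in> carrier ?R"
  have "\<phi> ` {x. f x \<noteq> 0} \<subseteq> carrier H" "finite (\<phi> ` {x. f x \<noteq> 0})"
    using f \<phi> by (auto simp: group_algebra_carrier hom_def)
  then show "push_forward \<phi> f \<in> carrier ?S"
    unfolding group_algebra_carrier
    by (intro conjI finite_subset[OF push_forward_support] order.trans[OF push_forward_support])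
  fix g assume g: "g \<in> carrier ?R"
  define A where "A = {x. f x \<noteq> 0}"
  define B where "B = {x. g x \<noteq> 0}"
  define D where "D = (\<lambda>(a, b). a \<otimes>\<^bsub>G\<^esub> b) ` (A \<times> B)"
  have fin: "finite A" "finite B" "finite D" and sub: "A \<subseteq> carrier G" "B \<subseteq> carrier G"
    using f g by (auto simp: group_algebra_carrier A_def B_def D_def)
  show "push_forward \<phi> (f \<oplus>\<^bsub>?R\<^esub> g) = push_forward \<phi> f \<oplus>\<^bsub>?S\<^esub> push_forward \<phi> g"
  proof
    fix y
    show "push_forward \<phi> (f \<oplus>\<^bsub>?R\<^esub> g) y = (push_forward \<phi> f \<oplus>\<^bsub>?S\<^esub> push_forward \<phi> g) y"
      using fin push_forward_eq[of "A \<union> B" f \<phi> y] push_forward_eq[of "A \<union> B" g \<phi> y]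
        push_forward_eq[of "A \<union> B" "\<lambda>x. f x + g x" \<phi> y]
        group_algebra_add_support[of f g]
      by (auto simp: A_def B_def group_algebra_def sum.distrib[symmetric] intro!: sum.cong)
  qed
  show "push_forward \<phi> (f \<otimes>\<^bsub>?R\<^esub> g) = push_forward \<phi> f \<otimes>\<^bsub>?S\<^esub> push_forward \<phi> g"
  proof
    fix y
    have "push_forward \<phi> (f \<otimes>\<^bsub>?R\<^esub> g) y = (\<Sum>d\<in>D. if \<phi> d = y then (f \<otimes>\<^bsub>?R\<^esub> g) d else 0)"
      using fin group_algebra_mult_support[of G f g]
      by (intro push_forward_eq) (auto simp: A_def B_def D_def)
    also have "\<dots> = (\<Sum>d\<in>D. \<Sum>a\<in>A. \<Sum>b\<in>B.
        if a \<otimes>\<^bsub>G\<^esub> b = d then (if \<phi> (a \<otimes>\<^bsub>G\<^esub> b) = y then f a * g b else 0) else 0)"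
      by (intro sum.cong refl)
        (auto simp: group_algebra_mult_eq[of A f B g] A_def B_def fin[unfolded A_def B_def]
          intro!: sum.cong sum.neutral)
    also have "\<dots> = (\<Sum>a\<in>A. \<Sum>b\<in>B. \<Sum>d\<in>D.
        if a \<otimes>\<^bsub>G\<^esub> b = d then (if \<phi> (a \<otimes>\<^bsub>G\<^esub> b) = y then f a * g b else 0) else 0)"
      by (rule trans[OF sum.swap], rule sum.cong[OF refl], rule sum.swap)
    also have "\<dots> = (\<Sum>a\<in>A. \<Sum>b\<in>B. if \<phi> a \<otimes>\<^bsub>H\<^esub> \<phi> b = y then f a * g b else 0)"
      using fin sub \<phi> by (intro sum.cong refl) (auto simp: D_def hom_def subset_iff)
    also have "\<dots> = (\<Sum>a\<in>A. \<Sum>b\<in>B. \<Sum>u\<in>\<phi>`A. \<Sum>v\<in>\<phi>`B. if \<phi> b = v then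
        (if \<phi> a = u then (if u \<otimes>\<^bsub>H\<^esub> v = y then f a * g b else 0) else 0) else 0)"
      using fin by (intro sum.cong refl) (simp add: sum.delta sum.delta')
    also have "\<dots> = (\<Sum>u\<in>\<phi>`A. \<Sum>v\<in>\<phi>`B. \<Sum>a\<in>A. \<Sum>b\<in>B. if \<phi> b = v then
        (if \<phi> a = u then (if u \<otimes>\<^bsub>H\<^esub> v = y then f a * g b else 0) else 0) else 0)"
      by (rule sum_swap_pairs)
    also have "\<dots> = (\<Sum>u\<in>\<phi>`A. \<Sum>v\<in>\<phi>`B. if u \<otimes>\<^bsub>H\<^esub> v = y
        then push_forward \<phi> f u * push_forward \<phi> g v else 0)"
      by (intro sum.cong refl)
        (auto simp: push_forward_eq[of A f] push_forward_eq[of B g] fin A_def[symmetric]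
          B_def[symmetric] sum_product intro!: sum.cong sum.neutral)
    also have "\<dots> = (push_forward \<phi> f \<otimes>\<^bsub>?S\<^esub> push_forward \<phi> g) y"
      using fin push_forward_support[of \<phi> f] push_forward_support[of \<phi> g]
      by (intro group_algebra_mult_eq[symmetric]) (auto simp: A_def B_def)
    finally show "push_forward \<phi> (f \<otimes>\<^bsub>?R\<^esub> g) y = (push_forward \<phi> f \<otimes>\<^bsub>?S\<^esub> push_forward \<phi> g) y" .
  qed
next
  have "\<phi> \<one>\<^bsub>G\<^esub> = \<one>\<^bsub>H\<^esub>" using G H \<phi> by (simp add: hom_one)
  then show "push_forward \<phi> \<one>\<^bsub>?R\<^esub> = \<one>\<^bsub>?S\<^esub>"
    by (auto simp: fun_eq_iff push_forward_eq[of "{\<one>\<^bsub>G\<^esub>}"] group_algebra_def)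
qed

lemma braid_cong_mono: "m \<le> n \<Longrightarrow> braid_cong m \<subseteq> braid_cong n"
proof -
  assume mn: "m \<le> n"
  have "(u, v) \<in> braid_cong n" if "(u, v) \<in> braid_cong m" for u v
    using that
  proof induction
    case (rel_refl w)
    then show ?case using mn by (intro braid_cong.rel_refl) (fastforce simp: braid_words_def)
  next
    case (rel_cancel i e)
    then show ?case using mn by (intro braid_cong.rel_cancel) auto
  next
    case (rel_braid i j)
    then show ?case using mn by (intro braid_cong.rel_braid) auto
  next
    case (rel_far i j)
    then show ?case using mn by (intro braid_cong.rel_far) auto
  qed (blast intro: braid_cong.intros)+
  then show ?thesis by auto
qed

lemma braid_words_mono: "m \<le> n \<Longrightarrow> w \<in> braid_words m \<Longrightarrow> w \<in> braid_words n"
  by (fastforce simp: braid_words_def)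

lemma braid_map_class:
  assumes "m \<le> n" "w \<in> braid_words m"
  shows "braid_map n (braid_cong m `` {w}) = braid_cong n `` {w}"
proof -
  have "(\<lambda>w. braid_cong n `` {w}) respects braid_cong m"
    using braid_cong_mono[OF assms(1)] unfolding congruent_def
    by (auto simp del: Image_singleton_iff intro!: equiv_class_eq[OF equiv_braid_cong])
  from UN_equiv_class[OF equiv_braid_cong this assms(2)] show ?thesis by (simp add: braid_map_def)
qed

lemma braid_map_hom: "m \<le> n \<Longrightarrow> braid_map n \<in> hom (braid_group m) (braid_group n)"
  by (auto simp: hom_def carrier_braid_group braid_mult_class braid_map_class braid_words_mono)

lemma push_ring_hom_ring:
  assumes "m \<le> n" shows "ring_hom_ring (kB m) (kB n) (push_forward (braid_map n))"
  unfolding kB_def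
  by (intro ring_hom_ringI2 group_algebra_ring push_forward_ring_hom group.is_monoid
      group_braid_group braid_map_hom assms)

lemma push_basis: "push_forward \<phi> (basis_elem g) = basis_elem (\<phi> g)"
  by (auto simp: fun_eq_iff push_forward_eq[of "{g}"] basis_elem_def)

lemma kB_closed [simp]:
  "i \<in> {1..<n} \<Longrightarrow> kB_sigma n i \<in> carrier (kB n)"
  "i \<in> {1..<n} \<Longrightarrow> kB_sigma_inv n i \<in> carrier (kB n)"
  "kB_scalar n c \<in> carrier (kB n)"
  by (auto simp: kB_def group_algebra_carrier kB_sigma_def kB_sigma_inv_def kB_scalar_def
      scalar_elem_def basis_elem_def carrier_braid_group one_braid_group braid_words_def)

lemma kB_kappa_closed [simp]: "i \<in> {1..<n} \<Longrightarrow> kB_kappa q n i \<in> carrier (kB n)"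
  unfolding kB_kappa_def
  by (intro ring.ring_simprules(1-6) ring.ring_simprules(4) abelian_group.minus_closed
      ring.is_abelian_group ring_kB kB_closed)

lemma push_kB_sigma:
  assumes "m \<le> n" "i \<in> {1..<m}"
  shows "push_forward (braid_map n) (kB_sigma m i) = kB_sigma n i"
    and "push_forward (braid_map n) (kB_sigma_inv m i) = kB_sigma_inv n i"
  using assms by (auto simp: kB_sigma_def kB_sigma_inv_def push_basis braid_map_class braid_words_def)

lemma push_kB_scalar:
  assumes "m \<le> n"
  shows "push_forward (braid_map n) (kB_scalar m c) = kB_scalar n c"
proof -
  have "push_forward (braid_map n) (kB_scalar m c) y = kB_scalar n c y" for y
    by (subst push_forward_eq[of "{\<one>\<^bsub>braid_group m\<^esub>}"])
      (auto simp: kB_scalar_def scalar_elem_def one_braid_group braid_map_class[OF assms]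
        simp del: Image_singleton_iff)
  then show ?thesis by blast
qed

lemma push_minus:
  assumes "m \<le> n" "f \<in> carrier (kB m)" "g \<in> carrier (kB m)"
  shows "push_forward (braid_map n) (f \<ominus>\<^bsub>kB m\<^esub> g) =
    push_forward (braid_map n) f \<ominus>\<^bsub>kB n\<^esub> push_forward (braid_map n) g"
proof -
  interpret ring_hom_ring "kB m" "kB n" "push_forward (braid_map n)"
    by (rule push_ring_hom_ring[OF assms(1)])
  show ?thesis using assms by (simp add: a_minus_def)
qed

lemma push_kB_kappa:
  assumes "m \<le> n" "i \<in> {1..<m}"
  shows "push_forward (braid_map n) (kB_kappa q m i) = kB_kappa q n i"
proof -
  interpret ring_hom_ring "kB m" "kB n" "push_forward (braid_map n)"
    by (rule push_ring_hom_ring[OF assms(1)])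
  show ?thesis using assms
    by (simp add: kB_kappa_def push_minus push_kB_sigma push_kB_scalar)
qed

lemma relators_closed: "relators T q n \<subseteq> carrier (kB n)"
proof -
  interpret ring "kB n" by (rule ring_kB)
  show ?thesis by (cases T) (auto intro!: minus_closed m_closed add.m_closed kB_closed kB_kappa_closed)
qed

lemma push_relators:
  assumes "m \<le> n" shows "push_forward (braid_map n) ` relators T q m \<subseteq> relators T q n"
proof -
  interpret ring_hom_ring "kB m" "kB n" "push_forward (braid_map n)"
    by (rule push_ring_hom_ring[OF assms(1)])
  let ?p = "push_forward (braid_map n)"
  have r0: "?p (kB_sigma m i \<otimes>\<^bsub>kB m\<^esub> kB_sigma m i \<ominus>\<^bsub>kB m\<^esub> (kB_scalar m (q - inverse q) \<otimes>\<^bsub>kB m\<^esub> kB_sigma m i \<oplus>\<^bsub>kB m\<^esub> \<one>\<^bsub>kB m\<^esub>)) \<in> relators Hecke q n"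
    if "i \<in> {1..<m}" for i
  proof -
    have i: "i \<in> {1..<m}" "i \<in> {1..<n}" using that assms by auto
    have "?p (kB_sigma m i \<otimes>\<^bsub>kB m\<^esub> kB_sigma m i \<ominus>\<^bsub>kB m\<^esub> (kB_scalar m (q - inverse q) \<otimes>\<^bsub>kB m\<^esub> kB_sigma m i \<oplus>\<^bsub>kB m\<^esub> \<one>\<^bsub>kB m\<^esub>)) =
        kB_sigma n i \<otimes>\<^bsub>kB n\<^esub> kB_sigma n i \<ominus>\<^bsub>kB n\<^esub> (kB_scalar n (q - inverse q) \<otimes>\<^bsub>kB n\<^esub> kB_sigma n i \<oplus>\<^bsub>kB n\<^esub> \<one>\<^bsub>kB n\<^esub>)"
      using i by (simp add: push_minus[OF assms] push_kB_sigma[OF assms] push_kB_scalar[OF assms]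
          push_kB_kappa[OF assms] del: atLeastLessThan_iff One_nat_def)
    then show ?thesis using i unfolding relators.simps by blast
  qed
  have r1: "?p (kB_kappa q m i \<otimes>\<^bsub>kB m\<^esub> kB_sigma m i \<ominus>\<^bsub>kB m\<^esub> kB_scalar m \<nu> \<otimes>\<^bsub>kB m\<^esub> kB_kappa q m i) \<in> relators (BMW \<nu>) q n"
    if "i \<in> {1..<m}" for i \<nu>
  proof -
    have i: "i \<in> {1..<m}" "i \<in> {1..<n}" using that assms by auto
    have "?p (kB_kappa q m i \<otimes>\<^bsub>kB m\<^esub> kB_sigma m i \<ominus>\<^bsub>kB m\<^esub> kB_scalar m \<nu> \<otimes>\<^bsub>kB m\<^esub> kB_kappa q m i) =
        kB_kappa q n i \<otimes>\<^bsub>kB n\<^esub> kB_sigma n i \<ominus>\<^bsub>kB n\<^esub> kB_scalar n \<nu> \<otimes>\<^bsub>kB n\<^esub> kB_kappa q n i"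
      using i by (simp add: push_minus[OF assms] push_kB_sigma[OF assms] push_kB_scalar[OF assms]
          push_kB_kappa[OF assms] del: atLeastLessThan_iff One_nat_def)
    then show ?thesis using i unfolding relators.simps by blast
  qed
  have r2: "?p (kB_sigma m i \<otimes>\<^bsub>kB m\<^esub> kB_kappa q m i \<ominus>\<^bsub>kB m\<^esub> kB_scalar m \<nu> \<otimes>\<^bsub>kB m\<^esub> kB_kappa q m i) \<in> relators (BMW \<nu>) q n"
    if "i \<in> {1..<m}" for i \<nu>
  proof -
    have i: "i \<in> {1..<m}" "i \<in> {1..<n}" using that assms by auto
    have "?p (kB_sigma m i \<otimes>\<^bsub>kB m\<^esub> kB_kappa q m i \<ominus>\<^bsub>kB m\<^esub> kB_scalar m \<nu> \<otimes>\<^bsub>kB m\<^esub> kB_kappa q m i) =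
        kB_sigma n i \<otimes>\<^bsub>kB n\<^esub> kB_kappa q n i \<ominus>\<^bsub>kB n\<^esub> kB_scalar n \<nu> \<otimes>\<^bsub>kB n\<^esub> kB_kappa q n i"
      using i by (simp add: push_minus[OF assms] push_kB_sigma[OF assms] push_kB_scalar[OF assms]
          push_kB_kappa[OF assms] del: atLeastLessThan_iff One_nat_def)
    then show ?thesis using i unfolding relators.simps by blast
  qed
  have r3: "?p (kB_kappa q m i \<otimes>\<^bsub>kB m\<^esub> kB_sigma m (i - 1) \<otimes>\<^bsub>kB m\<^esub> kB_kappa q m i \<ominus>\<^bsub>kB m\<^esub> kB_scalar m (inverse \<nu>) \<otimes>\<^bsub>kB m\<^esub> kB_kappa q m i) \<in> relators (BMW \<nu>) q n"
    if "i \<in> {2..<m}" for i \<nu>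
  proof -
    have i: "i - 1 \<in> {1..<m}" "i \<in> {1..<m}" "i \<in> {2..<n}" using that assms by auto
    have "?p (kB_kappa q m i \<otimes>\<^bsub>kB m\<^esub> kB_sigma m (i - 1) \<otimes>\<^bsub>kB m\<^esub> kB_kappa q m i \<ominus>\<^bsub>kB m\<^esub> kB_scalar m (inverse \<nu>) \<otimes>\<^bsub>kB m\<^esub> kB_kappa q m i) =
        kB_kappa q n i \<otimes>\<^bsub>kB n\<^esub> kB_sigma n (i - 1) \<otimes>\<^bsub>kB n\<^esub> kB_kappa q n i \<ominus>\<^bsub>kB n\<^esub> kB_scalar n (inverse \<nu>) \<otimes>\<^bsub>kB n\<^esub> kB_kappa q n i"
      using i by (simp add: push_minus[OF assms] push_kB_sigma[OF assms] push_kB_scalar[OF assms]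
          push_kB_kappa[OF assms] del: atLeastLessThan_iff One_nat_def)
    then show ?thesis using i unfolding relators.simps by blast
  qed
  have r4: "?p (kB_kappa q m i \<otimes>\<^bsub>kB m\<^esub> kB_sigma_inv m (i - 1) \<otimes>\<^bsub>kB m\<^esub> kB_kappa q m i \<ominus>\<^bsub>kB m\<^esub> kB_scalar m \<nu> \<otimes>\<^bsub>kB m\<^esub> kB_kappa q m i) \<in> relators (BMW \<nu>) q n"
    if "i \<in> {2..<m}" for i \<nu>
  proof -
    have i: "i - 1 \<in> {1..<m}" "i \<in> {1..<m}" "i \<in> {2..<n}" using that assms by auto
    have "?p (kB_kappa q m i \<otimes>\<^bsub>kB m\<^esub> kB_sigma_inv m (i - 1) \<otimes>\<^bsub>kB m\<^esub> kB_kappa q m i \<ominus>\<^bsub>kB m\<^esub> kB_scalar m \<nu> \<otimes>\<^bsub>kB m\<^esub> kB_kappa q m i) =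
        kB_kappa q n i \<otimes>\<^bsub>kB n\<^esub> kB_sigma_inv n (i - 1) \<otimes>\<^bsub>kB n\<^esub> kB_kappa q n i \<ominus>\<^bsub>kB n\<^esub> kB_scalar n \<nu> \<otimes>\<^bsub>kB n\<^esub> kB_kappa q n i"
      using i by (simp add: push_minus[OF assms] push_kB_sigma[OF assms] push_kB_scalar[OF assms]
          push_kB_kappa[OF assms] del: atLeastLessThan_iff One_nat_def)
    then show ?thesis using i unfolding relators.simps by blast
  qed
  show ?thesis
  proof (cases T)
    case Hecke
    show ?thesis using r0 unfolding Hecke relators.simps(1)[of q m] by blast
  next
    case (BMW \<nu>)
    show ?thesis using r1[of _ \<nu>] r2[of _ \<nu>] r3[of _ \<nu>] r4[of _ \<nu>]
      unfolding BMW relators.simps(2)[of \<nu> q m] by blast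
  qed
qed

lemma ideal_rel_ideal: "ideal (rel_ideal T q n) (kB n)"
  unfolding rel_ideal_def by (intro ring.genideal_ideal ring_kB relators_closed)

lemma ring_alg: "ring (alg T q n)"
  unfolding alg_def by (intro ideal.quotient_is_ring ideal_rel_ideal)

lemma alg_proj_hom: "ring_hom_ring (kB n) (alg T q n) (alg_proj T q n)"
  using ideal.rcos_ring_hom_ring[OF ideal_rel_ideal[of T q n]]
  unfolding alg_def alg_proj_def[abs_def] .

lemma push_rel_ideal:
  assumes "m \<le> n" "f \<in> rel_ideal T q m"
  shows "push_forward (braid_map n) f \<in> rel_ideal T q n"
proof -
  interpret ring_hom_ring "kB m" "kB n" "push_forward (braid_map n)"
    by (rule push_ring_hom_ring[OF assms(1)])
  have "relators T q n \<subseteq> rel_ideal T q n"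
    unfolding rel_ideal_def by (intro ring.genideal_self ring_kB relators_closed)
  then have "rel_ideal T q m \<subseteq> {r \<in> carrier (kB m). push_forward (braid_map n) r \<in> rel_ideal T q n}"
    unfolding rel_ideal_def[of T q m]
    using push_relators[OF assms(1), of T q] relators_closed[of T q m]
    by (intro R.genideal_minimal ideal_vimage ideal_rel_ideal) auto
  then show ?thesis using assms(2) by auto
qed

lemma alg_map_proj:
  assumes "m \<le> n" "f \<in> carrier (kB m)"
  shows "alg_map T q n (alg_proj T q m f) = alg_proj T q n (push_forward (braid_map n) f)"
proof -
  interpret ring_hom_ring "kB m" "kB n" "push_forward (braid_map n)"
    by (rule push_ring_hom_ring[OF assms(1)])
  interpret Im: ideal "rel_ideal T q m" "kB m" by (rule ideal_rel_ideal)
  interpret In: ideal "rel_ideal T q n" "kB n" by (rule ideal_rel_ideal)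
  have "alg_proj T q n (push_forward (braid_map n) g) = alg_proj T q n (push_forward (braid_map n) f)"
    if g: "g \<in> alg_proj T q m f" for g
  proof -
    obtain h where h: "h \<in> rel_ideal T q m" "g = h \<oplus>\<^bsub>kB m\<^esub> f"
      using g unfolding alg_proj_def a_r_coset_def' by auto
    have "push_forward (braid_map n) g =
        push_forward (braid_map n) h \<oplus>\<^bsub>kB n\<^esub> push_forward (braid_map n) f"
      using h assms by (simp add: Im.Icarr)
    then have "push_forward (braid_map n) g \<in> rel_ideal T q n +>\<^bsub>kB n\<^esub> push_forward (braid_map n) f"
      using push_rel_ideal[OF assms(1) h(1)] unfolding a_r_coset_def' by auto
    then show ?thesis
      unfolding alg_proj_def using assms by (intro In.a_repr_independence'[symmetric]) auto
  qed
  moreover have "f \<in> alg_proj T q m f"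
    unfolding alg_proj_def using assms(2) by (rule Im.a_rcos_self)
  ultimately show ?thesis unfolding alg_map_def by blast
qed

lemma carrier_alg: "carrier (alg T q n) = alg_proj T q n ` carrier (kB n)"
  by (auto simp: alg_def alg_proj_def FactRing_def A_RCOSETS_def')

lemma alg_map_hom:
  assumes "m \<le> n" shows "alg_map T q n \<in> ring_hom (alg T q m) (alg T q n)"
proof -
  interpret p: ring_hom_ring "kB m" "kB n" "push_forward (braid_map n)"
    by (rule push_ring_hom_ring[OF assms(1)])
  interpret m: ring_hom_ring "kB m" "alg T q m" "alg_proj T q m" by (rule alg_proj_hom)
  interpret n: ring_hom_ring "kB n" "alg T q n" "alg_proj T q n" by (rule alg_proj_hom)
  show ?thesis
  proof (rule ring_hom_memI)
    show "alg_map T q n \<one>\<^bsub>alg T q m\<^esub> = \<one>\<^bsub>alg T q n\<^esub>"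
      by (simp add: m.hom_one[symmetric] alg_map_proj[OF assms] del: m.hom_one)
  next
    fix x y assume "x \<in> carrier (alg T q m)" "y \<in> carrier (alg T q m)"
    then obtain f g where fg: "f \<in> carrier (kB m)" "g \<in> carrier (kB m)"
      "x = alg_proj T q m f" "y = alg_proj T q m g" unfolding carrier_alg by auto
    then show "alg_map T q n (x \<otimes>\<^bsub>alg T q m\<^esub> y) = alg_map T q n x \<otimes>\<^bsub>alg T q n\<^esub> alg_map T q n y"
      by (simp add: m.hom_mult[symmetric] alg_map_proj[OF assms] del: m.hom_mult)
    show "alg_map T q n (x \<oplus>\<^bsub>alg T q m\<^esub> y) = alg_map T q n x \<oplus>\<^bsub>alg T q n\<^esub> alg_map T q n y"
      using fg by (simp add: m.hom_add[symmetric] alg_map_proj[OF assms] del: m.hom_add)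
  qed (auto simp: carrier_alg alg_map_proj[OF assms])
qed

lemma alg_map_generators:
  "m \<le> n \<Longrightarrow> i \<in> {1..<m} \<Longrightarrow> alg_map T q n (alg_sigma T q m i) = alg_sigma T q n i"
  "m \<le> n \<Longrightarrow> alg_map T q n (alg_scalar T q m c) = alg_scalar T q n c"
  unfolding alg_sigma_def alg_scalar_def by (simp_all add: alg_map_proj push_kB_sigma push_kB_scalar)

end

theory Submission
  imports Defs
begin

text \<open>
  Write \<open>z = q - q\<^sup>-\<^sup>1\<close>. In the Hecke algebra \<open>\<kappa>\<^sub>i = 0\<close>, and with this convention the Hecke and BMW
  Baxterized elements at \<open>x = q\<^sup>j\<close> have the common shape
  \<open>q\<^sup>-\<^sup>j (1 + (x\<^sup>2 - 1) / z \<sigma>\<^sub>i + \<gamma> \<kappa>\<^sub>i)\<close>.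

  The Yang--Baxter equation is only needed against an eigenvector: if \<open>\<sigma>\<^sub>i X = q X\<close>, then
  \<open>\<sigma>\<^sub>i\<^sub>+\<^sub>1\<close> acts by \<open>q\<close> on \<open>\<sigma>\<^sub>i(q\<^sup>j) \<sigma>\<^sub>i\<^sub>+\<^sub>1(q\<^sup>j\<^sup>+\<^sup>1) X\<close>. This avoids the element \<open>\<sigma>\<^sub>i(q\<^sup>-\<^sup>1)\<close>, whose
  denominator may vanish. Together with \<open>\<sigma>\<^sub>1 \<sigma>\<^sub>1(q) = q \<sigma>\<^sub>1(q)\<close> it shows that all generators act by \<open>q\<close>
  on \<open>\<Sigma>\<^sub>n\<close> from the left. Applying this in the opposite algebra gives an element \<open>\<Sigma>'\<close> on which they
  act by \<open>q\<close> from the right. A Baxterized element at \<open>q\<^sup>j\<close> acts on such eigenvectors by \<open>[j + 1]\<close>, so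
  computing \<open>\<Sigma>' \<Sigma>\<^sub>n\<close> in both ways gives \<open>\<Sigma>' = \<Sigma>\<^sub>n\<close>, and the normalized \<open>\<Sigma>\<^sub>n\<close> is idempotent.

  It is non-zero since the character \<open>\<sigma>\<^sub>i \<mapsto> q\<close> sends it to 1, and unique since every \<open>x\<close> in the algebra
  multiplies it by a scalar.
\<close>

section \<open>Rings with central scalars\<close>

locale scalar_ring = ring R for R (structure) +
  fixes c :: "'k::field \<Rightarrow> 'a"
  assumes c_closed [simp]: "c a \<in> carrier R"
    and c_one: "c 1 = \<one>"
    and c_add: "c (a + b) = c a \<oplus> c b"
    and c_mult: "c (a * b) = c a \<otimes> c b"
    and c_central: "x \<in> carrier R \<Longrightarrow> x \<otimes> c a = c a \<otimes> x"
begin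

definition smult :: "'k \<Rightarrow> 'a \<Rightarrow> 'a"  (infixr "\<odot>" 75)
  where "a \<odot> x = c a \<otimes> x"

lemma smult_closed [simp]: "x \<in> carrier R \<Longrightarrow> a \<odot> x \<in> carrier R"
  by (simp add: smult_def)

lemma smult_add: "x \<in> carrier R \<Longrightarrow> y \<in> carrier R \<Longrightarrow> a \<odot> (x \<oplus> y) = a \<odot> x \<oplus> a \<odot> y"
  by (simp add: smult_def r_distr)

lemma add_smult: "x \<in> carrier R \<Longrightarrow> (a + b) \<odot> x = a \<odot> x \<oplus> b \<odot> x"
  by (simp add: smult_def c_add l_distr)

lemma smult_smult [simp]: "x \<in> carrier R \<Longrightarrow> a \<odot> b \<odot> x = (a * b) \<odot> x"
  by (simp add: smult_def c_mult m_assoc)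

lemma smult_mult [simp]:
  "x \<in> carrier R \<Longrightarrow> y \<in> carrier R \<Longrightarrow> (a \<odot> x) \<otimes> y = a \<odot> (x \<otimes> y)"
  by (simp add: smult_def m_assoc)

lemma mult_smult [simp]:
  "x \<in> carrier R \<Longrightarrow> y \<in> carrier R \<Longrightarrow> x \<otimes> (a \<odot> y) = a \<odot> (x \<otimes> y)"
  by (simp add: smult_def m_assoc[symmetric] c_central)

lemma one_smult [simp]: "x \<in> carrier R \<Longrightarrow> 1 \<odot> x = x"
  by (simp add: smult_def c_one)

lemma c_zero: "c 0 = \<zero>"
  using c_add[of 0 0] by (simp add: add.r_cancel_one)

lemma zero_smult [simp]: "x \<in> carrier R \<Longrightarrow> 0 \<odot> x = \<zero>"
  by (simp add: smult_def c_zero)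

lemma smult_zero [simp]: "a \<odot> \<zero> = \<zero>"
  by (simp add: smult_def)

lemma a_inv_smult: "x \<in> carrier R \<Longrightarrow> \<ominus> x = (- 1) \<odot> x"
  using add_smult[of x "-1" 1] by (intro minus_equality) auto

lemma minus_smult: "x \<in> carrier R \<Longrightarrow> y \<in> carrier R \<Longrightarrow> x \<ominus> y = x \<oplus> (- 1) \<odot> y"
  by (simp add: a_minus_def a_inv_smult)

lemma smult_cancel: "a \<noteq> 0 \<Longrightarrow> x \<in> carrier R \<Longrightarrow> y \<in> carrier R \<Longrightarrow> a \<odot> x = a \<odot> y \<Longrightarrow> x = y"
  by (metis left_inverse one_smult smult_smult)

end

text \<open>
  Both towers are instances: in the Hecke case \<open>K = 0\<close>, the parameter \<open>\<nu>\<close> is irrelevant, and the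
  genericity conditions on \<open>\<nu>\<close> may fail for every choice of it in a small field, whence the
  disjunction \<open>generic\<close>.
\<close>

locale bmw_ring = scalar_ring R c for R (structure) and c :: "'k::field \<Rightarrow> 'a" +
  fixes q \<nu> :: 'k and n :: nat and s t K :: "nat \<Rightarrow> 'a"
  assumes q_nz: "q \<noteq> 0" and q2: "q\<^sup>2 \<noteq> 1"
    and s_closed [simp]: "i \<in> {1..<n} \<Longrightarrow> s i \<in> carrier R"
    and t_closed [simp]: "i \<in> {1..<n} \<Longrightarrow> t i \<in> carrier R"
    and K_closed [simp]: "i \<in> {1..<n} \<Longrightarrow> K i \<in> carrier R"
    and s_t: "i \<in> {1..<n} \<Longrightarrow> s i \<otimes> t i = \<one>"
    and t_s: "i \<in> {1..<n} \<Longrightarrow> t i \<otimes> s i = \<one>"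
    and far: "i \<in> {1..<n} \<Longrightarrow> j \<in> {1..<n} \<Longrightarrow> Suc i < j \<Longrightarrow> s i \<otimes> s j = s j \<otimes> s i"
    and braid: "1 \<le> i \<Longrightarrow> Suc i < n \<Longrightarrow> s i \<otimes> (s (Suc i) \<otimes> s i) = s (Suc i) \<otimes> (s i \<otimes> s (Suc i))"
    and K_eq: "i \<in> {1..<n} \<Longrightarrow> K i = \<one> \<ominus> c (1 / (q - inverse q)) \<otimes> (s i \<ominus> t i)"
    and K_s: "i \<in> {1..<n} \<Longrightarrow> K i \<otimes> s i = c \<nu> \<otimes> K i"
    and s_K: "i \<in> {1..<n} \<Longrightarrow> s i \<otimes> K i = c \<nu> \<otimes> K i"
    and K_s_K: "1 \<le> i \<Longrightarrow> Suc i < n \<Longrightarrow> K (Suc i) \<otimes> (s i \<otimes> K (Suc i)) = c (inverse \<nu>) \<otimes> K (Suc i)"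
    and K_t_K: "1 \<le> i \<Longrightarrow> Suc i < n \<Longrightarrow> K (Suc i) \<otimes> (t i \<otimes> K (Suc i)) = c \<nu> \<otimes> K (Suc i)"
    and generic: "(\<forall>i\<in>{1..<n}. K i = \<zero>) \<or> \<nu> \<noteq> 0 \<and> (\<forall>j\<in>{1..<n}. \<nu> \<noteq> q ^ (2 * j - 1))"
begin

definition z where "z = q - inverse q"

lemma z_nz: "z \<noteq> 0"
  using q_nz q2 by (auto simp: z_def field_simps power2_eq_square)

lemma K_expand: "i \<in> {1..<n} \<Longrightarrow> K i = \<one> \<oplus> (- 1 / z) \<odot> s i \<oplus> (1 / z) \<odot> t i"
  by (simp add: K_eq smult_def[symmetric] z_def[symmetric] minus_smult smult_add a_assoc)

text \<open>The definition of \<open>K i\<close> solved for the inverse generator; with it, all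
  inverses can be eliminated in favour of \<open>s i\<close>, \<open>K i\<close> and 1.\<close>

lemma t_expand:
  assumes i: "i \<in> {1..<n}"
  shows "t i = s i \<oplus> (- z) \<odot> \<one> \<oplus> z \<odot> K i"
proof -
  have "z \<odot> K i = z \<odot> \<one> \<oplus> (- 1) \<odot> s i \<oplus> t i"
    using i z_nz by (simp add: K_expand smult_add del: atLeastLessThan_iff)
  then have "s i \<oplus> (- z) \<odot> \<one> \<oplus> z \<odot> K i = (s i \<oplus> (- 1) \<odot> s i) \<oplus> ((- z) \<odot> \<one> \<oplus> z \<odot> \<one>) \<oplus> t i"
    using i by (simp add: a_ac del: atLeastLessThan_iff)
  also have "\<dots> = t i"
    using i add_smult[of "s i" 1 "- 1"] add_smult[of \<one> "- z" z]
    by (simp del: atLeastLessThan_iff)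
  finally show ?thesis by simp
qed

text \<open>An element carrying \<open>s j\<close> to \<open>s i\<close> also carries everything
  built from them: the inverse, \<kappa> and the Baxterized elements. Nothing is asked about
  invertibility of \<open>x\<close>, so \<open>x\<close> may be a generator (commutation), a
  two-letter word or the half twist.\<close>

lemma intertwine_t:
  assumes ij: "i \<in> {1..<n}" "j \<in> {1..<n}" and x: "x \<in> carrier R" and xs: "x \<otimes> s j = s i \<otimes> x"
  shows "x \<otimes> t j = t i \<otimes> x"
proof -
  have "t i \<otimes> x = t i \<otimes> (x \<otimes> s j) \<otimes> t j" using ij x by (simp add: m_assoc s_t del: atLeastLessThan_iff)
  also have "\<dots> = (t i \<otimes> s i) \<otimes> (x \<otimes> t j)" using ij x by (simp add: m_assoc xs del: atLeastLessThan_iff)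
  also have "\<dots> = x \<otimes> t j" using ij x by (simp add: t_s del: atLeastLessThan_iff)
  finally show ?thesis by simp
qed

lemma intertwine_K:
  assumes ij: "i \<in> {1..<n}" "j \<in> {1..<n}" and x: "x \<in> carrier R" and xs: "x \<otimes> s j = s i \<otimes> x"
  shows "x \<otimes> K j = K i \<otimes> x"
  using ij x intertwine_t[OF assms]
  by (simp add: K_expand l_distr r_distr xs del: atLeastLessThan_iff)

text \<open>The Baxterized element at spectral parameter x = q^j, in the BMW form for both towers.
  Its denominators are 1 - \<nu>^(-1) q^(2j-1), which is where the excluded values of \<nu> come
  from.\<close>

definition bax where
  "bax i j = inverse (q ^ j) \<odot> (\<one> \<oplus> ((q ^ (2 * j) - 1) / z) \<odot> s i
     \<oplus> ((q ^ (2 * j) - 1) / (1 - inverse \<nu> * inverse q * q ^ (2 * j))) \<odot> K i)"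

lemma bax_closed [simp]: "i \<in> {1..<n} \<Longrightarrow> bax i j \<in> carrier R"
  by (simp add: bax_def)

lemma intertwine_bax:
  assumes ij: "i \<in> {1..<n}" "j \<in> {1..<n}" and x: "x \<in> carrier R" and xs: "x \<otimes> s j = s i \<otimes> x"
  shows "x \<otimes> bax j k = bax i k \<otimes> x"
  using ij x intertwine_K[OF assms]
  by (simp add: bax_def l_distr r_distr xs del: atLeastLessThan_iff)

lemma nu_or_K: "\<nu> \<noteq> 0 \<or> (\<forall>i\<in>{1..<n}. K i = \<zero>)"
  using generic by blast

lemma K_t: "i \<in> {1..<n} \<Longrightarrow> K i \<otimes> t i = inverse \<nu> \<odot> K i"
  and t_K: "i \<in> {1..<n} \<Longrightarrow> t i \<otimes> K i = inverse \<nu> \<odot> K i"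
proof -
  assume i: "i \<in> {1..<n}"
  show "K i \<otimes> t i = inverse \<nu> \<odot> K i"
  proof (cases "\<nu> = 0")
    \<comment> \<open>Here \<open>K i\<close> is zero by \<open>nu_or_K\<close>, so the convention
      \<open>inverse 0 = 0\<close> does no harm.\<close>
    case True
    then show ?thesis using i nu_or_K by (simp del: atLeastLessThan_iff)
  next
    case False
    have "K i = (K i \<otimes> s i) \<otimes> t i" using i by (simp add: m_assoc s_t del: atLeastLessThan_iff)
    also have "\<dots> = \<nu> \<odot> (K i \<otimes> t i)" using i K_s by (simp add: smult_def[symmetric] del: atLeastLessThan_iff)
    finally have "inverse \<nu> \<odot> K i = inverse \<nu> \<odot> \<nu> \<odot> (K i \<otimes> t i)" by simp
    then show ?thesis using i False by (simp del: atLeastLessThan_iff)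
  qed
  show "t i \<otimes> K i = inverse \<nu> \<odot> K i"
  proof (cases "\<nu> = 0")
    case True
    then show ?thesis using i nu_or_K by (simp del: atLeastLessThan_iff)
  next
    case False
    have "K i = t i \<otimes> (s i \<otimes> K i)" using i by (simp add: m_assoc[symmetric] t_s del: atLeastLessThan_iff)
    also have "\<dots> = \<nu> \<odot> (t i \<otimes> K i)" using i s_K by (simp add: smult_def[symmetric] del: atLeastLessThan_iff)
    finally have "inverse \<nu> \<odot> K i = inverse \<nu> \<odot> \<nu> \<odot> (t i \<otimes> K i)" by simp
    then show ?thesis using i False by (simp del: atLeastLessThan_iff)
  qed
qed

text \<open>The Hecke quadratic relation with a correction by \<kappa>, obtained by multiplying
  \<open>t_expand\<close> with \<open>s i\<close>.\<close>

lemma s_s: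
  assumes i: "i \<in> {1..<n}"
  shows "s i \<otimes> s i = \<one> \<oplus> z \<odot> s i \<oplus> (- z * \<nu>) \<odot> K i"
proof -
  have "\<one> = s i \<otimes> t i" using i by (simp add: s_t)
  also have "\<dots> = s i \<otimes> s i \<oplus> (- z) \<odot> s i \<oplus> (z * \<nu>) \<odot> K i"
    using i s_K by (simp add: t_expand r_distr smult_def[symmetric] del: atLeastLessThan_iff)
  finally have "\<one> \<oplus> z \<odot> s i \<oplus> (- z * \<nu>) \<odot> K i =
    s i \<otimes> s i \<oplus> ((- z) \<odot> s i \<oplus> z \<odot> s i) \<oplus> ((z * \<nu>) \<odot> K i \<oplus> (- z * \<nu>) \<odot> K i)"
    using i by (simp add: a_ac del: atLeastLessThan_iff)
  also have "\<dots> = s i \<otimes> s i"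
    using i by (simp add: add_smult[symmetric] del: atLeastLessThan_iff)
  finally show ?thesis by simp
qed

lemma denom_nz:
  assumes "j \<in> {1..<n}" "\<not> (\<forall>i\<in>{1..<n}. K i = \<zero>)"
  shows "1 - inverse \<nu> * inverse q * q ^ (2 * j) \<noteq> 0"
proof
  have \<nu>: "\<nu> \<noteq> 0" "\<nu> \<noteq> q ^ (2 * j - 1)" using generic assms by blast+
  \<comment> \<open>Splitting off one q matches the odd exponent in \<open>generic\<close>; it
    relies on j being at least 1.\<close>
  have m: "q ^ (2 * j) = q * q ^ (2 * j - 1)"
    using assms(1) power_minus_mult[of "2 * j" q] by (simp add: mult.commute)
  assume "1 - inverse \<nu> * inverse q * q ^ (2 * j) = 0"
  then have "\<nu> = q ^ (2 * j - 1)" using \<nu>(1) q_nz by (simp add: m) (simp add: field_simps)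
  then show False using \<nu>(2) by simp
qed

text \<open>At x = q the coefficient of \<open>s i\<close> becomes q. Expanding by
  \<open>s_s\<close>, the eigenvalue equation then reduces to 1 + q z = q^2 for \<open>s i\<close>
  and to \<open>g * \<nu> - q * z * \<nu> = q * g\<close> for \<open>K i\<close>, and the BMW
  coefficient \<open>g\<close> solves the latter.\<close>

lemma bax_one_eigen:
  assumes i: "i \<in> {1..<n}"
  shows "s i \<otimes> bax i 1 = q \<odot> bax i 1"
proof -
  define g where "g = (q ^ (2 * 1) - 1) / (1 - inverse \<nu> * inverse q * q ^ (2 * 1))"
  have \<beta>: "(q ^ (2 * 1) - 1) / z = q"
    using q_nz z_nz by (simp add: z_def field_simps power2_eq_square)
  have K: "(g * \<nu> - q * z * \<nu>) \<odot> K i = (q * g) \<odot> K i"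
  proof (cases "\<forall>i\<in>{1..<n}. K i = \<zero>")
    case True
    then show ?thesis using i by simp
  next
    case False
    then have "1 - inverse \<nu> * inverse q * q ^ (2 * 1) \<noteq> 0" using denom_nz[of 1] i by auto
    moreover have "\<nu> \<noteq> 0" using False nu_or_K by blast
    ultimately have "g * \<nu> - q * z * \<nu> = q * g"
      unfolding g_def z_def using q_nz by (simp add: divide_simps power2_eq_square) (simp add: algebra_simps)
    then show ?thesis by simp
  qed
  have "s i \<otimes> (\<one> \<oplus> q \<odot> s i \<oplus> g \<odot> K i) =
      q \<odot> \<one> \<oplus> (s i \<oplus> (q * z) \<odot> s i) \<oplus> ((g * \<nu>) \<odot> K i \<oplus> (- (q * z * \<nu>)) \<odot> K i)"
    using i s_K by (simp add: r_distr s_s smult_add smult_def[symmetric] a_ac mult.assoc del: atLeastLessThan_iff)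
  also have "s i \<oplus> (q * z) \<odot> s i = (q * q) \<odot> s i"
    using i add_smult[of "s i" 1 "q * z"] q_nz by (simp add: z_def algebra_simps del: atLeastLessThan_iff)
  also have "(g * \<nu>) \<odot> K i \<oplus> (- (q * z * \<nu>)) \<odot> K i = (q * g) \<odot> K i"
    using i K by (simp add: add_smult[symmetric] del: atLeastLessThan_iff)
  also have "q \<odot> \<one> \<oplus> (q * q) \<odot> s i \<oplus> (q * g) \<odot> K i = q \<odot> (\<one> \<oplus> q \<odot> s i \<oplus> g \<odot> K i)"
    using i by (simp add: smult_add del: atLeastLessThan_iff)
  finally show ?thesis using i
    unfolding bax_def \<beta> g_def[symmetric] by (simp add: mult.commute del: atLeastLessThan_iff)
qed

section \<open>Two neighbouring generators\<close>

context
  fixes i assumes i: "1 \<le> i" "Suc i < n"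
begin

private lemma mem [simp]: "i \<in> {1..<n}" "Suc i \<in> {1..<n}" using i by auto

private abbreviation "a \<equiv> s i"
private abbreviation "a' \<equiv> t i"
private abbreviation "A \<equiv> K i"
private abbreviation "b \<equiv> s (Suc i)"
private abbreviation "b' \<equiv> t (Suc i)"
private abbreviation "B \<equiv> K (Suc i)"

private lemma cl [simp]: "a \<in> carrier R" "a' \<in> carrier R" "A \<in> carrier R"
  "b \<in> carrier R" "b' \<in> carrier R" "B \<in> carrier R"
  using mem by (simp_all del: atLeastLessThan_iff mem)

private lemma cancel [simp]:
  "x \<in> carrier R \<Longrightarrow> a \<otimes> (a' \<otimes> x) = x" "x \<in> carrier R \<Longrightarrow> a' \<otimes> (a \<otimes> x) = x"
  "x \<in> carrier R \<Longrightarrow> b \<otimes> (b' \<otimes> x) = x" "x \<in> carrier R \<Longrightarrow> b' \<otimes> (b \<otimes> x) = x"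
  "a \<otimes> a' = \<one>" "a' \<otimes> a = \<one>" "b \<otimes> b' = \<one>" "b' \<otimes> b = \<one>"
  using mem by (simp_all add: m_assoc[symmetric] s_t t_s del: atLeastLessThan_iff mem)

private lemma br: "a \<otimes> (b \<otimes> a) = b \<otimes> (a \<otimes> b)" using braid i by simp

text \<open>By the braid relation the word \<open>b \<otimes> a\<close> carries \<open>b\<close> to
  \<open>a\<close>, hence \<open>B\<close> to \<open>A\<close>.\<close>

private lemma ba_B: "b \<otimes> (a \<otimes> B) = A \<otimes> (b \<otimes> a)"
  using intertwine_K[of i "Suc i" "b \<otimes> a"] mem by (simp add: m_assoc br del: atLeastLessThan_iff mem)

private lemma ab_A: "a \<otimes> (b \<otimes> A) = B \<otimes> (a \<otimes> b)"
  using intertwine_K[of "Suc i" i "a \<otimes> b"] mem by (simp add: m_assoc br del: atLeastLessThan_iff mem)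

text \<open>The half twist on three strands. Conjugation by it exchanges the two generators and
  thereby \<open>A\<close> and \<open>B\<close>, which yields the mirror images of the relations
  that the presentation imposes only on the upper \<kappa>.\<close>

private definition "D = a \<otimes> (b \<otimes> a)"

private lemma D_closed [simp]: "D \<in> carrier R" by (simp add: D_def)

private lemma D_s: "D \<otimes> a = b \<otimes> D" "D \<otimes> b = a \<otimes> D"
proof -
  show "D \<otimes> a = b \<otimes> D"
    unfolding D_def by (subst br) (simp add: m_assoc)
  show "D \<otimes> b = a \<otimes> D"
    unfolding D_def by (simp add: m_assoc br[symmetric])
qed

private lemma D_t: "D \<otimes> a' = b' \<otimes> D" and D_K: "D \<otimes> B = A \<otimes> D"
  using intertwine_t[of "Suc i" i D] intertwine_K[of i "Suc i" D] D_s mem by auto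

private lemma D_cancel: "x \<in> carrier R \<Longrightarrow> y \<in> carrier R \<Longrightarrow> x \<otimes> D = y \<otimes> D \<Longrightarrow> x = y"
proof -
  assume xy: "x \<in> carrier R" "y \<in> carrier R" "x \<otimes> D = y \<otimes> D"
  \<comment> \<open>The word \<open>a' \<otimes> (b' \<otimes> a')\<close> is the inverse of the
    half twist.\<close>
  then have "x \<otimes> D \<otimes> (a' \<otimes> (b' \<otimes> a')) = y \<otimes> D \<otimes> (a' \<otimes> (b' \<otimes> a'))" by simp
  then show "x = y" using xy(1,2) by (simp add: D_def m_assoc)
qed

private lemma D_move: "x \<in> carrier R \<Longrightarrow> D \<otimes> (B \<otimes> x) = A \<otimes> (D \<otimes> x)"
  "x \<in> carrier R \<Longrightarrow> D \<otimes> (a \<otimes> x) = b \<otimes> (D \<otimes> x)"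
  "x \<in> carrier R \<Longrightarrow> D \<otimes> (a' \<otimes> x) = b' \<otimes> (D \<otimes> x)"
  by (simp_all add: m_assoc[symmetric] D_K D_s D_t)

text \<open>The mirror image of \<open>K_s_K\<close>, carried over by the half twist and then freed
  of it by \<open>D_cancel\<close>.\<close>

private lemma A_b_A: "A \<otimes> (b \<otimes> A) = inverse \<nu> \<odot> A"
proof (rule D_cancel)
  have "D \<otimes> (B \<otimes> (a \<otimes> B)) = inverse \<nu> \<odot> (D \<otimes> B)"
    using K_s_K[OF i] by (simp add: smult_def[symmetric])
  then show "A \<otimes> (b \<otimes> A) \<otimes> D = inverse \<nu> \<odot> A \<otimes> D"
    by (simp add: D_move D_K m_assoc)
qed auto

private lemma A_b'_A: "A \<otimes> (b' \<otimes> A) = \<nu> \<odot> A"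
proof (rule D_cancel)
  have "D \<otimes> (B \<otimes> (a' \<otimes> B)) = \<nu> \<odot> (D \<otimes> B)"
    using K_t_K[OF i] by (simp add: smult_def[symmetric])
  then show "A \<otimes> (b' \<otimes> A) \<otimes> D = \<nu> \<odot> A \<otimes> D"
    by (simp add: D_move D_K m_assoc)
qed auto


text \<open>The Temperley--Lieb relation. Expanding the middle factor into 1, \<open>a\<close> and
  \<open>a'\<close> leaves multiples of \<open>B\<close> by \<open>K_s_K\<close> and
  \<open>K_t_K\<close>; their \<nu> terms cancel against those of the loop value computed in
  \<open>BB\<close>.\<close>

private lemma B_A_B: "B \<otimes> (A \<otimes> B) = B"
proof -
  have BB: "B \<otimes> B = (1 - \<nu> / z + inverse \<nu> / z) \<odot> B"
  proof -
    have "B \<otimes> B = B \<otimes> (\<one> \<oplus> (- 1 / z) \<odot> b \<oplus> (1 / z) \<odot> b')"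
      using K_expand[OF mem(2)] by simp
    also have "\<dots> = B \<oplus> (- 1 / z) \<odot> \<nu> \<odot> B \<oplus> (1 / z) \<odot> inverse \<nu> \<odot> B"
      using K_s[OF mem(2)] K_t[OF mem(2)] by (simp add: r_distr smult_def[symmetric] del: smult_smult)
    also have "\<dots> = (1 + (- 1 / z) * \<nu> + (1 / z) * inverse \<nu>) \<odot> B"
      by (simp only: add_smult one_smult smult_smult cl)
    finally show ?thesis by simp
  qed
  have "B \<otimes> (A \<otimes> B) = B \<otimes> ((\<one> \<oplus> (- 1 / z) \<odot> a \<oplus> (1 / z) \<odot> a') \<otimes> B)"
    using K_expand[OF mem(1)] by simp
  also have "\<dots> = B \<otimes> B \<oplus> (- 1 / z) \<odot> inverse \<nu> \<odot> B \<oplus> (1 / z) \<odot> \<nu> \<odot> B"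
    using K_s_K[OF i] K_t_K[OF i] by (simp add: l_distr r_distr smult_def[symmetric] del: smult_smult)
  also have "\<dots> = ((1 - \<nu> / z + inverse \<nu> / z) + (- 1 / z) * inverse \<nu> + (1 / z) * \<nu>) \<odot> B"
    by (simp only: BB add_smult smult_smult cl)
  also have "\<dots> = 1 \<odot> B" by (rule arg_cong[where f = "\<lambda>x. x \<odot> B"]) simp
  finally show ?thesis by simp
qed

text \<open>For \<nu> = 0 the scalar is 0, but then \<open>A\<close> vanishes as well.\<close>

private lemma nu_A: "(\<nu> * inverse \<nu>) \<odot> A = A"
  using nu_or_K mem by (cases "\<nu> = 0") (simp_all del: atLeastLessThan_iff mem)

text \<open>Insert \<open>B = B A B\<close> on the right and move \<open>b a\<close> past the first \<open>B\<close>.\<close>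

private lemma baB: "b \<otimes> (a \<otimes> B) = A \<otimes> B"
proof -
  have "b \<otimes> (a \<otimes> B) = (b \<otimes> (a \<otimes> B)) \<otimes> (A \<otimes> B)"
    by (simp add: m_assoc B_A_B)
  also have "\<dots> = A \<otimes> (b \<otimes> ((a \<otimes> A) \<otimes> B))"
    by (simp only: ba_B) (simp add: m_assoc)
  also have "\<dots> = \<nu> \<odot> ((A \<otimes> (b \<otimes> A)) \<otimes> B)"
    using s_K[OF mem(1)] by (simp add: smult_def[symmetric] m_assoc)
  also have "\<dots> = (\<nu> * inverse \<nu>) \<odot> A \<otimes> B" by (simp only: A_b_A) simp
  also have "\<dots> = A \<otimes> B" by (simp add: nu_A)
  finally show ?thesis .
qed

private lemma b'a'B: "b' \<otimes> (a' \<otimes> B) = A \<otimes> B"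
proof -
  \<comment> \<open>Multiplying \<open>ab_A\<close> by the inverse words on both sides gives the
    commutation rule for \<open>b' \<otimes> a'\<close>; the rest runs as for
    \<open>baB\<close>.\<close>
  have "A \<otimes> (b' \<otimes> a') = b' \<otimes> (a' \<otimes> (a \<otimes> (b \<otimes> A))) \<otimes> (b' \<otimes> a')" by simp
  also have "\<dots> = b' \<otimes> (a' \<otimes> B)" by (simp only: ab_A) (simp add: m_assoc)
  finally have *: "b' \<otimes> (a' \<otimes> B) = A \<otimes> (b' \<otimes> a')" by simp
  have "b' \<otimes> (a' \<otimes> B) = (b' \<otimes> (a' \<otimes> B)) \<otimes> (A \<otimes> B)"
    by (simp add: m_assoc B_A_B)
  also have "\<dots> = A \<otimes> (b' \<otimes> ((a' \<otimes> A) \<otimes> B))"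
    by (simp only: *) (simp add: m_assoc)
  also have "\<dots> = inverse \<nu> \<odot> ((A \<otimes> (b' \<otimes> A)) \<otimes> B)"
    using t_K[OF mem(1)] by (simp add: m_assoc)
  also have "\<dots> = (\<nu> * inverse \<nu>) \<odot> A \<otimes> B" by (simp only: A_b'_A) (simp add: mult.commute)
  also have "\<dots> = A \<otimes> B" by (simp add: nu_A)
  finally show ?thesis .
qed

text \<open>Since \<open>A \<otimes> B\<close> equals \<open>b' \<otimes> (a' \<otimes> B)\<close>,
  the factor \<open>b\<close> cancels, and \<open>t_expand\<close> removes the remaining
  inverse.\<close>

private lemma bAB: "b \<otimes> (A \<otimes> B) = a \<otimes> B \<oplus> (- z) \<odot> B \<oplus> z \<odot> (A \<otimes> B)"
proof -
  have "b \<otimes> (A \<otimes> B) = a' \<otimes> B" by (simp add: b'a'B[symmetric])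
  then show ?thesis using t_expand[OF mem(1)] by (simp add: l_distr)
qed

text \<open>The substitute for the Yang--Baxter equation: passing through the two Baxterized factors
  turns an eigenvector of the lower generator into one of the upper generator, which drives
  \<open>s_Sh_eigen\<close>.\<close>

lemma bax_pair_eigen:
  assumes X: "X \<in> carrier R" and aX: "s i \<otimes> X = q \<odot> X" and j: "1 \<le> j" "Suc j < n"
  shows "s (Suc i) \<otimes> (bax i j \<otimes> (bax (Suc i) (Suc j) \<otimes> X)) =
    q \<odot> (bax i j \<otimes> (bax (Suc i) (Suc j) \<otimes> X))"
proof -
  \<comment> \<open>The span of these six vectors is stable under \<open>b\<close>, so that the claim becomes a comparison of
    coefficients.\<close>
  define L where "L c1 c2 c3 c4 c5 c6 = c1 \<odot> X \<oplus> c2 \<odot> (b \<otimes> X) \<oplus> c3 \<odot> (a \<otimes> (b \<otimes> X))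
    \<oplus> c4 \<odot> (B \<otimes> X) \<oplus> c5 \<odot> (a \<otimes> (B \<otimes> X)) \<oplus> c6 \<odot> (A \<otimes> (B \<otimes> X))" for c1 c2 c3 c4 c5 c6
  note Xc [simp] = X
  have Lcl [simp]: "L c1 c2 c3 c4 c5 c6 \<in> carrier R" for c1 c2 c3 c4 c5 c6
    by (simp add: L_def)
  have Ladd: "L c1 c2 c3 c4 c5 c6 \<oplus> L d1 d2 d3 d4 d5 d6 =
      L (c1 + d1) (c2 + d2) (c3 + d3) (c4 + d4) (c5 + d5) (c6 + d6)" for c1 c2 c3 c4 c5 c6 d1 d2 d3 d4 d5 d6
    by (simp add: L_def add_smult a_ac)
  have Lsm: "k \<odot> L c1 c2 c3 c4 c5 c6 = L (k * c1) (k * c2) (k * c3) (k * c4) (k * c5) (k * c6)"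
    for k c1 c2 c3 c4 c5 c6
    by (simp add: L_def smult_add)
  have a'X: "a' \<otimes> X = inverse q \<odot> X"
  proof -
    have "X = a' \<otimes> (a \<otimes> X)" by simp
    also have "\<dots> = q \<odot> (a' \<otimes> X)" by (simp only: aX) simp
    finally have "inverse q \<odot> X = inverse q \<odot> q \<odot> (a' \<otimes> X)" by simp
    then show ?thesis using q_nz by simp
  qed
  \<comment> \<open>Where \<open>a\<close> acts by q, \<open>A\<close> acts by 1 - (q - q^(-1)) / z
    = 0.\<close>
  have AX: "A \<otimes> X = \<zero>"
  proof -
    have "A \<otimes> X = X \<oplus> (- 1 / z) \<odot> q \<odot> X \<oplus> (1 / z) \<odot> inverse q \<odot> X"
      using K_expand[OF mem(1)] by (simp add: l_distr aX a'X del: smult_smult)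
    also have "\<dots> = (1 + (- 1 / z) * q + (1 / z) * inverse q) \<odot> X"
      by (simp only: add_smult one_smult smult_smult X)
    also have "1 + (- 1 / z) * q + (1 / z) * inverse q = 0"
    proof -
      have "1 + (- 1 / z) * q + (1 / z) * inverse q = 1 - (q - inverse q) / z"
        by (simp add: diff_divide_distrib)
      then show ?thesis using z_nz by (simp add: z_def[symmetric])
    qed
    finally show ?thesis by simp
  qed
  \<comment> \<open>Together \<open>ba_B\<close> and \<open>baB\<close> give
    \<open>A \<otimes> (b \<otimes> a) = A \<otimes> B\<close>. This reduces the word
    \<open>A \<otimes> (b \<otimes> X)\<close> to one of the six vectors.\<close>
  have AbX: "A \<otimes> (b \<otimes> X) = inverse q \<odot> (A \<otimes> (B \<otimes> X))"
  proof -
    have "A \<otimes> (B \<otimes> X) = (A \<otimes> (b \<otimes> a)) \<otimes> X"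
      using ba_B baB by (simp add: m_assoc[symmetric])
    also have "\<dots> = q \<odot> (A \<otimes> (b \<otimes> X))" by (simp add: m_assoc aX)
    finally show ?thesis using q_nz by simp
  qed
  have bbX: "b \<otimes> (b \<otimes> X) = X \<oplus> z \<odot> (b \<otimes> X) \<oplus> (- z * \<nu>) \<odot> (B \<otimes> X)"
    using s_s[OF mem(2)] by (simp add: m_assoc[symmetric] l_distr)
  \<comment> \<open>The braid relation brings \<open>a\<close> next to \<open>X\<close>, where it
    acts by q.\<close>
  have babX: "b \<otimes> (a \<otimes> (b \<otimes> X)) = q \<odot> (a \<otimes> (b \<otimes> X))"
  proof -
    have "b \<otimes> (a \<otimes> (b \<otimes> X)) = (a \<otimes> (b \<otimes> a)) \<otimes> X" by (simp only: br) (simp add: m_assoc)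
    then show ?thesis by (simp add: m_assoc aX)
  qed
  have bBX: "b \<otimes> (B \<otimes> X) = \<nu> \<odot> (B \<otimes> X)"
    using s_K[OF mem(2)] by (simp add: m_assoc[symmetric] smult_def)
  have baBX: "b \<otimes> (a \<otimes> (B \<otimes> X)) = A \<otimes> (B \<otimes> X)"
    using arg_cong[OF baB, of "\<lambda>y. y \<otimes> X"] by (simp add: m_assoc)
  have bABX: "b \<otimes> (A \<otimes> (B \<otimes> X)) = a \<otimes> (B \<otimes> X) \<oplus> (- z) \<odot> (B \<otimes> X) \<oplus> z \<odot> (A \<otimes> (B \<otimes> X))"
    using arg_cong[OF bAB, of "\<lambda>y. y \<otimes> X"] by (simp add: m_assoc l_distr)
  \<comment> \<open>The action of \<open>b\<close> in coordinates; the summands below are the images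
    of the six vectors in turn.\<close>
  have bL: "b \<otimes> L c1 c2 c3 c4 c5 c6 =
      L c2 (c1 + z * c2) (q * c3) (- z * \<nu> * c2 + \<nu> * c4 - z * c6) c6 (c5 + z * c6)"
    for c1 c2 c3 c4 c5 c6
  proof -
    have "b \<otimes> L c1 c2 c3 c4 c5 c6 = c1 \<odot> (b \<otimes> X) \<oplus> c2 \<odot> (b \<otimes> (b \<otimes> X)) \<oplus> c3 \<odot> (b \<otimes> (a \<otimes> (b \<otimes> X)))
      \<oplus> c4 \<odot> (b \<otimes> (B \<otimes> X)) \<oplus> c5 \<odot> (b \<otimes> (a \<otimes> (B \<otimes> X))) \<oplus> c6 \<odot> (b \<otimes> (A \<otimes> (B \<otimes> X)))"
      by (simp add: L_def r_distr)
    also have "\<dots> = L 0 c1 0 0 0 0 \<oplus> L c2 (c2 * z) 0 (c2 * (- z * \<nu>)) 0 0 \<oplus> L 0 0 (c3 * q) 0 0 0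
      \<oplus> L 0 0 0 (c4 * \<nu>) 0 0 \<oplus> L 0 0 0 0 0 c5 \<oplus> L 0 0 0 (c6 * (- z)) c6 (c6 * z)"
      by (simp add: L_def bbX babX bBX baBX bABX smult_add a_ac)
    also have "\<dots> = L c2 (c1 + z * c2) (q * c3) (- z * \<nu> * c2 + \<nu> * c4 - z * c6) c6 (c5 + z * c6)"
      by (simp add: Ladd algebra_simps)
    finally show ?thesis .
  qed
  \<comment> \<open>The squares of the two spectral parameters are Q and q^2 Q; \<beta> and \<gamma>
    are the corresponding coefficients of \<sigma> and \<kappa>, with index 1 for the left factor
    and 2 for the right one.\<close>
  define Q where "Q = q ^ (2 * j)"
  define \<beta>1 where "\<beta>1 = (Q - 1) / z"
  define \<gamma>1 where "\<gamma>1 = (Q - 1) / (1 - inverse \<nu> * inverse q * Q)"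
  define \<beta>2 where "\<beta>2 = (q\<^sup>2 * Q - 1) / z"
  define \<gamma>2 where "\<gamma>2 = (q\<^sup>2 * Q - 1) / (1 - inverse \<nu> * inverse q * (q\<^sup>2 * Q))"
  have Q2: "q ^ (2 * Suc j) = q\<^sup>2 * Q" by (simp add: Q_def power2_eq_square)
  have Y: "bax (Suc i) (Suc j) \<otimes> X = inverse (q ^ Suc j) \<odot> L 1 \<beta>2 0 \<gamma>2 0 0"
    unfolding bax_def Q2 \<beta>2_def[symmetric] \<gamma>2_def[symmetric] by (simp add: L_def l_distr)
  define W where "W = L (1 + \<beta>1 * q) \<beta>2 (\<beta>1 * \<beta>2) \<gamma>2 (\<beta>1 * \<gamma>2) (\<gamma>1 * (\<beta>2 * inverse q + \<gamma>2))"
  have aL: "a \<otimes> L 1 \<beta>2 0 \<gamma>2 0 0 = L q 0 \<beta>2 0 \<gamma>2 0"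
    by (simp add: L_def r_distr aX)
  have AL: "A \<otimes> L 1 \<beta>2 0 \<gamma>2 0 0 = L 0 0 0 0 0 (\<beta>2 * inverse q + \<gamma>2)"
    by (simp add: L_def r_distr AX AbX add_smult)
  have "bax i j \<otimes> L 1 \<beta>2 0 \<gamma>2 0 0 = inverse (q ^ j) \<odot> (L 1 \<beta>2 0 \<gamma>2 0 0
      \<oplus> \<beta>1 \<odot> (a \<otimes> L 1 \<beta>2 0 \<gamma>2 0 0) \<oplus> \<gamma>1 \<odot> (A \<otimes> L 1 \<beta>2 0 \<gamma>2 0 0))"
    unfolding bax_def Q_def[symmetric] \<beta>1_def[symmetric] \<gamma>1_def[symmetric] by (simp add: l_distr)
  also have "\<dots> = inverse (q ^ j) \<odot> W"
    by (simp add: aL AL Lsm Ladd W_def)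
  finally have W: "bax i j \<otimes> (bax (Suc i) (Suc j) \<otimes> X) = (inverse (q ^ Suc j) * inverse (q ^ j)) \<odot> W"
    using mem by (simp add: Y W_def del: atLeastLessThan_iff mem)
  \<comment> \<open>Six coefficient equations: \<open>e1\<close> gives the first two, the third is
    an identity, and the fourth, fifth and sixth are \<open>e3\<close>, \<open>e2\<close> and
    \<open>e4\<close>, where \<open>e2\<close> has been used to rewrite the last coordinate.\<close>
  have "b \<otimes> W = q \<odot> W"
  proof -
    have "z * q = q\<^sup>2 - 1" using q_nz by (simp add: z_def algebra_simps power2_eq_square)
    then have "\<beta>2 = q * (1 + \<beta>1 * q)"
      unfolding \<beta>1_def \<beta>2_def using z_nz by (simp add: field_simps power2_eq_square)
    moreover from this have "1 + \<beta>1 * q = inverse q * \<beta>2" using q_nz by simp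
    then have "1 + \<beta>1 * q + z * \<beta>2 = q * \<beta>2" by (simp add: z_def algebra_simps)
    ultimately have e1: "\<beta>2 = q * (1 + \<beta>1 * q)" "1 + \<beta>1 * q + z * \<beta>2 = q * \<beta>2" by blast+
    show ?thesis
    proof (cases "\<forall>i\<in>{1..<n}. K i = \<zero>")
      case True
      \<comment> \<open>Without \<kappa> the last three vectors vanish, so their coordinates can be
        changed at will and the equations for them disappear.\<close>
      have "L c1 c2 c3 c4 c5 c6 = L c1 c2 c3 d4 d5 d6" for c1 c2 c3 c4 c5 c6 d4 d5 d6
        using True mem by (simp add: L_def del: atLeastLessThan_iff mem)
      then show ?thesis unfolding W_def bL Lsm using e1 by metis
    next
      case False
      have \<nu>: "\<nu> \<noteq> 0" using False nu_or_K by blast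
      have d1: "1 - inverse \<nu> * inverse q * Q \<noteq> 0" and d2: "1 - inverse \<nu> * inverse q * (q\<^sup>2 * Q) \<noteq> 0"
        using denom_nz[OF _ False, of j] denom_nz[OF _ False, of "Suc j"] j
        unfolding Q2 Q_def[symmetric] by auto
      have e2: "\<gamma>1 * (\<beta>2 * inverse q + \<gamma>2) = q * (\<beta>1 * \<gamma>2)"
        using d1 d2 \<nu> q_nz z_nz
        unfolding \<beta>1_def \<beta>2_def \<gamma>1_def \<gamma>2_def
        by (simp add: divide_simps) (simp add: z_def field_simps power2_eq_square)
      have e3: "- z * \<nu> * \<beta>2 + \<nu> * \<gamma>2 - z * (q * (\<beta>1 * \<gamma>2)) = q * \<gamma>2"
        using d1 d2 \<nu> q_nz z_nz
        unfolding \<beta>1_def \<beta>2_def \<gamma>1_def \<gamma>2_def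
        by (simp add: divide_simps) (simp add: z_def field_simps power2_eq_square)
      have e4: "\<beta>1 * \<gamma>2 + z * (q * (\<beta>1 * \<gamma>2)) = q * (q * (\<beta>1 * \<gamma>2))"
        using q_nz by (simp add: z_def algebra_simps)
      show ?thesis unfolding W_def bL Lsm e2 e3 e4 e1(2) using e1(1) by simp
    qed
  qed
  then show ?thesis unfolding W using mem by (simp add: W_def mult.commute del: atLeastLessThan_iff mem)
qed

end

end

section \<open>Eigenvectors and the opposite ring\<close>

text \<open>The products behind \<open>qSh\<close> and \<open>qSigma\<close> for arbitrary factors
  and multiplication, so that the same formula can be read both in a ring and in its
  opposite.\<close>

primrec sh_prod :: "('a, 'b) monoid_scheme \<Rightarrow> (nat \<Rightarrow> 'a) \<Rightarrow> nat \<Rightarrow> 'a" where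
  "sh_prod G f 0 = \<one>\<^bsub>G\<^esub>"
| "sh_prod G f (Suc k) = sh_prod G f k \<otimes>\<^bsub>G\<^esub> f (Suc k)"

primrec sigma_prod :: "('a, 'b) monoid_scheme \<Rightarrow> (nat \<Rightarrow> 'a) \<Rightarrow> nat \<Rightarrow> 'a" where
  "sigma_prod G f 0 = \<one>\<^bsub>G\<^esub>"
| "sigma_prod G f (Suc m) = sh_prod G f m \<otimes>\<^bsub>G\<^esub> sigma_prod G f m"

lemma sh_prod_cong: "(\<And>j. 1 \<le> j \<Longrightarrow> j \<le> k \<Longrightarrow> f j = g j) \<Longrightarrow> sh_prod G f k = sh_prod G g k"
  by (induction k) auto

lemma sigma_prod_cong: "(\<And>j. 1 \<le> j \<Longrightarrow> j < m \<Longrightarrow> f j = g j) \<Longrightarrow> sigma_prod G f m = sigma_prod G g m"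
proof (induction m)
  case (Suc m)
  have "sh_prod G f m = sh_prod G g m" using Suc.prems by (intro sh_prod_cong) auto
  then show ?case using Suc by simp
qed simp

lemma qfact_Suc: "qfact q (Suc n) = qfact q n * qint q (Suc n)"
  by (simp add: qfact_def)

lemma qsuperfact_Suc: "qsuperfact q (Suc n) = qsuperfact q n * qfact q (Suc n)"
  by (simp add: qsuperfact_def)

definition opposite_ring :: "('a, 'b) ring_scheme \<Rightarrow> ('a, 'b) ring_scheme" where
  "opposite_ring R = R\<lparr>mult := \<lambda>x y. y \<otimes>\<^bsub>R\<^esub> x\<rparr>"

lemma opposite_ring_simps [simp]:
  "carrier (opposite_ring R) = carrier R"
  "x \<otimes>\<^bsub>opposite_ring R\<^esub> y = y \<otimes>\<^bsub>R\<^esub> x"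
  "\<one>\<^bsub>opposite_ring R\<^esub> = \<one>\<^bsub>R\<^esub>"
  "\<zero>\<^bsub>opposite_ring R\<^esub> = \<zero>\<^bsub>R\<^esub>"
  "x \<oplus>\<^bsub>opposite_ring R\<^esub> y = x \<oplus>\<^bsub>R\<^esub> y"
  by (simp_all add: opposite_ring_def)

lemma (in ring) ring_opposite_ring: "ring (opposite_ring R)"
proof (rule ringI)
  show "abelian_group (opposite_ring R)"
  proof (rule abelian_groupI)
    fix x assume "x \<in> carrier (opposite_ring R)"
    then show "\<exists>y\<in>carrier (opposite_ring R). y \<oplus>\<^bsub>opposite_ring R\<^esub> x = \<zero>\<^bsub>opposite_ring R\<^esub>"
      by (intro bexI[of _ "\<ominus> x"]) (simp_all add: l_neg)
  qed (simp_all add: a_ac)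
  show "Group.monoid (opposite_ring R)"
    by (rule Group.monoidI) (auto simp: m_assoc)
qed (auto simp: l_distr r_distr)

section \<open>Generators acting on the shuffle products from the left\<close>

context bmw_ring
begin

abbreviation "Sh \<equiv> sh_prod R (\<lambda>k. bax k k)"
abbreviation "Sg \<equiv> sigma_prod R (\<lambda>k. bax k k)"

text \<open>The second disjunct covers the empty product for n = 0, which occurs as the predecessor
  of n = 1.\<close>

lemma Sh_closed [simp]: "k < n \<or> k = 0 \<Longrightarrow> Sh k \<in> carrier R"
  by (induction k) auto

lemma Sg_closed [simp]: "m \<le> n \<Longrightarrow> Sg m \<in> carrier R"
  by (induction m) auto

lemma s_comm_bax:
  assumes "i \<in> {1..<n}" "j \<in> {1..<n}" "Suc i < j \<or> Suc j < i"
  shows "s i \<otimes> bax j k = bax j k \<otimes> s i"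
  using assms far[of i j] far[of j i] by (intro intertwine_bax) auto

lemma s_comm_Sh:
  assumes "i < n" "Suc k < i"
  shows "s i \<otimes> Sh k = Sh k \<otimes> s i"
  using assms
proof (induction k)
  case (Suc k)
  then have mem: "i \<in> {1..<n}" "Suc k \<in> {1..<n}" by auto
  have "s i \<otimes> Sh (Suc k) = (s i \<otimes> Sh k) \<otimes> bax (Suc k) (Suc k)"
    using Suc.prems mem by (simp add: m_assoc)
  also have "\<dots> = Sh k \<otimes> (s i \<otimes> bax (Suc k) (Suc k))"
    using Suc.prems mem by (subst Suc.IH) (simp_all add: m_assoc)
  also have "\<dots> = Sh (Suc k) \<otimes> s i"
    using Suc.prems mem s_comm_bax[OF mem] by (simp add: m_assoc)
  finally show ?case .
qed auto

text \<open>Factors of index above i are at distance at least 2 from i - 1, so they can be absorbed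
  into \<open>X\<close> without losing its eigenvector property; this reduces to k = i. There
  \<open>bax_one_eigen\<close> settles i = 1. Otherwise \<open>s i\<close> commutes with all but the
  last two factors, and \<open>bax_pair_eigen\<close> handles these two.\<close>

lemma s_Sh_eigen:
  assumes "1 \<le> i" "i \<le> k" "k < n" "X \<in> carrier R" "2 \<le> i \<Longrightarrow> s (i - 1) \<otimes> X = q \<odot> X"
  shows "s i \<otimes> (Sh k \<otimes> X) = q \<odot> (Sh k \<otimes> X)"
  using assms(2-)
proof (induction k arbitrary: X rule: dec_induct)
  case base
  note X [simp] = \<open>X \<in> carrier R\<close>
  have i: "i \<in> {1..<n}" using base assms(1) by auto
  show ?case
  proof (cases "i = 1")
    case True
    have "s i \<otimes> (bax i 1 \<otimes> X) = (s i \<otimes> bax i 1) \<otimes> X" using i by (simp add: m_assoc)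
    then show ?thesis using i bax_one_eigen[OF i] by (simp add: True)
  next
    case False
    then obtain k where k: "i = Suc (Suc k)" using assms(1) by (cases i; cases "i - 1") auto
    have mem: "Suc k \<in> {1..<n}" "i \<in> {1..<n}" "k < n" using i k by auto
    let ?Y = "bax (Suc k) (Suc k) \<otimes> (bax i i \<otimes> X)"
    have Y: "?Y \<in> carrier R" using mem by (simp del: atLeastLessThan_iff)
    have Sh: "Sh i \<otimes> X = Sh k \<otimes> ?Y" using mem unfolding k by (simp add: m_assoc)
    have "s i \<otimes> ?Y = q \<odot> ?Y"
      unfolding k using base k by (intro bax_pair_eigen) auto
    moreover have "s i \<otimes> (Sh k \<otimes> ?Y) = Sh k \<otimes> (s i \<otimes> ?Y)"
      using Y mem s_comm_Sh[of i k] k by (simp add: m_assoc[symmetric])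
    ultimately show ?thesis unfolding Sh using Y mem by simp
  qed
next
  case (step k)
  note X [simp] = \<open>X \<in> carrier R\<close>
  have mem: "Suc k \<in> {1..<n}" using step by auto
  have "s (i - 1) \<otimes> (bax (Suc k) (Suc k) \<otimes> X) = q \<odot> (bax (Suc k) (Suc k) \<otimes> X)" if "2 \<le> i"
  proof -
    have "i - 1 \<in> {1..<n}" "Suc (i - 1) < Suc k" using that step by auto
    with mem have "s (i - 1) \<otimes> (bax (Suc k) (Suc k) \<otimes> X) = bax (Suc k) (Suc k) \<otimes> (s (i - 1) \<otimes> X)"
      using s_comm_bax[of "i - 1" "Suc k"]
      by (simp add: m_assoc[symmetric] del: atLeastLessThan_iff)
    then show ?thesis using step.prems that mem by (simp del: atLeastLessThan_iff)
  qed
  from step.IH[OF _ _ this] step mem show ?case by (simp add: m_assoc)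
qed

text \<open>The inductive hypothesis at i - 1 is exactly what \<open>s_Sh_eigen\<close> asks of X =
  \<open>Sg m\<close> when i is at least 2.\<close>

lemma s_Sg_eigen:
  assumes "m \<le> n" "1 \<le> i" "i < m"
  shows "s i \<otimes> Sg m = q \<odot> Sg m"
  using assms
proof (induction m arbitrary: i)
  case (Suc m)
  show ?case using Suc.prems Suc.IH[of "i - 1"] by (auto intro!: s_Sh_eigen)
qed auto

text \<open>The left side is the value of \<open>bax i j\<close> when \<sigma> is replaced by q and
  \<kappa> by 0. It serves both for eigenvectors and for the character.\<close>

lemma bax_eigenvalue: "inverse (q ^ j) * (1 + (q ^ (2 * j) - 1) / z * q) = qint q (Suc j)"
proof -
  have zq: "z + (q ^ (2 * j) - 1) * q = q * q ^ j * q ^ j - inverse q"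
    by (simp only: mult_2 power_add) (simp add: z_def algebra_simps)
  have "inverse (q ^ j) * (1 + (q ^ (2 * j) - 1) / z * q) =
      inverse (q ^ j) * (z + (q ^ (2 * j) - 1) * q) / z"
    using z_nz by (simp add: field_simps)
  also have "inverse (q ^ j) * (z + (q ^ (2 * j) - 1) * q) = q ^ Suc j - inverse q ^ Suc j"
    unfolding zq using q_nz by (simp add: right_diff_distrib power_inverse)
  finally show ?thesis by (simp add: qint_def z_def)
qed

lemma qint_1: "qint q (Suc 0) = 1"
  using z_nz by (simp add: qint_def z_def)

section \<open>Eigenvalues of the shuffle products on right eigenvectors\<close>

context
  fixes Y assumes Y [simp]: "Y \<in> carrier R" and Y_s: "\<And>i. i \<in> {1..<n} \<Longrightarrow> Y \<otimes> s i = q \<odot> Y"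
begin

lemma eigen_K:
  assumes i: "i \<in> {1..<n}"
  shows "Y \<otimes> K i = \<zero>"
proof -
  have "Y = (Y \<otimes> s i) \<otimes> t i" using i by (simp add: m_assoc s_t del: atLeastLessThan_iff)
  also have "\<dots> = q \<odot> (Y \<otimes> t i)" using i by (simp add: Y_s del: atLeastLessThan_iff)
  finally have "inverse q \<odot> Y = inverse q \<odot> q \<odot> (Y \<otimes> t i)" by simp
  then have Y_t: "Y \<otimes> t i = inverse q \<odot> Y" using i q_nz by (simp del: atLeastLessThan_iff)
  have "Y \<otimes> K i = Y \<oplus> (- 1 / z) \<odot> q \<odot> Y \<oplus> (1 / z) \<odot> inverse q \<odot> Y"
    using i by (simp add: K_expand r_distr Y_s Y_t del: smult_smult atLeastLessThan_iff)
  also have "\<dots> = (1 + (- 1 / z) * q + (1 / z) * inverse q) \<odot> Y"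
    by (simp only: add_smult one_smult smult_smult Y)
  also have "1 + (- 1 / z) * q + (1 / z) * inverse q = 1 - (q - inverse q) / z"
    by (simp add: diff_divide_distrib)
  also have "\<dots> = 0" using z_nz by (simp add: z_def[symmetric])
  finally show ?thesis by simp
qed

lemma eigen_bax:
  assumes i: "i \<in> {1..<n}"
  shows "Y \<otimes> bax i j = qint q (Suc j) \<odot> Y"
proof -
  have "Y \<otimes> bax i j = inverse (q ^ j) \<odot> (Y \<oplus> ((q ^ (2 * j) - 1) / z * q) \<odot> Y)"
    using i by (simp add: bax_def r_distr eigen_K Y_s del: atLeastLessThan_iff)
  also have "\<dots> = (inverse (q ^ j) * (1 + (q ^ (2 * j) - 1) / z * q)) \<odot> Y"
    by (simp add: smult_add add_smult distrib_left)
  also note bax_eigenvalue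
  finally show ?thesis .
qed

text \<open>The factors contribute [2], ..., [k + 1]; since [1] = 1 this is the full factorial of k
  + 1.\<close>

lemma eigen_Sh:
  assumes "k < n \<or> k = 0"
  shows "Y \<otimes> Sh k = qfact q (Suc k) \<odot> Y"
  using assms
proof (induction k)
  case 0
  then show ?case by (simp add: qfact_def qint_1)
next
  case (Suc k)
  have "Y \<otimes> Sh (Suc k) = (Y \<otimes> Sh k) \<otimes> bax (Suc k) (Suc k)"
    using Suc.prems by (simp add: m_assoc)
  also have "\<dots> = (qfact q (Suc k) * qint q (Suc (Suc k))) \<odot> Y"
    using Suc by (simp add: eigen_bax)
  finally show ?case by (simp only: qfact_Suc[of q "Suc k"])
qed

lemma eigen_Sg:
  assumes "m \<le> n"
  shows "Y \<otimes> Sg m = qsuperfact q m \<odot> Y"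
  using assms
proof (induction m)
  case 0
  then show ?case by (simp add: qsuperfact_def)
next
  case (Suc m)
  have "Y \<otimes> Sg (Suc m) = (Y \<otimes> Sh m) \<otimes> Sg m"
    using Suc.prems by (simp add: m_assoc)
  also have "\<dots> = (qsuperfact q m * qfact q (Suc m)) \<odot> Y"
    using Suc by (simp add: eigen_Sh mult.commute)
  finally show ?case by (simp only: qsuperfact_Suc)
qed

end

text \<open>The relations are invariant under reversing words, so left-handed results have right-handed twins.\<close>

lemma bmw_ring_opposite: "bmw_ring (opposite_ring R) c q \<nu> n s t K"
proof -
  interpret op: ring "opposite_ring R" by (rule ring_opposite_ring)
  \<comment> \<open>Additive inverses are attached to the whole ring record, so those of the two
    rings are identified by uniqueness before \<open>K_eq\<close> can be transferred.\<close>
  have inv: "\<ominus>\<^bsub>opposite_ring R\<^esub> x = \<ominus> x" if "x \<in> carrier R" for x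
    using that by (intro op.minus_equality) (auto simp: l_neg)
  have minus: "x \<ominus>\<^bsub>opposite_ring R\<^esub> y = x \<ominus> y" if "y \<in> carrier R" for x y
    using that by (simp add: a_minus_def inv)
  show ?thesis
  proof
    fix i assume i: "i \<in> {1..<n}"
    show "K i = \<one>\<^bsub>opposite_ring R\<^esub> \<ominus>\<^bsub>opposite_ring R\<^esub>
        c (1 / (q - inverse q)) \<otimes>\<^bsub>opposite_ring R\<^esub> (s i \<ominus>\<^bsub>opposite_ring R\<^esub> t i)"
      using i by (simp add: K_eq minus c_central del: atLeastLessThan_iff)
    show "K i \<otimes>\<^bsub>opposite_ring R\<^esub> s i = c \<nu> \<otimes>\<^bsub>opposite_ring R\<^esub> K i"
      "s i \<otimes>\<^bsub>opposite_ring R\<^esub> K i = c \<nu> \<otimes>\<^bsub>opposite_ring R\<^esub> K i"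
      using i by (simp_all add: K_s s_K c_central del: atLeastLessThan_iff)
  next
    fix i j assume "i \<in> {1..<n}" "j \<in> {1..<n}" "Suc i < j"
    then show "s i \<otimes>\<^bsub>opposite_ring R\<^esub> s j = s j \<otimes>\<^bsub>opposite_ring R\<^esub> s i"
      using far[of i j] by simp
  next
    fix i assume i: "1 \<le> i" "Suc i < n"
    then have mem: "i \<in> {1..<n}" "Suc i \<in> {1..<n}" by auto
    show "s i \<otimes>\<^bsub>opposite_ring R\<^esub> (s (Suc i) \<otimes>\<^bsub>opposite_ring R\<^esub> s i) =
        s (Suc i) \<otimes>\<^bsub>opposite_ring R\<^esub> (s i \<otimes>\<^bsub>opposite_ring R\<^esub> s (Suc i))"
      using mem braid[OF i] by (simp add: m_assoc del: atLeastLessThan_iff)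
    show "K (Suc i) \<otimes>\<^bsub>opposite_ring R\<^esub> (s i \<otimes>\<^bsub>opposite_ring R\<^esub> K (Suc i)) =
        c (inverse \<nu>) \<otimes>\<^bsub>opposite_ring R\<^esub> K (Suc i)"
      "K (Suc i) \<otimes>\<^bsub>opposite_ring R\<^esub> (t i \<otimes>\<^bsub>opposite_ring R\<^esub> K (Suc i)) =
        c \<nu> \<otimes>\<^bsub>opposite_ring R\<^esub> K (Suc i)"
      using mem K_s_K[OF i] K_t_K[OF i] by (simp_all add: m_assoc c_central del: atLeastLessThan_iff)
  next
    fix a b :: 'k and x assume "x \<in> carrier (opposite_ring R)"
    then show "x \<otimes>\<^bsub>opposite_ring R\<^esub> c a = c a \<otimes>\<^bsub>opposite_ring R\<^esub> x"
      using c_central[of x a] by simp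
  next
    fix a b :: 'k
    show "c (a * b) = c a \<otimes>\<^bsub>opposite_ring R\<^esub> c b"
      using c_mult[of b a] by (simp add: mult.commute)
  qed (use generic in \<open>simp_all add: c_one c_add q_nz q2 s_t t_s\<close>)
qed

lemma Sg_s_eigen:
  assumes nz: "qsuperfact q n \<noteq> 0" and i: "i \<in> {1..<n}"
  shows "Sg n \<otimes> s i = q \<odot> Sg n"
proof -
  interpret op: bmw_ring "opposite_ring R" c q \<nu> n s t K by (rule bmw_ring_opposite)
  \<comment> \<open>In the opposite ring scalars multiply from the right; centrality makes both
    actions agree.\<close>
  have sm: "op.smult a x = a \<odot> x" if "x \<in> carrier R" for a x
    unfolding op.smult_def smult_def using c_central[OF that, of a] by simp
  \<comment> \<open>The same factors multiplied in reverse order: a right eigenvector of all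
    generators.\<close>
  let ?S = "op.Sg n"
  have S [simp]: "?S \<in> carrier R" using op.Sg_closed[of n] by simp
  have S_s: "?S \<otimes> s j = q \<odot> ?S" if "j \<in> {1..<n}" for j
    using op.s_Sg_eigen[of n j] that by (simp add: sm)
  have "?S \<otimes> Sg n = qsuperfact q n \<odot> ?S"
    by (rule eigen_Sg) (auto simp: S_s)
  moreover have "?S \<otimes> Sg n = qsuperfact q n \<odot> Sg n"
  proof -
    \<comment> \<open>The same product read in the opposite ring, where \<open>Sg n\<close> takes
      over the role of the right eigenvector.\<close>
    have "Sg n \<otimes>\<^bsub>opposite_ring R\<^esub> ?S = op.smult (qsuperfact q n) (Sg n)"
    proof (rule op.eigen_Sg)
      show "Sg n \<otimes>\<^bsub>opposite_ring R\<^esub> s j = op.smult q (Sg n)" if "j \<in> {1..<n}" for j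
        using s_Sg_eigen[of n j] that sm[of "Sg n" q] by simp
    qed simp_all
    then show ?thesis using sm[of "Sg n" "qsuperfact q n"] by simp
  qed
  ultimately have "qsuperfact q n \<odot> ?S = qsuperfact q n \<odot> Sg n" by simp
  then have "?S = Sg n" using nz by (rule smult_cancel[rotated 3]) simp_all
  then show ?thesis using S_s[OF i] by simp
qed

end

section \<open>Characters of group algebras\<close>

text \<open>A character with value q on the generators takes the value q^(-1) on their inverses and
  0 on \<kappa>, so it meets the same quantum integers as an eigenvector does. A non-zero
  superfactorial therefore forces \<open>Sg n\<close> to be non-zero.\<close>

lemma (in bmw_ring) character_Sg:
  fixes \<phi> :: "'a \<Rightarrow> 'k"
  assumes mult: "\<And>x y. x \<in> carrier R \<Longrightarrow> y \<in> carrier R \<Longrightarrow> \<phi> (x \<otimes> y) = \<phi> x * \<phi> y"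
    and add: "\<And>x y. x \<in> carrier R \<Longrightarrow> y \<in> carrier R \<Longrightarrow> \<phi> (x \<oplus> y) = \<phi> x + \<phi> y"
    and scal: "\<And>a. \<phi> (c a) = a" and sig: "\<And>i. i \<in> {1..<n} \<Longrightarrow> \<phi> (s i) = q"
  shows "m \<le> n \<Longrightarrow> \<phi> (Sg m) = qsuperfact q m"
proof -
  have one: "\<phi> \<one> = 1" using scal[of 1] by (simp add: c_one)
  have sm: "\<phi> (a \<odot> x) = a * \<phi> x" if "x \<in> carrier R" for a x
    using that by (simp add: smult_def mult scal)
  have t: "\<phi> (t i) = inverse q" if i: "i \<in> {1..<n}" for i
    using mult[OF s_closed[OF i] t_closed[OF i]] i q_nz
    by (simp add: s_t one sig field_simps del: atLeastLessThan_iff)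
  have K: "\<phi> (K i) = 0" if i: "i \<in> {1..<n}" for i
  proof -
    have "\<phi> (K i) = 1 - (q - inverse q) / z"
      using i by (simp add: K_expand add sm one sig t diff_divide_distrib inverse_eq_divide
          del: atLeastLessThan_iff)
    then show ?thesis using z_nz by (simp add: z_def[symmetric])
  qed
  have bax: "\<phi> (bax i j) = qint q (Suc j)" if i: "i \<in> {1..<n}" for i j
    using i bax_eigenvalue[of j] by (simp add: bax_def add sm one sig K del: atLeastLessThan_iff)
  have Sh: "\<phi> (Sh k) = qfact q (Suc k)" if "k < n \<or> k = 0" for k
    using that
  proof (induction k)
    case 0
    then show ?case by (simp add: one qfact_def qint_1)
  next
    case (Suc k)
    then show ?case by (simp add: mult bax qfact_Suc[of q "Suc k"])
  qed
  show "\<phi> (Sg m) = qsuperfact q m" if "m \<le> n"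
    using that
  proof (induction m)
    case 0
    then show ?case by (simp add: one qsuperfact_def)
  next
    case (Suc m)
    then show ?case by (simp add: mult Sh qsuperfact_Suc)
  qed
qed

lemma ideal_character_kernel:
  fixes R (structure) and \<phi> :: "'a \<Rightarrow> 'k::field"
  assumes "ring R"
    and mult: "\<And>x y. x \<in> carrier R \<Longrightarrow> y \<in> carrier R \<Longrightarrow> \<phi> (x \<otimes> y) = \<phi> x * \<phi> y"
    and add: "\<And>x y. x \<in> carrier R \<Longrightarrow> y \<in> carrier R \<Longrightarrow> \<phi> (x \<oplus> y) = \<phi> x + \<phi> y"
  shows "ideal {x \<in> carrier R. \<phi> x = 0} R"
proof -
  interpret ring R by fact
  have zero: "\<phi> \<zero> = 0" using add[of \<zero> \<zero>] by (metis add_cancel_right_right l_zero zero_closed)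
  have uminus: "\<phi> (\<ominus> x) = - \<phi> x" if "x \<in> carrier R" for x
    using add[of x "\<ominus> x"] that by (simp add: r_neg zero add_eq_0_iff)
  show ?thesis
  proof (rule idealI[OF \<open>ring R\<close>])
    show "subgroup {x \<in> carrier R. \<phi> x = 0} (add_monoid R)"
      by (rule add.subgroupI)
        (auto simp: add zero uminus simp flip: a_inv_def intro: exI[of _ \<zero>])
  qed (auto simp: mult)
qed

lemma basis_elem_mult:
  "basis_elem a \<otimes>\<^bsub>group_algebra G\<^esub> basis_elem b = (basis_elem (a \<otimes>\<^bsub>G\<^esub> b) :: _ \<Rightarrow> 'k::field)"
  by (auto simp: fun_eq_iff group_algebra_mult_eq[of "{a}" _ "{b}"] basis_elem_def)

lemma scalar_elem_mult:
  assumes G: "Group.monoid G" and f: "f \<in> carrier (group_algebra G)"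
  shows "scalar_elem G c \<otimes>\<^bsub>group_algebra G\<^esub> f = (\<lambda>x. c * f x)"
    and "f \<otimes>\<^bsub>group_algebra G\<^esub> scalar_elem G c = (\<lambda>x. c * f x)"
proof -
  let ?A = "{x. f x \<noteq> 0}"
  have fin: "finite ?A" and sub: "?A \<subseteq> carrier G" using f by (auto simp: group_algebra_carrier)
  show "scalar_elem G c \<otimes>\<^bsub>group_algebra G\<^esub> f = (\<lambda>x. c * f x)"
  proof
    fix x
    have "(scalar_elem G c \<otimes>\<^bsub>group_algebra G\<^esub> f) x =
        (\<Sum>b\<in>?A. if \<one>\<^bsub>G\<^esub> \<otimes>\<^bsub>G\<^esub> b = x then c * f b else 0)"
      using fin by (subst group_algebra_mult_eq[of "{\<one>\<^bsub>G\<^esub>}" _ ?A]) (auto simp: scalar_elem_def intro!: sum.cong)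
    also have "\<dots> = (\<Sum>b\<in>?A. if b = x then c * f b else 0)"
      using sub by (intro sum.cong refl) (auto simp: monoid.l_one[OF G] subset_iff)
    also have "\<dots> = c * f x" using fin by (simp add: sum.delta')
    finally show "(scalar_elem G c \<otimes>\<^bsub>group_algebra G\<^esub> f) x = c * f x" .
  qed
  show "f \<otimes>\<^bsub>group_algebra G\<^esub> scalar_elem G c = (\<lambda>x. c * f x)"
  proof
    fix x
    have "(f \<otimes>\<^bsub>group_algebra G\<^esub> scalar_elem G c) x =
        (\<Sum>b\<in>?A. if b \<otimes>\<^bsub>G\<^esub> \<one>\<^bsub>G\<^esub> = x then c * f b else 0)"
      using fin by (subst group_algebra_mult_eq[of ?A _ "{\<one>\<^bsub>G\<^esub>}"])
        (auto simp: scalar_elem_def mult.commute intro!: sum.cong)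
    also have "\<dots> = (\<Sum>b\<in>?A. if b = x then c * f b else 0)"
      using sub by (intro sum.cong refl) (auto simp: monoid.r_one[OF G] subset_iff)
    also have "\<dots> = c * f x" using fin by (simp add: sum.delta')
    finally show "(f \<otimes>\<^bsub>group_algebra G\<^esub> scalar_elem G c) x = c * f x" .
  qed
qed

lemma group_algebra_induct [consumes 1, case_names zero add]:
  fixes f :: "'g \<Rightarrow> 'k::field"
  assumes "f \<in> carrier (group_algebra G)"
    and zero: "P (\<lambda>x. 0)"
    and add: "\<And>f g c. f \<in> carrier (group_algebra G) \<Longrightarrow> g \<in> carrier G \<Longrightarrow> P f \<Longrightarrow>
      P (\<lambda>x. f x + c * basis_elem g x)"
  shows "P f"
proof -
  have "finite {x. f x \<noteq> 0}" "{x. f x \<noteq> 0} \<subseteq> carrier G"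
    using assms(1) by (auto simp: group_algebra_carrier)
  then show ?thesis
  proof (induction "{x. f x \<noteq> 0}" arbitrary: f rule: finite_induct)
    case empty
    then have "f = (\<lambda>x. 0)" by auto
    then show ?case using zero by simp
  next
    case (insert g A)
    \<comment> \<open>Remove one point from the support and restore it as a multiple of a basis
      element.\<close>
    let ?h = "f(g := 0)"
    have A: "{x. ?h x \<noteq> 0} = A" using insert.hyps by auto
    have "P ?h" using insert.hyps(3)[of ?h] A insert.hyps(4) insert.prems by auto
    moreover have "?h \<in> carrier (group_algebra G)"
      unfolding group_algebra_carrier A using insert by auto
    moreover have "g \<in> carrier G" using insert.hyps(4) insert.prems by auto
    ultimately have "P (\<lambda>x. ?h x + f g * basis_elem g x)"
      by (rule add[rotated 2])
    moreover have "(\<lambda>x. ?h x + f g * basis_elem g x) = f"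
      by (auto simp: basis_elem_def)
    ultimately show ?case by simp
  qed
qed

definition character_ext :: "('g \<Rightarrow> 'k::field) \<Rightarrow> ('g \<Rightarrow> 'k) \<Rightarrow> 'k" where
  "character_ext \<chi> f = (\<Sum>x | f x \<noteq> 0. f x * \<chi> x)"

lemma character_ext_eq:
  "finite A \<Longrightarrow> {x. f x \<noteq> 0} \<subseteq> A \<Longrightarrow> character_ext \<chi> f = (\<Sum>x\<in>A. f x * \<chi> x)"
  unfolding character_ext_def by (intro sum.mono_neutral_left) auto

lemma character_ext_basis: "character_ext \<chi> (basis_elem g) = \<chi> g"
  by (simp add: character_ext_eq[of "{g}"] basis_elem_def)

lemma character_ext_scalar: "character_ext \<chi> (scalar_elem G c) = c * \<chi> \<one>\<^bsub>G\<^esub>"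
  by (subst character_ext_eq[of "{\<one>\<^bsub>G\<^esub>}"]) (auto simp: scalar_elem_def)

lemma character_ext_add:
  assumes f: "f \<in> carrier (group_algebra G)" and g: "g \<in> carrier (group_algebra G)"
  shows "character_ext \<chi> (f \<oplus>\<^bsub>group_algebra G\<^esub> g) = character_ext \<chi> f + character_ext \<chi> g"
proof -
  let ?A = "{x. f x \<noteq> 0} \<union> {x. g x \<noteq> 0}"
  have "finite ?A" using f g by (auto simp: group_algebra_carrier)
  then have "character_ext \<chi> u = (\<Sum>x\<in>?A. u x * \<chi> x)" if "{x. u x \<noteq> 0} \<subseteq> ?A" for u
    using that by (rule character_ext_eq)
  from this[of f] this[of g] this[of "\<lambda>x. f x + g x"] show ?thesis
    using group_algebra_add_support[of f g]
    by (simp add: group_algebra_def sum.distrib distrib_right)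
qed

lemma character_ext_mult:
  assumes f: "f \<in> carrier (group_algebra G)" and g: "g \<in> carrier (group_algebra G)"
    and \<chi>: "\<And>a b. a \<in> carrier G \<Longrightarrow> b \<in> carrier G \<Longrightarrow> \<chi> (a \<otimes>\<^bsub>G\<^esub> b) = \<chi> a * \<chi> b"
  shows "character_ext \<chi> (f \<otimes>\<^bsub>group_algebra G\<^esub> g) = character_ext \<chi> f * character_ext \<chi> g"
proof -
  define A where "A = {x. f x \<noteq> 0}"
  define B where "B = {x. g x \<noteq> 0}"
  define D where "D = (\<lambda>(a, b). a \<otimes>\<^bsub>G\<^esub> b) ` (A \<times> B)"
  have fin: "finite A" "finite B" "finite D" and sub: "A \<subseteq> carrier G" "B \<subseteq> carrier G"
    using f g by (auto simp: group_algebra_carrier A_def B_def D_def)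
  have "character_ext \<chi> (f \<otimes>\<^bsub>group_algebra G\<^esub> g) = (\<Sum>d\<in>D. (f \<otimes>\<^bsub>group_algebra G\<^esub> g) d * \<chi> d)"
    using fin group_algebra_mult_support[of G f g]
    by (intro character_ext_eq) (auto simp: A_def B_def D_def)
  also have "\<dots> = (\<Sum>d\<in>D. \<Sum>a\<in>A. \<Sum>b\<in>B. if a \<otimes>\<^bsub>G\<^esub> b = d then f a * g b * \<chi> d else 0)"
    using fin by (intro sum.cong refl)
      (simp add: group_algebra_mult_eq[of A f B g] A_def B_def sum_distrib_right if_distrib[of "\<lambda>x. x * _"]
        cong: if_cong)
  also have "\<dots> = (\<Sum>a\<in>A. \<Sum>b\<in>B. \<Sum>d\<in>D. if a \<otimes>\<^bsub>G\<^esub> b = d then f a * g b * \<chi> d else 0)"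
    by (rule trans[OF sum.swap], rule sum.cong[OF refl], rule sum.swap)
  also have "\<dots> = (\<Sum>a\<in>A. \<Sum>b\<in>B. f a * \<chi> a * (g b * \<chi> b))"
    using fin sub by (intro sum.cong refl) (auto simp: D_def \<chi> subset_iff sum.delta)
  also have "\<dots> = character_ext \<chi> f * character_ext \<chi> g"
    by (simp add: character_ext_def A_def B_def sum_product)
  finally show ?thesis .
qed

section \<open>The character of braid groups and their algebras with value q on generators\<close>

primrec word_weight :: "'k::field \<Rightarrow> braid_word \<Rightarrow> 'k" where
  "word_weight q [] = 1"
| "word_weight q (x # w) = (if snd x then q else inverse q) * word_weight q w"

lemma word_weight_append [simp]: "word_weight q (u @ v) = word_weight q u * word_weight q v"
  by (induction u) (auto simp: mult.assoc)

text \<open>The weight is q to the exponent sum, which the braid relations preserve; cancellation of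
  a letter with its inverse uses that q is non-zero.\<close>

lemma word_weight_cong:
  assumes "q \<noteq> 0"
  shows "(u, v) \<in> braid_cong n \<Longrightarrow> word_weight q u = word_weight q v"
  by (induction rule: braid_cong.induct) (use assms in auto)

text \<open>Computed on a chosen representative; \<open>word_weight_cong\<close> makes the choice
  immaterial for non-zero q, whatever the number of strands.\<close>

definition braid_character :: "'k::field \<Rightarrow> braid_word set \<Rightarrow> 'k" where
  "braid_character q X = word_weight q (SOME w. w \<in> X)"

lemma braid_character_class:
  assumes "q \<noteq> 0" "w \<in> braid_words n"
  shows "braid_character q (braid_cong n `` {w}) = word_weight q w"
proof -
  have "w \<in> braid_cong n `` {w}" using assms(2) by (auto intro: braid_cong.rel_refl)
  then have "(SOME v. v \<in> braid_cong n `` {w}) \<in> braid_cong n `` {w}" by (rule someI)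
  then have "(w, SOME v. v \<in> braid_cong n `` {w}) \<in> braid_cong n" by (simp only: Image_singleton_iff)
  then show ?thesis unfolding braid_character_def by (metis word_weight_cong[OF assms(1)])
qed

lemma braid_character_mult:
  assumes "q \<noteq> 0" "a \<in> carrier (braid_group n)" "b \<in> carrier (braid_group n)"
  shows "braid_character q (a \<otimes>\<^bsub>braid_group n\<^esub> b) = braid_character q a * braid_character q b"
proof -
  obtain u v where uv: "u \<in> braid_words n" "v \<in> braid_words n"
    "a = braid_cong n `` {u}" "b = braid_cong n `` {v}"
    using assms by (auto simp: carrier_braid_group)
  then show ?thesis
    by (simp only: uv braid_mult_class braid_character_class[OF assms(1)] braid_words_append
        word_weight_append simp_thms)
qed

definition kB_character :: "'k::field \<Rightarrow> 'k braid_alg_elem \<Rightarrow> 'k" where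
  "kB_character q = character_ext (braid_character q)"

context
  fixes q :: "'k::field" assumes q: "q \<noteq> 0"
begin

lemma kB_character_hom:
  assumes "f \<in> carrier (kB n)" "g \<in> carrier (kB n)"
  shows "kB_character q (f \<otimes>\<^bsub>kB n\<^esub> g) = kB_character q f * kB_character q g"
    and "kB_character q (f \<oplus>\<^bsub>kB n\<^esub> g) = kB_character q f + kB_character q g"
    and "kB_character q (f \<ominus>\<^bsub>kB n\<^esub> g) = kB_character q f - kB_character q g"
proof -
  interpret ring "kB n" by (rule ring_kB)
  show "kB_character q (f \<otimes>\<^bsub>kB n\<^esub> g) = kB_character q f * kB_character q g"
    using assms braid_character_mult[OF q] unfolding kB_character_def kB_def
    by (intro character_ext_mult)
  have add: "kB_character q (f \<oplus>\<^bsub>kB n\<^esub> g) = kB_character q f + kB_character q g"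
    if "f \<in> carrier (kB n)" "g \<in> carrier (kB n)" for f g
    using that unfolding kB_character_def kB_def by (intro character_ext_add)
  then show "kB_character q (f \<oplus>\<^bsub>kB n\<^esub> g) = kB_character q f + kB_character q g"
    using assms by blast
  have "(f \<ominus>\<^bsub>kB n\<^esub> g) \<oplus>\<^bsub>kB n\<^esub> g = f" using assms by (simp add: a_minus_def a_assoc l_neg)
  then show "kB_character q (f \<ominus>\<^bsub>kB n\<^esub> g) = kB_character q f - kB_character q g"
    using add[of "f \<ominus>\<^bsub>kB n\<^esub> g" g] assms by simp
qed

lemma kB_character_generators:
  "kB_character q (kB_scalar n c) = c" "kB_character q \<one>\<^bsub>kB n\<^esub> = 1"
  "i \<in> {1..<n} \<Longrightarrow> kB_character q (kB_sigma n i) = q"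
  "i \<in> {1..<n} \<Longrightarrow> kB_character q (kB_sigma_inv n i) = inverse q"
proof -
  show sc: "kB_character q (kB_scalar n c) = c" for c
    unfolding kB_character_def kB_scalar_def character_ext_scalar one_braid_group
    by (simp only: braid_character_class[OF q] Nil_braid_words word_weight.simps mult_1_right)
  have "\<one>\<^bsub>kB n\<^esub> = (kB_scalar n 1 :: 'k braid_alg_elem)"
    by (simp add: kB_def kB_scalar_def group_algebra_def scalar_elem_def)
  then show "kB_character q \<one>\<^bsub>kB n\<^esub> = 1" by (simp add: sc)
  assume "i \<in> {1..<n}"
  then have w: "[(i, e)] \<in> braid_words n" for e by (simp add: braid_words_def)
  show "kB_character q (kB_sigma n i) = q" "kB_character q (kB_sigma_inv n i) = inverse q"
    unfolding kB_character_def kB_sigma_def kB_sigma_inv_def character_ext_basis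
      braid_character_class[OF q w] by simp_all
qed

lemma kB_character_kappa:
  assumes "q\<^sup>2 \<noteq> 1" "i \<in> {1..<n}"
  shows "kB_character q (kB_kappa q n i) = 0"
proof -
  interpret ring "kB n" by (rule ring_kB)
  have "q - inverse q \<noteq> 0" using q assms(1) by (auto simp: field_simps power2_eq_square)
  then show ?thesis using assms(2) unfolding kB_kappa_def
    by (simp add: kB_character_hom kB_character_generators del: atLeastLessThan_iff)
qed

text \<open>Each term of a BMW relator contains \<kappa>, on which the character vanishes, and the
  Hecke relator becomes q^2 - ((q - q^(-1)) q + 1) = 0. The kernel is an ideal, so it contains the
  ideal that the relators generate.\<close>

lemma kB_character_rel_ideal:
  assumes q2: "q\<^sup>2 \<noteq> 1" and f: "f \<in> rel_ideal T q n"
  shows "kB_character q f = 0"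
proof -
  interpret ring "kB n" by (rule ring_kB)
  have "kB_character q r = 0" if r: "r \<in> relators T q n" for r
  proof (cases T)
    case Hecke
    with r show ?thesis using q
      by (auto simp: kB_character_hom kB_character_generators algebra_simps)
  next
    case (BMW \<nu>)
    have *: "i \<in> {1..<n} \<and> i - 1 \<in> {1..<n}" if "i \<in> {2..<n}" for i using that by auto
    from BMW r show ?thesis
      unfolding relators.simps
      by (auto simp: kB_character_hom kB_character_generators kB_character_kappa[OF q2]
          dest!: * simp del: atLeastLessThan_iff)
  qed
  then have "rel_ideal T q n \<subseteq> {f \<in> carrier (kB n). kB_character q f = 0}"
    unfolding rel_ideal_def using relators_closed[of T q n]
    by (intro genideal_minimal ideal_character_kernel ring_kB kB_character_hom) auto
  then show ?thesis using f by auto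
qed

end

definition alg_character :: "'k::field \<Rightarrow> 'k braid_alg_elem set \<Rightarrow> 'k" where
  "alg_character q X = kB_character q (SOME f. f \<in> X)"

lemma alg_character_proj:
  assumes q: "q \<noteq> 0" "q\<^sup>2 \<noteq> 1" and f: "f \<in> carrier (kB n)"
  shows "alg_character q (alg_proj T q n f) = kB_character q f"
proof -
  interpret I: ideal "rel_ideal T q n" "kB n" by (rule ideal_rel_ideal)
  have "f \<in> alg_proj T q n f"
    unfolding alg_proj_def using f by (rule I.a_rcos_self)
  then have "(SOME g. g \<in> alg_proj T q n f) \<in> alg_proj T q n f"
    by (rule someI[of "\<lambda>g. g \<in> alg_proj T q n f"])
  then obtain h where "h \<in> rel_ideal T q n" "(SOME g. g \<in> alg_proj T q n f) = h \<oplus>\<^bsub>kB n\<^esub> f"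
    unfolding alg_proj_def a_r_coset_def' by auto
  then show ?thesis unfolding alg_character_def
    using f kB_character_rel_ideal[OF q] by (simp add: kB_character_hom[OF q(1)] I.Icarr)
qed

section \<open>The Hecke and BMW algebras\<close>

lemma kB_word_mult:
  assumes "u \<in> braid_words n" "v \<in> braid_words n"
  shows "basis_elem (braid_cong n `` {u}) \<otimes>\<^bsub>kB n\<^esub> basis_elem (braid_cong n `` {v}) =
    (basis_elem (braid_cong n `` {u @ v}) :: 'k::field braid_alg_elem)"
  unfolding kB_def basis_elem_mult braid_mult_class[OF assms] by (rule refl)

lemma kB_one: "\<one>\<^bsub>kB n\<^esub> = (basis_elem (braid_cong n `` {[]}) :: 'k::field braid_alg_elem)"
  by (simp add: kB_def group_algebra_def basis_elem_def one_braid_group)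

lemma basis_elem_braid_eq:
  "(u, v) \<in> braid_cong n \<Longrightarrow> basis_elem (braid_cong n `` {u}) = basis_elem (braid_cong n `` {v})"
  by (simp only: equiv_class_eq[OF equiv_braid_cong])

lemma kB_braid_relations:
  fixes i j n :: nat
  defines "S \<equiv> kB_sigma n :: nat \<Rightarrow> 'k::field braid_alg_elem"
    and "S' \<equiv> kB_sigma_inv n :: nat \<Rightarrow> 'k braid_alg_elem"
  assumes i: "i \<in> {1..<n}"
  shows "S i \<otimes>\<^bsub>kB n\<^esub> S' i = \<one>\<^bsub>kB n\<^esub>" "S' i \<otimes>\<^bsub>kB n\<^esub> S i = \<one>\<^bsub>kB n\<^esub>"
    and "j \<in> {1..<n} \<Longrightarrow> Suc i < j \<Longrightarrow> S i \<otimes>\<^bsub>kB n\<^esub> S j = S j \<otimes>\<^bsub>kB n\<^esub> S i"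
    and "j \<in> {1..<n} \<Longrightarrow> j = Suc i \<Longrightarrow>
      S i \<otimes>\<^bsub>kB n\<^esub> (S j \<otimes>\<^bsub>kB n\<^esub> S i) = S j \<otimes>\<^bsub>kB n\<^esub> (S i \<otimes>\<^bsub>kB n\<^esub> S j)"
proof -
  have w: "w \<in> braid_words n \<longleftrightarrow> fst ` set w \<subseteq> {1..<n}" for w
    by (auto simp: braid_words_def)
  have mult: "basis_elem (braid_cong n `` {u}) \<otimes>\<^bsub>kB n\<^esub> basis_elem (braid_cong n `` {v}) =
    (basis_elem (braid_cong n `` {u @ v}) :: 'k braid_alg_elem)"
    if "fst ` set u \<subseteq> {1..<n}" "fst ` set v \<subseteq> {1..<n}" for u v
    using that by (intro kB_word_mult) (auto simp only: w)
  note sets = list.set image_insert image_empty fst_conv insert_subset empty_subsetI simp_thms append.simps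
  \<comment> \<open>The second sign is written as a negation so that \<open>rel_cancel\<close>
    matches literally.\<close>
  have "S i \<otimes>\<^bsub>kB n\<^esub> S' i = basis_elem (braid_cong n `` {[(i, True), (i, \<not> True)]})"
    "S' i \<otimes>\<^bsub>kB n\<^esub> S i = basis_elem (braid_cong n `` {[(i, False), (i, \<not> False)]})"
    using i unfolding S_def S'_def kB_sigma_def kB_sigma_inv_def by (simp_all only: mult sets)
  then show "S i \<otimes>\<^bsub>kB n\<^esub> S' i = \<one>\<^bsub>kB n\<^esub>" "S' i \<otimes>\<^bsub>kB n\<^esub> S i = \<one>\<^bsub>kB n\<^esub>"
    by (simp_all only: kB_one basis_elem_braid_eq[OF braid_cong.rel_cancel[OF i]])
  show "S i \<otimes>\<^bsub>kB n\<^esub> S j = S j \<otimes>\<^bsub>kB n\<^esub> S i" if "j \<in> {1..<n}" "Suc i < j"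
  proof -
    have "([(i, True), (j, True)], [(j, True), (i, True)]) \<in> braid_cong n"
      using i that by (intro braid_cong.rel_far) auto
    then show ?thesis using i that(1) unfolding S_def kB_sigma_def
      by (simp only: mult sets basis_elem_braid_eq)
  qed
  show "S i \<otimes>\<^bsub>kB n\<^esub> (S j \<otimes>\<^bsub>kB n\<^esub> S i) = S j \<otimes>\<^bsub>kB n\<^esub> (S i \<otimes>\<^bsub>kB n\<^esub> S j)"
    if "j \<in> {1..<n}" "j = Suc i"
  proof -
    have "([(i, True), (j, True), (i, True)], [(j, True), (i, True), (j, True)]) \<in> braid_cong n"
      using i that by (intro braid_cong.rel_braid) auto
    then show ?thesis using i that(1) unfolding S_def kB_sigma_def
      by (simp only: mult sets basis_elem_braid_eq)
  qed
qed

lemma scalar_ring_alg: "scalar_ring (alg T q n) (alg_scalar T q n)"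
proof -
  interpret kB: ring "kB n" by (rule ring_kB)
  interpret p: ring_hom_ring "kB n" "alg T q n" "alg_proj T q n" by (rule alg_proj_hom)
  have G: "Group.monoid (braid_group n)" by (intro group.is_monoid group_braid_group)
  have carr: "f \<in> carrier (group_algebra (braid_group n))" if "f \<in> carrier (kB n)" for f
    using that by (simp add: kB_def)
  have add: "kB_scalar n (a + b) = kB_scalar n a \<oplus>\<^bsub>kB n\<^esub> kB_scalar n b" for a b :: 'a
    by (auto simp: kB_scalar_def kB_def group_algebra_def scalar_elem_def)
  have mult: "kB_scalar n (a * b) = kB_scalar n a \<otimes>\<^bsub>kB n\<^esub> kB_scalar n b" for a b :: 'a
  proof -
    have "kB_scalar n a \<otimes>\<^bsub>kB n\<^esub> kB_scalar n b = (\<lambda>x. a * kB_scalar n b x)"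
      using scalar_elem_mult(1)[OF G carr[OF kB_closed(3)], of a b] by (simp add: kB_scalar_def kB_def)
    then show ?thesis by (auto simp: kB_scalar_def scalar_elem_def)
  qed
  have one: "kB_scalar n (1 :: 'a) = \<one>\<^bsub>kB n\<^esub>"
    by (simp add: kB_def kB_scalar_def group_algebra_def scalar_elem_def)
  have central: "f \<otimes>\<^bsub>kB n\<^esub> kB_scalar n a = kB_scalar n a \<otimes>\<^bsub>kB n\<^esub> f" if "f \<in> carrier (kB n)" for f and a :: 'a
    using scalar_elem_mult[OF G carr[OF that]] by (simp add: kB_scalar_def kB_def)
  show ?thesis
  proof
    fix x a assume "x \<in> carrier (alg T q n)"
    then obtain f where f: "f \<in> carrier (kB n)" "x = alg_proj T q n f" unfolding carrier_alg by auto
    show "x \<otimes>\<^bsub>alg T q n\<^esub> alg_scalar T q n a = alg_scalar T q n a \<otimes>\<^bsub>alg T q n\<^esub> x"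
      using f central[OF f(1), of a] by (simp add: alg_scalar_def p.hom_mult[symmetric] del: p.hom_mult)
  qed (simp_all add: alg_scalar_def add mult one)
qed

text \<open>In the Hecke tower \<kappa> vanishes and the relations with \<nu> read 0 = 0, so any
  value, here 1, makes the algebra an instance of \<open>bmw_ring\<close>.\<close>

fun tower_nu :: "'k::field tower \<Rightarrow> 'k" where
  "tower_nu Hecke = 1"
| "tower_nu (BMW \<nu>) = \<nu>"

lemma alg_proj_minus:
  assumes "f \<in> carrier (kB n)" "g \<in> carrier (kB n)"
  shows "alg_proj T q n (f \<ominus>\<^bsub>kB n\<^esub> g) = alg_proj T q n f \<ominus>\<^bsub>alg T q n\<^esub> alg_proj T q n g"
proof -
  interpret p: ring_hom_ring "kB n" "alg T q n" "alg_proj T q n" by (rule alg_proj_hom)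
  show ?thesis using assms by (simp add: a_minus_def)
qed

lemma alg_proj_eq:
  assumes "f \<in> carrier (kB n)" "g \<in> carrier (kB n)" "f \<ominus>\<^bsub>kB n\<^esub> g \<in> relators T q n"
  shows "alg_proj T q n f = alg_proj T q n g"
proof -
  interpret kB: ring "kB n" by (rule ring_kB)
  interpret p: ring_hom_ring "kB n" "alg T q n" "alg_proj T q n" by (rule alg_proj_hom)
  have "f \<ominus>\<^bsub>kB n\<^esub> g \<in> rel_ideal T q n"
    unfolding rel_ideal_def using kB.genideal_self[OF relators_closed] assms(3) by blast
  then have "alg_proj T q n (f \<ominus>\<^bsub>kB n\<^esub> g) = \<zero>\<^bsub>alg T q n\<^esub>"
    unfolding alg_proj_def alg_def FactRing_def using kB.a_rcos_zero[OF ideal_rel_ideal] by simp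
  then have "alg_proj T q n f \<ominus>\<^bsub>alg T q n\<^esub> alg_proj T q n g \<oplus>\<^bsub>alg T q n\<^esub> alg_proj T q n g = alg_proj T q n g"
    using assms(1,2) by (simp add: alg_proj_minus)
  then show ?thesis using assms(1,2) by (simp add: a_minus_def p.S.a_assoc p.S.l_neg)
qed

lemma alg_generators_closed:
  assumes "i \<in> {1..<n}"
  shows "alg_sigma T q n i \<in> carrier (alg T q n)"
    "alg_sigma_inv T q n i \<in> carrier (alg T q n)" "alg_kappa T q n i \<in> carrier (alg T q n)"
proof -
  interpret p: ring_hom_ring "kB n" "alg T q n" "alg_proj T q n" by (rule alg_proj_hom)
  show "alg_sigma T q n i \<in> carrier (alg T q n)"
    "alg_sigma_inv T q n i \<in> carrier (alg T q n)" "alg_kappa T q n i \<in> carrier (alg T q n)"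
    using assms
    by (simp_all add: alg_sigma_def alg_sigma_inv_def alg_kappa_def del: atLeastLessThan_iff)
qed

lemma alg_sigma_inverse:
  fixes q :: "'k::field"
  assumes "i \<in> {1..<n}"
  shows "alg_sigma T q n i \<otimes>\<^bsub>alg T q n\<^esub> alg_sigma_inv T q n i = \<one>\<^bsub>alg T q n\<^esub>"
    "alg_sigma_inv T q n i \<otimes>\<^bsub>alg T q n\<^esub> alg_sigma T q n i = \<one>\<^bsub>alg T q n\<^esub>"
proof -
  interpret p: ring_hom_ring "kB n" "alg T q n" "alg_proj T q n" by (rule alg_proj_hom)
  show "alg_sigma T q n i \<otimes>\<^bsub>alg T q n\<^esub> alg_sigma_inv T q n i = \<one>\<^bsub>alg T q n\<^esub>"
    "alg_sigma_inv T q n i \<otimes>\<^bsub>alg T q n\<^esub> alg_sigma T q n i = \<one>\<^bsub>alg T q n\<^esub>"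
    using kB_braid_relations(1,2)[OF assms, where ?'k = 'k] assms
    by (simp_all add: alg_sigma_def alg_sigma_inv_def p.hom_mult[symmetric]
        del: p.hom_mult atLeastLessThan_iff)
qed

lemma alg_kappa_eq:
  assumes "i \<in> {1..<n}"
  shows "alg_kappa T q n i = \<one>\<^bsub>alg T q n\<^esub> \<ominus>\<^bsub>alg T q n\<^esub> alg_scalar T q n (1 / (q - inverse q))
    \<otimes>\<^bsub>alg T q n\<^esub> (alg_sigma T q n i \<ominus>\<^bsub>alg T q n\<^esub> alg_sigma_inv T q n i)"
proof -
  interpret kB: ring "kB n" by (rule ring_kB)
  interpret p: ring_hom_ring "kB n" "alg T q n" "alg_proj T q n" by (rule alg_proj_hom)
  show ?thesis
    using assms by (simp add: alg_sigma_def alg_sigma_inv_def alg_kappa_def alg_scalar_def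
        kB_kappa_def alg_proj_minus del: atLeastLessThan_iff)
qed

text \<open>Multiplying the quadratic relation by the inverse generator gives \<sigma> -
  \<sigma>^(-1) = q - q^(-1), which is the vanishing of \<kappa>.\<close>

lemma alg_kappa_Hecke:
  assumes q: "q \<noteq> 0" "q\<^sup>2 \<noteq> 1" and i: "i \<in> {1..<n}"
  shows "alg_kappa Hecke q n i = \<zero>\<^bsub>alg Hecke q n\<^esub>"
proof -
  interpret kB: ring "kB n" by (rule ring_kB)
  interpret p: ring_hom_ring "kB n" "alg Hecke q n" "alg_proj Hecke q n" by (rule alg_proj_hom)
  interpret scalar_ring "alg Hecke q n" "alg_scalar Hecke q n" by (rule scalar_ring_alg)
  note st = alg_sigma_inverse and closed = alg_generators_closed
  let ?z = "q - inverse q"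
  have z: "?z \<noteq> 0" using q by (auto simp: field_simps power2_eq_square)
  let ?s = "alg_sigma Hecke q n i" and ?t = "alg_sigma_inv Hecke q n i"
  have "alg_proj Hecke q n (kB_sigma n i \<otimes>\<^bsub>kB n\<^esub> kB_sigma n i) =
    alg_proj Hecke q n (kB_scalar n ?z \<otimes>\<^bsub>kB n\<^esub> kB_sigma n i \<oplus>\<^bsub>kB n\<^esub> \<one>\<^bsub>kB n\<^esub>)"
    using i by (intro alg_proj_eq) auto
  then have ss: "?s \<otimes>\<^bsub>alg Hecke q n\<^esub> ?s = smult ?z ?s \<oplus>\<^bsub>alg Hecke q n\<^esub> \<one>\<^bsub>alg Hecke q n\<^esub>"
    using i by (simp add: alg_sigma_def alg_scalar_def smult_def del: atLeastLessThan_iff)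
  have "?s = ?s \<otimes>\<^bsub>alg Hecke q n\<^esub> ?s \<otimes>\<^bsub>alg Hecke q n\<^esub> ?t"
    using st[OF i, of Hecke q] closed[OF i, of Hecke q] by (simp add: p.S.m_assoc)
  also have "\<dots> = smult ?z \<one>\<^bsub>alg Hecke q n\<^esub> \<oplus>\<^bsub>alg Hecke q n\<^esub> ?t"
    unfolding ss using st[OF i, of Hecke q] closed[OF i, of Hecke q] by (simp add: p.S.l_distr)
  finally have "?s \<ominus>\<^bsub>alg Hecke q n\<^esub> ?t = smult ?z \<one>\<^bsub>alg Hecke q n\<^esub>"
    using closed[OF i, of Hecke q] by (simp add: a_minus_def p.S.a_assoc p.S.r_neg)
  then show ?thesis
    unfolding alg_kappa_eq[OF i] using z by (simp add: smult_def[symmetric] a_minus_def p.S.r_neg)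
qed

lemma bmw_ring_alg:
  fixes q :: "'k::field"
  assumes q: "q \<noteq> 0" "q\<^sup>2 \<noteq> 1"
    and T: "T = Hecke \<or> (\<exists>\<nu>. T = BMW \<nu> \<and> \<nu> \<noteq> 0 \<and> (\<forall>j\<in>{1..<n}. \<nu> \<noteq> q ^ (2 * j - 1)))"
  shows "bmw_ring (alg T q n) (alg_scalar T q n) q (tower_nu T) n
    (alg_sigma T q n) (alg_sigma_inv T q n) (alg_kappa T q n)"
proof -
  interpret kB: ring "kB n" by (rule ring_kB)
  interpret p: ring_hom_ring "kB n" "alg T q n" "alg_proj T q n" by (rule alg_proj_hom)
  interpret scalar_ring "alg T q n" "alg_scalar T q n" by (rule scalar_ring_alg)
  note defs = alg_sigma_def alg_sigma_inv_def alg_kappa_def alg_scalar_def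
  note hom = p.hom_mult[symmetric]
  note st = alg_sigma_inverse and closed = alg_generators_closed
  have kappa_Hecke: "alg_kappa T q n i = \<zero>\<^bsub>alg T q n\<^esub>" if "T = Hecke" "i \<in> {1..<n}" for i
    using that alg_kappa_Hecke[OF q] by simp
  have BMW: "alg_kappa T q n i \<otimes>\<^bsub>alg T q n\<^esub> alg_sigma T q n i =
        alg_scalar T q n (tower_nu T) \<otimes>\<^bsub>alg T q n\<^esub> alg_kappa T q n i \<and>
      alg_sigma T q n i \<otimes>\<^bsub>alg T q n\<^esub> alg_kappa T q n i =
        alg_scalar T q n (tower_nu T) \<otimes>\<^bsub>alg T q n\<^esub> alg_kappa T q n i" if i: "i \<in> {1..<n}" for i
  proof (cases T)
    case Hecke
    show ?thesis using closed[OF i, of T q] kappa_Hecke[OF Hecke i] by simp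
  next
    case (BMW \<nu>)
    have "alg_proj T q n (kB_kappa q n i \<otimes>\<^bsub>kB n\<^esub> kB_sigma n i) =
        alg_proj T q n (kB_scalar n \<nu> \<otimes>\<^bsub>kB n\<^esub> kB_kappa q n i)"
      "alg_proj T q n (kB_sigma n i \<otimes>\<^bsub>kB n\<^esub> kB_kappa q n i) =
        alg_proj T q n (kB_scalar n \<nu> \<otimes>\<^bsub>kB n\<^esub> kB_kappa q n i)"
      using i unfolding BMW relators.simps by (intro alg_proj_eq; auto)+
    moreover have "tower_nu T = \<nu>" by (simp add: BMW)
    ultimately show ?thesis using i by (simp add: defs del: atLeastLessThan_iff)
  qed
  have BMW3: "alg_kappa T q n (Suc i) \<otimes>\<^bsub>alg T q n\<^esub> (alg_sigma T q n i \<otimes>\<^bsub>alg T q n\<^esub> alg_kappa T q n (Suc i)) =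
        alg_scalar T q n (inverse (tower_nu T)) \<otimes>\<^bsub>alg T q n\<^esub> alg_kappa T q n (Suc i) \<and>
      alg_kappa T q n (Suc i) \<otimes>\<^bsub>alg T q n\<^esub> (alg_sigma_inv T q n i \<otimes>\<^bsub>alg T q n\<^esub> alg_kappa T q n (Suc i)) =
        alg_scalar T q n (tower_nu T) \<otimes>\<^bsub>alg T q n\<^esub> alg_kappa T q n (Suc i)"
    if i: "1 \<le> i" "Suc i < n" for i
  proof -
    have mem: "i \<in> {1..<n}" "Suc i \<in> {1..<n}" "Suc i \<in> {2..<n}" "i = Suc i - 1" using i by auto
    show ?thesis
    proof (cases T)
      case Hecke
      show ?thesis
        using closed[OF mem(1), of T q] kappa_Hecke[OF Hecke mem(2)] by simp
    next
      case (BMW \<nu>)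
      have "alg_proj T q n (kB_kappa q n (Suc i) \<otimes>\<^bsub>kB n\<^esub> kB_sigma n i \<otimes>\<^bsub>kB n\<^esub> kB_kappa q n (Suc i)) =
          alg_proj T q n (kB_scalar n (inverse \<nu>) \<otimes>\<^bsub>kB n\<^esub> kB_kappa q n (Suc i))"
        "alg_proj T q n (kB_kappa q n (Suc i) \<otimes>\<^bsub>kB n\<^esub> kB_sigma_inv n i \<otimes>\<^bsub>kB n\<^esub> kB_kappa q n (Suc i)) =
          alg_proj T q n (kB_scalar n \<nu> \<otimes>\<^bsub>kB n\<^esub> kB_kappa q n (Suc i))"
      proof -
        \<comment> \<open>The relators are indexed by the upper of two neighbours and the locale by
          the lower one; \<open>Suc i - 1\<close> bridges the shift.\<close>
        have "kB_kappa q n (Suc i) \<otimes>\<^bsub>kB n\<^esub> kB_sigma n (Suc i - 1) \<otimes>\<^bsub>kB n\<^esub> kB_kappa q n (Suc i)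
            \<ominus>\<^bsub>kB n\<^esub> kB_scalar n (inverse \<nu>) \<otimes>\<^bsub>kB n\<^esub> kB_kappa q n (Suc i) \<in> relators T q n"
          "kB_kappa q n (Suc i) \<otimes>\<^bsub>kB n\<^esub> kB_sigma_inv n (Suc i - 1) \<otimes>\<^bsub>kB n\<^esub> kB_kappa q n (Suc i)
            \<ominus>\<^bsub>kB n\<^esub> kB_scalar n \<nu> \<otimes>\<^bsub>kB n\<^esub> kB_kappa q n (Suc i) \<in> relators T q n"
          unfolding BMW relators.simps using mem(3) by blast+
        note r = this[unfolded diff_Suc_1]
        show "alg_proj T q n (kB_kappa q n (Suc i) \<otimes>\<^bsub>kB n\<^esub> kB_sigma n i \<otimes>\<^bsub>kB n\<^esub> kB_kappa q n (Suc i)) =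
            alg_proj T q n (kB_scalar n (inverse \<nu>) \<otimes>\<^bsub>kB n\<^esub> kB_kappa q n (Suc i))"
          "alg_proj T q n (kB_kappa q n (Suc i) \<otimes>\<^bsub>kB n\<^esub> kB_sigma_inv n i \<otimes>\<^bsub>kB n\<^esub> kB_kappa q n (Suc i)) =
            alg_proj T q n (kB_scalar n \<nu> \<otimes>\<^bsub>kB n\<^esub> kB_kappa q n (Suc i))"
          by (intro alg_proj_eq kB.m_closed kB_closed kB_kappa_closed mem(1,2) r)+
      qed
      moreover have "tower_nu T = \<nu>" by (simp add: BMW)
      ultimately show ?thesis using mem(1,2)
        by (simp add: defs p.S.m_assoc del: atLeastLessThan_iff)
    qed
  qed
  show ?thesis
  proof
    show "(\<forall>i\<in>{1..<n}. alg_kappa T q n i = \<zero>\<^bsub>alg T q n\<^esub>) \<or>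
        tower_nu T \<noteq> 0 \<and> (\<forall>j\<in>{1..<n}. tower_nu T \<noteq> q ^ (2 * j - 1))"
      using T kappa_Hecke by auto
  next
    fix i j assume ij: "i \<in> {1..<n}" "j \<in> {1..<n}" "Suc i < j"
    then show "alg_sigma T q n i \<otimes>\<^bsub>alg T q n\<^esub> alg_sigma T q n j =
        alg_sigma T q n j \<otimes>\<^bsub>alg T q n\<^esub> alg_sigma T q n i"
      using kB_braid_relations(3)[OF ij, where ?'k = 'k]
      by (simp add: defs hom del: p.hom_mult atLeastLessThan_iff)
  next
    fix i assume "1 \<le> i" "Suc i < n"
    then have mem: "i \<in> {1..<n}" "Suc i \<in> {1..<n}" by auto
    then show "alg_sigma T q n i \<otimes>\<^bsub>alg T q n\<^esub> (alg_sigma T q n (Suc i) \<otimes>\<^bsub>alg T q n\<^esub> alg_sigma T q n i) =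
        alg_sigma T q n (Suc i) \<otimes>\<^bsub>alg T q n\<^esub> (alg_sigma T q n i \<otimes>\<^bsub>alg T q n\<^esub> alg_sigma T q n (Suc i))"
      using kB_braid_relations(4)[OF mem refl, where ?'k = 'k]
      by (simp add: defs hom del: p.hom_mult atLeastLessThan_iff)
  qed (assumption | rule q closed st alg_kappa_eq BMW[THEN conjunct1] BMW[THEN conjunct2]
      BMW3[THEN conjunct1] BMW3[THEN conjunct2])+
qed

lemma alg_character_props:
  assumes q: "q \<noteq> 0" "q\<^sup>2 \<noteq> 1"
  shows "x \<in> carrier (alg T q n) \<Longrightarrow> y \<in> carrier (alg T q n) \<Longrightarrow>
      alg_character q (x \<otimes>\<^bsub>alg T q n\<^esub> y) = alg_character q x * alg_character q y"
    and "x \<in> carrier (alg T q n) \<Longrightarrow> y \<in> carrier (alg T q n) \<Longrightarrow>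
      alg_character q (x \<oplus>\<^bsub>alg T q n\<^esub> y) = alg_character q x + alg_character q y"
    and "alg_character q (alg_scalar T q n a) = a"
    and "i \<in> {1..<n} \<Longrightarrow> alg_character q (alg_sigma T q n i) = q"
proof -
  interpret kB: ring "kB n" by (rule ring_kB)
  interpret p: ring_hom_ring "kB n" "alg T q n" "alg_proj T q n" by (rule alg_proj_hom)
  show "alg_character q (alg_scalar T q n a) = a"
    by (simp add: alg_scalar_def alg_character_proj[OF q] kB_character_generators[OF q(1)])
  show "alg_character q (alg_sigma T q n i) = q" if "i \<in> {1..<n}"
    using that by (simp add: alg_sigma_def alg_character_proj[OF q] kB_character_generators[OF q(1)]
        del: atLeastLessThan_iff)
  assume "x \<in> carrier (alg T q n)" "y \<in> carrier (alg T q n)"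
  then obtain f g where fg: "f \<in> carrier (kB n)" "g \<in> carrier (kB n)"
    "x = alg_proj T q n f" "y = alg_proj T q n g" unfolding carrier_alg by auto
  show "alg_character q (x \<otimes>\<^bsub>alg T q n\<^esub> y) = alg_character q x * alg_character q y"
    using fg by (simp add: p.hom_mult[symmetric] alg_character_proj[OF q] kB_character_hom[OF q(1)]
        del: p.hom_mult)
  show "alg_character q (x \<oplus>\<^bsub>alg T q n\<^esub> y) = alg_character q x + alg_character q y"
    using fg by (simp add: p.hom_add[symmetric] alg_character_proj[OF q] kB_character_hom[OF q(1)]
        del: p.hom_add)
qed

text \<open>Words act on \<open>S\<close> by their weight, and they span the algebra; so every
  element acts by a scalar. Uniqueness of the symmetrizer rests on this.\<close>

lemma alg_mult_eigenvector:
  fixes q :: "'k::field"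
  assumes q: "q \<noteq> 0" and S: "S \<in> carrier (alg T q n)"
    and eigen: "\<And>i. i \<in> {1..<n} \<Longrightarrow>
      alg_sigma T q n i \<otimes>\<^bsub>alg T q n\<^esub> S = alg_scalar T q n q \<otimes>\<^bsub>alg T q n\<^esub> S"
    and x: "x \<in> carrier (alg T q n)"
  shows "\<exists>a. x \<otimes>\<^bsub>alg T q n\<^esub> S = alg_scalar T q n a \<otimes>\<^bsub>alg T q n\<^esub> S"
proof -
  interpret kB: ring "kB n" by (rule ring_kB)
  interpret p: ring_hom_ring "kB n" "alg T q n" "alg_proj T q n" by (rule alg_proj_hom)
  interpret scalar_ring "alg T q n" "alg_scalar T q n" by (rule scalar_ring_alg)
  note [simp] = S
  have G: "Group.monoid (braid_group n)" by (intro group.is_monoid group_braid_group)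
  let ?b = "\<lambda>w. basis_elem (braid_cong n `` {w}) :: 'k braid_alg_elem"
  have b_closed: "?b w \<in> carrier (kB n)" if "w \<in> braid_words n" for w
    using that by (auto simp: kB_def group_algebra_carrier basis_elem_def carrier_braid_group
        simp del: Image_singleton_iff)
  have letter: "alg_proj T q n (?b [(i, e)]) \<otimes>\<^bsub>alg T q n\<^esub> S = smult (if e then q else inverse q) S"
    if i: "i \<in> {1..<n}" for i e
  proof (cases e)
    case True
    then show ?thesis using eigen[OF i] by (simp add: alg_sigma_def kB_sigma_def smult_def)
  next
    case False
    let ?s = "alg_sigma T q n i" and ?t = "alg_sigma_inv T q n i"
    note cl = alg_generators_closed[OF i, of T q]
    have "S = ?t \<otimes>\<^bsub>alg T q n\<^esub> (?s \<otimes>\<^bsub>alg T q n\<^esub> S)"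
      using cl alg_sigma_inverse[OF i, of T q] by (simp add: p.S.m_assoc[symmetric])
    also have "\<dots> = smult q (?t \<otimes>\<^bsub>alg T q n\<^esub> S)"
      unfolding eigen[OF i] using cl by (simp add: smult_def[symmetric])
    finally have "smult (inverse q) S = smult (inverse q) (smult q (?t \<otimes>\<^bsub>alg T q n\<^esub> S))" by simp
    then show ?thesis using False q cl by (simp add: alg_sigma_inv_def kB_sigma_inv_def)
  qed
  have word: "alg_proj T q n (?b w) \<otimes>\<^bsub>alg T q n\<^esub> S = smult (word_weight q w) S"
    if "w \<in> braid_words n" for w
    using that
  proof (induction w)
    case Nil
    show ?case by (simp add: kB_one[symmetric])
  next
    case (Cons y w)
    obtain i e where y: "y = (i, e)" by (cases y)
    have w: "i \<in> {1..<n}" "[y] \<in> braid_words n" "w \<in> braid_words n"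
      using Cons.prems by (auto simp: braid_words_def y)
    have "alg_proj T q n (?b (y # w)) = alg_proj T q n (?b [y]) \<otimes>\<^bsub>alg T q n\<^esub> alg_proj T q n (?b w)"
      using w b_closed kB_word_mult[OF w(2,3), where ?'k = 'k] by (simp flip: p.hom_mult)
    then have "alg_proj T q n (?b (y # w)) \<otimes>\<^bsub>alg T q n\<^esub> S =
        alg_proj T q n (?b [y]) \<otimes>\<^bsub>alg T q n\<^esub> smult (word_weight q w) S"
      using w b_closed Cons.IH by (simp add: p.S.m_assoc)
    also have "\<dots> = smult (word_weight q w) (smult (if e then q else inverse q) S)"
      using w b_closed[OF w(2)] letter[OF w(1), of e] by (simp add: y)
    finally show ?case by (simp add: y mult.commute)
  qed
  obtain f where f: "f \<in> carrier (kB n)" "x = alg_proj T q n f" using x unfolding carrier_alg by auto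
  have "f \<in> carrier (group_algebra (braid_group n))" using f(1) by (simp add: kB_def)
  then have "\<exists>a. alg_proj T q n f \<otimes>\<^bsub>alg T q n\<^esub> S = smult a S"
  proof (induction rule: group_algebra_induct)
    case zero
    have "(\<lambda>x. 0) = (\<zero>\<^bsub>kB n\<^esub> :: 'k braid_alg_elem)" by (simp add: kB_def group_algebra_def)
    then show ?case by (intro exI[of _ 0]) simp
  next
    case (add f g c)
    have f: "f \<in> carrier (kB n)" using add.hyps by (simp add: kB_def)
    obtain w where w: "w \<in> braid_words n" "g = braid_cong n `` {w}"
      using add.hyps by (auto simp: carrier_braid_group)
    obtain a where a: "alg_proj T q n f \<otimes>\<^bsub>alg T q n\<^esub> S = smult a S" using add.IH by blast
    have "(\<lambda>x. f x + c * basis_elem g x) = f \<oplus>\<^bsub>kB n\<^esub> (kB_scalar n c \<otimes>\<^bsub>kB n\<^esub> ?b w)"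
      using scalar_elem_mult(1)[OF G b_closed[OF w(1), unfolded kB_def], of c]
      by (simp add: kB_scalar_def kB_def w(2)) (simp add: group_algebra_def)
    then have "alg_proj T q n (\<lambda>x. f x + c * basis_elem g x) =
        alg_proj T q n f \<oplus>\<^bsub>alg T q n\<^esub> smult c (alg_proj T q n (?b w))"
      using f b_closed[OF w(1)] by (simp add: smult_def alg_scalar_def)
    then have "alg_proj T q n (\<lambda>x. f x + c * basis_elem g x) \<otimes>\<^bsub>alg T q n\<^esub> S =
        smult (a + c * word_weight q w) S"
      using f b_closed[OF w(1)] by (simp add: p.S.l_distr a word[OF w(1)] add_smult)
    then show ?case by blast
  qed
  then show ?thesis using f(2) by (simp add: smult_def)
qed

section \<open>Compatibility of the Baxterized products with the maps of the tower\<close>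

lemma alg_map_minus:
  assumes "m \<le> n" "x \<in> carrier (alg T q m)" "y \<in> carrier (alg T q m)"
  shows "alg_map T q n (x \<ominus>\<^bsub>alg T q m\<^esub> y) = alg_map T q n x \<ominus>\<^bsub>alg T q n\<^esub> alg_map T q n y"
proof -
  interpret ring_hom_ring "alg T q m" "alg T q n" "alg_map T q n"
    by (intro ring_hom_ringI2 ring_alg alg_map_hom assms(1))
  show ?thesis using assms by (simp add: a_minus_def)
qed

lemma alg_map_sigma_inv:
  "m \<le> n \<Longrightarrow> i \<in> {1..<m} \<Longrightarrow> alg_map T q n (alg_sigma_inv T q m i) = alg_sigma_inv T q n i"
  and alg_map_kappa:
  "m \<le> n \<Longrightarrow> i \<in> {1..<m} \<Longrightarrow> alg_map T q n (alg_kappa T q m i) = alg_kappa T q n i"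
  unfolding alg_sigma_inv_def alg_kappa_def
  by (simp_all add: alg_map_proj push_kB_sigma push_kB_kappa del: atLeastLessThan_iff)

lemma alg_scalar_closed: "alg_scalar T q n a \<in> carrier (alg T q n)"
  using scalar_ring.c_closed[OF scalar_ring_alg] .

lemma baxter_closed:
  assumes "i \<in> {1..<n}"
  shows "baxter T q n i x \<in> carrier (alg T q n)"
proof (cases T)
  case Hecke
  interpret ring "alg Hecke q n" by (rule ring_alg)
  show ?thesis unfolding Hecke
    using alg_generators_closed[OF assms, of Hecke q] by (simp add: Let_def alg_scalar_closed)
next
  case (BMW \<nu>)
  interpret ring "alg (BMW \<nu>) q n" by (rule ring_alg)
  show ?thesis unfolding BMW
    using alg_generators_closed[OF assms, of "BMW \<nu>" q] by (simp add: Let_def alg_scalar_closed)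
qed

lemma qSh_closed: "k < n \<or> k = 0 \<Longrightarrow> qSh T q n k \<in> carrier (alg T q n)"
proof (induction k)
  case 0
  interpret ring "alg T q n" by (rule ring_alg)
  show ?case by simp
next
  case (Suc k)
  interpret ring "alg T q n" by (rule ring_alg)
  show ?case using Suc by (auto intro!: baxter_closed m_closed)
qed

lemma qSigma_closed: "m \<le> n \<Longrightarrow> qSigma T q n m \<in> carrier (alg T q n)"
proof (induction m)
  case 0
  interpret ring "alg T q n" by (rule ring_alg)
  show ?case by simp
next
  case (Suc k)
  interpret ring "alg T q n" by (rule ring_alg)
  show ?case using Suc by (auto intro!: qSh_closed m_closed)
qed

lemma alg_map_baxter:
  assumes "m \<le> n" "i \<in> {1..<m}"
  shows "alg_map T q n (baxter T q m i x) = baxter T q n i x"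
proof (cases T)
  case Hecke
  interpret ring_hom_ring "alg Hecke q m" "alg Hecke q n" "alg_map Hecke q n"
    by (intro ring_hom_ringI2 ring_alg alg_map_hom assms(1))
  show ?thesis unfolding Hecke
    using alg_generators_closed[OF assms(2), of Hecke q] alg_map_generators(1)[OF assms, of Hecke q]
    by (simp add: Let_def alg_scalar_closed alg_map_minus[OF assms(1)] alg_map_generators(2)[OF assms(1)]
        alg_map_sigma_inv[OF assms])
next
  case (BMW \<nu>)
  interpret ring_hom_ring "alg (BMW \<nu>) q m" "alg (BMW \<nu>) q n" "alg_map (BMW \<nu>) q n"
    by (intro ring_hom_ringI2 ring_alg alg_map_hom assms(1))
  show ?thesis unfolding BMW
    using alg_generators_closed[OF assms(2), of "BMW \<nu>" q] alg_map_generators(1)[OF assms, of "BMW \<nu>" q]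
    by (simp add: Let_def alg_scalar_closed alg_map_generators(2)[OF assms(1)] alg_map_kappa[OF assms])
qed

lemma alg_map_qSh:
  assumes "m \<le> n"
  shows "k < m \<or> k = 0 \<Longrightarrow> alg_map T q n (qSh T q m k) = qSh T q n k"
proof (induction k)
  case 0
  interpret ring_hom_ring "alg T q m" "alg T q n" "alg_map T q n"
    by (intro ring_hom_ringI2 ring_alg alg_map_hom assms)
  show ?case by simp
next
  case (Suc k)
  interpret ring_hom_ring "alg T q m" "alg T q n" "alg_map T q n"
    by (intro ring_hom_ringI2 ring_alg alg_map_hom assms)
  show ?case using Suc by (simp add: qSh_closed baxter_closed alg_map_baxter[OF assms])
qed

lemma alg_map_qSigma:
  assumes "m \<le> n"
  shows "k \<le> m \<Longrightarrow> alg_map T q n (qSigma T q m k) = qSigma T q n k"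
proof (induction k)
  case 0
  interpret ring_hom_ring "alg T q m" "alg T q n" "alg_map T q n"
    by (intro ring_hom_ringI2 ring_alg alg_map_hom assms)
  show ?case by simp
next
  case (Suc k)
  interpret ring_hom_ring "alg T q m" "alg T q n" "alg_map T q n"
    by (intro ring_hom_ringI2 ring_alg alg_map_hom assms)
  show ?case using Suc by (simp add: qSh_closed qSigma_closed alg_map_qSh[OF assms])
qed

text \<open>For BMW both sides have the same formula. For Hecke, putting \<sigma>^(-1) = \<sigma> -
  z into (x \<sigma> - x^(-1) \<sigma>^(-1)) / z leaves x^(-1) (1 + (x^2 - 1) / z \<sigma>).\<close>

lemma baxter_eq_bax:
  fixes q :: "'k::field"
  assumes "bmw_ring (alg T q n) (alg_scalar T q n) q (tower_nu T) n
      (alg_sigma T q n) (alg_sigma_inv T q n) (alg_kappa T q n)"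
    and i: "i \<in> {1..<n}"
  shows "baxter T q n i (q ^ j) = bmw_ring.bax (alg T q n) (alg_scalar T q n) q (tower_nu T)
      (alg_sigma T q n) (alg_kappa T q n) i j"
proof -
  interpret bmw_ring "alg T q n" "alg_scalar T q n" q "tower_nu T" n
    "alg_sigma T q n" "alg_sigma_inv T q n" "alg_kappa T q n" by fact
  have qj: "q ^ (2 * j) = (q ^ j)\<^sup>2" by (simp add: power_even_eq)
  show ?thesis
  proof (cases T)
    case (BMW \<nu>)
    show ?thesis unfolding bax_def qj smult_def z_def by (simp add: BMW Let_def)
  next
    case Hecke
    define x where "x = q ^ j"
    have x: "x \<noteq> 0" using q_nz by (simp add: x_def)
    let ?s = "alg_sigma T q n i" and ?t = "alg_sigma_inv T q n i"
    have K: "alg_kappa T q n i = \<zero>\<^bsub>alg T q n\<^esub>"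
      using alg_kappa_Hecke[OF q_nz q2 i] Hecke by simp
    have t: "?t = ?s \<oplus>\<^bsub>alg T q n\<^esub> smult (- z) \<one>\<^bsub>alg T q n\<^esub>"
      using t_expand[OF i] s_closed[OF i] by (simp add: K)
    have "baxter T q n i x = smult (1 / z) (smult x ?s \<ominus>\<^bsub>alg T q n\<^esub> smult (inverse x) ?t)"
      unfolding smult_def z_def by (simp add: Hecke Let_def)
    also have "\<dots> = smult (inverse x) \<one>\<^bsub>alg T q n\<^esub> \<oplus>\<^bsub>alg T q n\<^esub>
        (smult (1 / z * x) ?s \<oplus>\<^bsub>alg T q n\<^esub> smult (1 / z * - inverse x) ?s)"
      using s_closed[OF i] z_nz by (simp add: t minus_smult smult_add a_ac)
    also have "smult (1 / z * x) ?s \<oplus>\<^bsub>alg T q n\<^esub> smult (1 / z * - inverse x) ?s =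
        smult (inverse x * ((x\<^sup>2 - 1) / z)) ?s"
    proof -
      have "1 / z * x + 1 / z * - inverse x = inverse x * ((x\<^sup>2 - 1) / z)"
        using x z_nz by (simp add: field_simps power2_eq_square)
      then show ?thesis using s_closed[OF i] by (simp only: add_smult[symmetric])
    qed
    also have "smult (inverse x) \<one>\<^bsub>alg T q n\<^esub> \<oplus>\<^bsub>alg T q n\<^esub> smult (inverse x * ((x\<^sup>2 - 1) / z)) ?s = bax i j"
      unfolding bax_def qj x_def[symmetric] using s_closed[OF i] by (simp add: K smult_add)
    finally show ?thesis by (simp add: x_def)
  qed
qed

section \<open>The symmetrizer: existence, uniqueness and recurrence\<close>

lemma qsuperfact_nonzero:
  fixes q :: "'k::field"
  assumes "q \<noteq> 0" "q\<^sup>2 \<noteq> 1" "\<forall>k\<in>{2..n}. qint q k \<noteq> 0"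
  shows "qsuperfact q n \<noteq> 0"
proof -
  have "q - inverse q \<noteq> 0" using assms(1,2) by (auto simp: field_simps power2_eq_square)
  then have "qint q 1 \<noteq> 0" by (simp add: qint_def)
  then have nz: "qint q k \<noteq> 0" if "k \<in> {1..n}" for k
    using assms(3) that by (cases "k = 1") auto
  then have "qfact q m \<noteq> 0" if "m \<le> n" for m
    using that by (auto simp: qfact_def)
  then show ?thesis by (auto simp: qsuperfact_def)
qed

lemma symmetrizer_formula:
  fixes q :: "'k::field"
  assumes q: "q \<noteq> 0" "q\<^sup>2 \<noteq> 1" and nz: "qsuperfact q n \<noteq> 0"
    and T: "T = Hecke \<or> (\<exists>\<nu>. T = BMW \<nu> \<and> \<nu> \<noteq> 0 \<and> (\<forall>j\<in>{1..<n}. \<nu> \<noteq> q ^ (2 * j - 1)))"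
  defines "S \<equiv> alg_scalar T q n (1 / qsuperfact q n) \<otimes>\<^bsub>alg T q n\<^esub> qSigma T q n n"
  shows "is_symmetrizer T q n S" and "is_symmetrizer T q n X \<Longrightarrow> X = S"
proof -
  interpret bmw_ring "alg T q n" "alg_scalar T q n" q "tower_nu T" n
    "alg_sigma T q n" "alg_sigma_inv T q n" "alg_kappa T q n"
    using q T by (rule bmw_ring_alg)
  let ?A = "alg T q n" and ?N = "qsuperfact q n"
  have qSh: "qSh T q n k = sh_prod ?A (\<lambda>k. baxter T q n k (q ^ k)) k" for k
    by (induction k) auto
  have "qSigma T q n m = sigma_prod ?A (\<lambda>k. baxter T q n k (q ^ k)) m" for m
    by (induction m) (auto simp: qSh)
  also have "sigma_prod ?A (\<lambda>k. baxter T q n k (q ^ k)) n = Sg n"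
    by (intro sigma_prod_cong baxter_eq_bax bmw_ring_axioms) auto
  finally have S: "S = smult (1 / ?N) (Sg n)" by (simp add: S_def smult_def)
  have cl [simp]: "S \<in> carrier ?A" by (simp add: S)
  have left: "alg_sigma T q n i \<otimes>\<^bsub>?A\<^esub> S = smult q S" if "i \<in> {1..<n}" for i
    using s_Sg_eigen[of n i] that by (simp add: S mult.commute)
  have right: "S \<otimes>\<^bsub>?A\<^esub> alg_sigma T q n i = smult q S" if "i \<in> {1..<n}" for i
    using Sg_s_eigen[OF nz that] that by (simp add: S mult.commute)
  \<comment> \<open>After normalization \<open>S\<close> is a right identity on all right
    eigenvectors. With Y = \<open>S\<close> this is idempotency, and with another symmetrizer it
    prepares uniqueness.\<close>
  have absorb: "Y \<otimes>\<^bsub>?A\<^esub> S = Y"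
    if "Y \<in> carrier ?A" "\<And>i. i \<in> {1..<n} \<Longrightarrow> Y \<otimes>\<^bsub>?A\<^esub> alg_sigma T q n i = smult q Y" for Y
    using eigen_Sg[OF that order_refl] that(1) nz by (simp add: S)
  have "alg_character q (Sg n) = ?N"
    by (rule character_Sg) (simp_all only: alg_character_props[OF q] order_refl)
  then have "alg_character q S = 1 / ?N * ?N"
    using alg_character_props(1)[OF q c_closed Sg_closed, of n "1 / ?N"]
    by (simp add: S smult_def alg_character_props(3)[OF q])
  then have "alg_character q S \<noteq> 0" using nz by simp
  moreover have "alg_character q \<zero>\<^bsub>?A\<^esub> = 0"
    using alg_character_props(3)[OF q, of T n 0] by (simp add: c_zero)
  ultimately have S_nz: "S \<noteq> \<zero>\<^bsub>?A\<^esub>" by auto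
  show "is_symmetrizer T q n S"
    unfolding is_symmetrizer_def using S_nz left right absorb[OF cl right] by (simp add: smult_def)
  assume X: "is_symmetrizer T q n X"
  then have X_cl [simp]: "X \<in> carrier ?A" and XX: "X \<otimes>\<^bsub>?A\<^esub> X = X" and X_nz: "X \<noteq> \<zero>\<^bsub>?A\<^esub>"
    and X_s: "\<And>i. i \<in> {1..<n} \<Longrightarrow> X \<otimes>\<^bsub>?A\<^esub> alg_sigma T q n i = smult q X"
    by (simp_all only: is_symmetrizer_def smult_def simp_thms)
  \<comment> \<open>The product is a multiple of \<open>S\<close> because \<open>S\<close> is a left
    eigenvector, and it equals \<open>X\<close> because \<open>X\<close> is a right one.\<close>
  obtain a where "X \<otimes>\<^bsub>?A\<^esub> S = smult a S"
    using alg_mult_eigenvector[OF q(1) cl left[unfolded smult_def] X_cl] unfolding smult_def by blast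
  then have Xa: "X = smult a S" using absorb[OF X_cl X_s] by simp
  \<comment> \<open>Both \<open>X\<close> and \<open>S\<close> are idempotent; cancelling one factor
    a then identifies them.\<close>
  have "smult (a * a) S = smult a S"
    using XX absorb[OF cl right] by (simp add: Xa)
  moreover have "a \<noteq> 0" using X_nz unfolding Xa by auto
  ultimately have "smult a S = S"
    by (intro smult_cancel[of a "smult a S" S]) simp_all
  then show "X = S" using Xa by (rule trans[rotated])
qed

theorem mainTheorem2:
  fixes q :: "'k::field" and n :: nat and T :: "'k tower"
  assumes "n \<ge> 1"
    and "q \<noteq> 0" and "q\<^sup>2 \<noteq> 1"
    and "\<forall>k\<in>{2..n}. qint q k \<noteq> 0"
    and "T = Hecke \<or>
         (\<exists>\<nu>. T = BMW \<nu> \<and> \<nu> \<notin> {0, q, - inverse q} \<and> (\<forall>j\<in>{1..n - 1}. \<nu> \<noteq> q ^ (2 * j - 1)))"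
  shows "(\<exists>!S. is_symmetrizer T q n S) \<and>
         symmetrizer T q n =
           alg_scalar T q n (1 / qsuperfact q n) \<otimes>\<^bsub>alg T q n\<^esub> qSigma T q n n \<and>
         (n \<ge> 2 \<longrightarrow>
           symmetrizer T q n =
             alg_scalar T q n (1 / qfact q n) \<otimes>\<^bsub>alg T q n\<^esub> qSh T q n (n - 1)
               \<otimes>\<^bsub>alg T q n\<^esub> alg_map T q n (symmetrizer T q (n - 1)))"
proof -
  \<comment> \<open>The hypotheses pass to every m up to n; the recurrence also needs the formula
    for the preceding algebra of the tower.\<close>
  have T: "T = Hecke \<or> (\<exists>\<nu>. T = BMW \<nu> \<and> \<nu> \<noteq> 0 \<and> (\<forall>j\<in>{1..<m}. \<nu> \<noteq> q ^ (2 * j - 1)))"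
    if "m \<le> n" for m
  proof -
    have "{1..<m} \<subseteq> {1..n - 1}" using that by auto
    then show ?thesis using assms(5) by blast
  qed
  have nz: "qsuperfact q m \<noteq> 0" if "m \<le> n" for m
    using that assms(4) by (intro qsuperfact_nonzero[OF assms(2,3)]) auto
  have ex1: "\<exists>!S. is_symmetrizer T q m S" if "m \<le> n" for m
    using symmetrizer_formula[OF assms(2,3) nz[OF that] T[OF that]] by (rule ex1I)
  have formula: "symmetrizer T q m =
      alg_scalar T q m (1 / qsuperfact q m) \<otimes>\<^bsub>alg T q m\<^esub> qSigma T q m m" if "m \<le> n" for m
    unfolding symmetrizer_def
    using symmetrizer_formula[OF assms(2,3) nz[OF that] T[OF that]] by (rule the_equality)
  have "symmetrizer T q n = alg_scalar T q n (1 / qfact q n) \<otimes>\<^bsub>alg T q n\<^esub> qSh T q n (n - 1)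
      \<otimes>\<^bsub>alg T q n\<^esub> alg_map T q n (symmetrizer T q (n - 1))"
  proof -
    define m where "m = n - 1"
    have n: "n = Suc m" using assms(1) by (simp add: m_def)
    then have m: "m \<le> n" "m < n" by simp_all
    interpret scalar_ring "alg T q n" "alg_scalar T q n" by (rule scalar_ring_alg)
    interpret h: ring_hom_ring "alg T q m" "alg T q n" "alg_map T q n"
      by (intro ring_hom_ringI2 ring_alg alg_map_hom m)
    have cl [simp]: "qSh T q n m \<in> carrier (alg T q n)" "qSigma T q n m \<in> carrier (alg T q n)"
      "qSigma T q m m \<in> carrier (alg T q m)"
      using m by (simp_all add: qSh_closed qSigma_closed)
    \<comment> \<open>The tower map sends scalars to scalars and the product computed in the smaller
      algebra to the same product in the larger one.\<close>
    have map: "alg_map T q n (symmetrizer T q m) = smult (1 / qsuperfact q m) (qSigma T q n m)"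
      using alg_map_qSigma[OF m(1) order_refl, of T q] alg_map_generators(2)[OF m(1), of T q]
      by (simp add: formula[OF m(1)] alg_scalar_closed smult_def)
    \<comment> \<open>Both the product and its normalization split at the top: one shuffle factor
      against one quantum factorial.\<close>
    have "qSigma T q n n = qSh T q n m \<otimes>\<^bsub>alg T q n\<^esub> qSigma T q n m"
      "qsuperfact q n = qsuperfact q m * qfact q n"
      using qSigma.simps(2)[of T q n m] qsuperfact_Suc[of q m] unfolding n[symmetric] .
    then have "symmetrizer T q n = smult (1 / qfact q n * (1 / qsuperfact q m))
        (qSh T q n m \<otimes>\<^bsub>alg T q n\<^esub> qSigma T q n m)"
      using formula[OF order_refl] by (simp add: smult_def mult.commute)
    then show ?thesis unfolding m_def[symmetric]
      by (simp add: map smult_def[symmetric] mult.commute)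
  qed
  then show ?thesis using ex1[OF order_refl] formula[OF order_refl] by simp
qed

end
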